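(* Let $\mathbf M_n=(X_{n,ij})_{i,j\in[n]}$ be a real symmetric random (Wigner) matrix whose upper triangular entries $\{X_{n,ij}:1\le i\le j\le n\}$ are i.i.d. with common distribution $\mathcal P$ having a density $f$, mean zero and variance $\sigma^2$, and such that there exists a constant $\beta\in(0,\infty)$ with $\mathbb E_{\mathcal P}|X|^k\le\sigma^kk^{\beta k}$ for all positive integers $k$. Then the problem sequence of minimizing $\boldsymbol v^\top\mathbf M_n\boldsymbol v$ over $\boldsymbol v\in\mathcal S_n$ is stable under small perturbations with perturbation blocks $\mathcal J_n=\{J_{n,i}:i\in[n]\}$, where $J_{n,i}=\{(i,j):j\ge i\}\cup\{(j,i):j\le i\}$ (with $j\in[n]$) for all $i\in[n]$.
   Context: Parameter space: $\mathcal S_n=\{\boldsymbol v=(v_1,\dots,v_n)\in\mathbb R^n:\|\boldsymbol v\|_2=1,\ v_1\ge0\}$ with $d_n$ the Euclidean distance. The input index set is $I_n=\{(i,j):1\le i\le j\le n\}$ (upper triangular entries; changing the $(i,j)$ input changes both $X_{n,ij}$ and $X_{n,ji}$), and $\mathbf X^n=(X_{n,ij})_{i\le j}$. The minimizer is almost surely unique, denoted $\widehat{\boldsymbol v}(\mathbf X^n)$ (the unit eigenvector for the smallest eigenvalue). $[n]=\{1,\dots,n\}$; $\mathbb E_{\mathcal P}$ is expectation for $X\sim\mathcal P$. Stability. $\mathcal J_n=\{J_{n,l}:l\in\mathcal L_n\}$ is a finite family of subsets of $I_n$ with union $I_n$; $m_n=\operatorname{card}(\mathcal L_n)$. For each $l$,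 $\mathbf X^{n,l}$ is an independent copy of $\mathbf X^n$ (no further assumption on the joint law over $l$), and $\mathbf X^n_l$ is $\mathbf X^n$ with the coordinates in $J_{n,l}$ replaced by those of $\mathbf X^{n,l}$. For a metric $\mathsf d$, $P(T,\mathsf d,\varepsilon)$ is the largest cardinality of a subset of $T$ with pairwise distances $>\varepsilon$. With $\mathcal O_{n,A}=\{\widehat{\boldsymbol v}(\mathbf X^n_l):l\in A\}$, the sequence is stable under small perturbations with perturbation blocks $\mathcal J_n$ if for any $\varepsilon,\delta>0$ there is $M(\varepsilon,\delta)<\infty$ with $\limsup_{n\to\infty}\mathbb P[\min_{A\subseteq\mathcal L_n:|A|>(1-\varepsilon)m_n}P(\mathcal O_{n,A},d_n,\varepsilon)\ge M(\varepsilon,\delta)]\le\delta$. *)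

theory Defs
  imports "HOL-Probability.Probability"
begin

section \<open>Packing numbers\<close>

text \<open>Finite subsets suffice: if arbitrarily large finite separated subsets exist, the value
  is \<open>\<infinity>\<close>.  Note that \<^const>\<open>pairwise\<close> only compares distinct points.\<close>

definition packing_number :: "'v set \<Rightarrow> ('v \<Rightarrow> 'v \<Rightarrow> real) \<Rightarrow> real \<Rightarrow> enat" where
  "packing_number T d \<epsilon> =
     (SUP S \<in> {S. S \<subseteq> T \<and> finite S \<and> pairwise (\<lambda>x y. d x y > \<epsilon>) S}. enat (card S))"


section \<open>Resampled inputs and stability under small perturbations\<close>

text \<open>An input is a family \<open>X\<close> of real random variables indexed by a finite set \<open>I\<close>; only the
  coordinates in \<open>I\<close> matter, so as a random vector it takes values in the product space
  over \<open>I\<close>.\<close>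

definition random_vector :: "'i set \<Rightarrow> ('i \<Rightarrow> 'w \<Rightarrow> real) \<Rightarrow> 'w \<Rightarrow> 'i \<Rightarrow> real" where
  "random_vector I X \<omega> = (\<lambda>p\<in>I. X p \<omega>)"

text \<open>Measurability of both vectors is part of \<^const>\<open>prob_space.indep_var\<close>.\<close>

definition independent_copy ::
    "'w measure \<Rightarrow> 'i set \<Rightarrow> ('i \<Rightarrow> 'w \<Rightarrow> real) \<Rightarrow> ('i \<Rightarrow> 'w \<Rightarrow> real) \<Rightarrow> bool" where
  "independent_copy M I X Y \<longleftrightarrow>
     prob_space.indep_var M (Pi\<^sub>M I (\<lambda>_. borel)) (random_vector I X)
                            (Pi\<^sub>M I (\<lambda>_. borel)) (random_vector I Y) \<and>
     distr M (Pi\<^sub>M I (\<lambda>_. borel)) (random_vector I Y) =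
     distr M (Pi\<^sub>M I (\<lambda>_. borel)) (random_vector I X)"

definition resample :: "'i set \<Rightarrow> ('i \<Rightarrow> 'w \<Rightarrow> real) \<Rightarrow> ('i \<Rightarrow> 'w \<Rightarrow> real) \<Rightarrow> 'i \<Rightarrow> 'w \<Rightarrow> real" where
  "resample J X Y p = (if p \<in> J then Y p else X p)"

definition perturbation_blocks :: "'i set \<Rightarrow> 'l set \<Rightarrow> ('l \<Rightarrow> 'i set) \<Rightarrow> bool" where
  "perturbation_blocks I L J \<longleftrightarrow> finite L \<and> (\<Union>l\<in>L. J l) = I"

text \<open>\<open>opt x\<close> is the minimizer for the input \<open>x\<close>.  Both infima range over finite sets, so they
  are minima.\<close>

definition min_packing_of_optima ::
    "'i set \<Rightarrow> 'l set \<Rightarrow> ('l \<Rightarrow> 'i set) \<Rightarrow> ('v \<Rightarrow> 'v \<Rightarrow> real) \<Rightarrow> (('i \<Rightarrow> real) \<Rightarrow> 'v) \<Rightarrow>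
     ('i \<Rightarrow> 'w \<Rightarrow> real) \<Rightarrow> ('l \<Rightarrow> 'i \<Rightarrow> 'w \<Rightarrow> real) \<Rightarrow> real \<Rightarrow> 'w \<Rightarrow> enat" where
  "min_packing_of_optima I L J d opt X Y \<epsilon> \<omega> =
     (INF A \<in> {A. A \<subseteq> L \<and> real (card A) > (1 - \<epsilon>) * real (card L)}.
        packing_number ((\<lambda>l. opt (random_vector I (resample (J l) X (Y l)) \<omega>)) ` A) d \<epsilon>)"

text \<open>The \<open>n\<close>-th problem lives on its own probability space \<open>M n\<close>.  The probability is taken as
  \<^const>\<open>outer_measure_of\<close>, which equals the measure on measurable events and never
  underestimates otherwise: since \<open>opt\<close> may involve an arbitrary choice where the minimizer is
  not unique, the event need only be measurable up to a null set.\<close>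

definition stable_under_small_perturbations ::
    "(nat \<Rightarrow> 'w measure) \<Rightarrow> (nat \<Rightarrow> 'i set) \<Rightarrow> (nat \<Rightarrow> 'l set) \<Rightarrow> (nat \<Rightarrow> 'l \<Rightarrow> 'i set) \<Rightarrow>
     (nat \<Rightarrow> 'v \<Rightarrow> 'v \<Rightarrow> real) \<Rightarrow> (nat \<Rightarrow> ('i \<Rightarrow> real) \<Rightarrow> 'v) \<Rightarrow>
     (nat \<Rightarrow> 'i \<Rightarrow> 'w \<Rightarrow> real) \<Rightarrow> (nat \<Rightarrow> 'l \<Rightarrow> 'i \<Rightarrow> 'w \<Rightarrow> real) \<Rightarrow> bool" where
  "stable_under_small_perturbations M I L J d opt X Y \<longleftrightarrow>
     (\<forall>n. perturbation_blocks (I n) (L n) (J n)) \<and>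
     (\<forall>\<epsilon>>0. \<forall>\<delta>>0. \<exists>K::nat.
        limsup (\<lambda>n. outer_measure_of (M n)
          {\<omega> \<in> space (M n).
             min_packing_of_optima (I n) (L n) (J n) (d n) (opt n) (X n) (Y n) \<epsilon> \<omega> \<ge> enat K})
        \<le> ennreal \<delta>)"


section \<open>Minimizing the quadratic form of a symmetric matrix over the half-sphere\<close>

text \<open>Vectors in \<open>\<real>\<^sup>n\<close> are functions on \<open>{1..n}\<close> (extensional, so that equality is equality of
  coordinates).\<close>

definition half_sphere :: "nat \<Rightarrow> (nat \<Rightarrow> real) set" where
  "half_sphere n = {v \<in> {1..n} \<rightarrow>\<^sub>E UNIV. L2_set v {1..n} = 1 \<and> v 1 \<ge> 0}"

definition euclid_dist :: "nat \<Rightarrow> (nat \<Rightarrow> real) \<Rightarrow> (nat \<Rightarrow> real) \<Rightarrow> real" where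
  "euclid_dist n v w = L2_set (\<lambda>i. v i - w i) {1..n}"

definition upper_indices :: "nat \<Rightarrow> (nat \<times> nat) set" where
  "upper_indices n = {(i, j). 1 \<le> i \<and> i \<le> j \<and> j \<le> n}"

definition sym_matrix :: "(nat \<times> nat \<Rightarrow> real) \<Rightarrow> nat \<Rightarrow> nat \<Rightarrow> real" where
  "sym_matrix x i j = (if i \<le> j then x (i, j) else x (j, i))"

definition quadratic_form :: "nat \<Rightarrow> (nat \<Rightarrow> nat \<Rightarrow> real) \<Rightarrow> (nat \<Rightarrow> real) \<Rightarrow> real" where
  "quadratic_form n A v = (\<Sum>i\<in>{1..n}. \<Sum>j\<in>{1..n}. v i * A i j * v j)"

text \<open>\<^const>\<open>arg_min_on\<close> picks some minimizer; one exists for \<open>n \<ge> 1\<close> by compactness, and for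
  inputs with a density it is almost surely unique.\<close>

definition min_eigenvector :: "nat \<Rightarrow> (nat \<times> nat \<Rightarrow> real) \<Rightarrow> nat \<Rightarrow> real" where
  "min_eigenvector n x = arg_min_on (quadratic_form n (sym_matrix x)) (half_sphere n)"

definition row_block :: "nat \<Rightarrow> nat \<Rightarrow> (nat \<times> nat) set" where
  "row_block n i = {(i, j) | j. j \<in> {1..n} \<and> j \<ge> i} \<union> {(j, i) | j. j \<in> {1..n} \<and> j \<le> i}"

end

theory Submission
  imports Defs
begin

text \<open>Let \<open>J\<^sub>i\<close> be the \<open>i\<close>-th row block, \<open>\<lambda>\<close> the smallest eigenvalue, \<open>v\<close> a minimizer and \<open>X\<^sub>i\<close> the input
  with block \<open>J\<^sub>i\<close> resampled.  Exchanging the roles of \<open>X\<close> and \<open>X\<^sub>i\<close> does not change their joint law, and a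
  fresh row is independent of \<open>v (X)\<close>.  Hence the expected sum over \<open>i\<close> of the excesses
  \<open>\<langle>v (X\<^sub>i), X v (X\<^sub>i)\<rangle> - \<lambda> (X)\<close> is, up to a diagonal term, \<open>2 E \<bar>\<lambda>\<bar> = O (\<surd>n)\<close>, so for most \<open>i\<close>
  the vector \<open>v (X\<^sub>i)\<close> minimizes the form of \<open>X\<close> up to \<open>O (1 / \<surd>n)\<close> and lies close to the span of the
  eigenvectors with eigenvalues within \<open>O (1 / \<surd>n)\<close> of \<open>\<lambda> (X)\<close>.

  If there were \<open>K + 1\<close> such eigenvectors, resampling one row would decrease \<open>\<lambda>\<close> in expectation by a multiple of
  \<open>\<surd>(K / n)\<close>: mix \<open>e\<^sub>i\<close> with weight \<open>1 / \<surd>n\<close> into the projection of the fresh row onto their span.  As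
  \<open>E \<lambda>\<close> is invariant under resampling, this has small probability for large \<open>K\<close>.

  The bound \<open>E \<bar>\<lambda>\<bar> = O (\<surd>n)\<close> comes from symmetrization.  For a matrix with independent random signs, the
  Walsh coefficients of the powers evolve under an operator that adds an edge to the index set or removes one; the
  squared norm of either part is at most the largest squared row norm plus \<open>2 p\<close> times the largest squared entry as
  long as the index sets have at most \<open>p\<close> elements, and \<open>p\<close> of order \<open>log n\<close> suffices.\<close>

section \<open>The smallest eigenvalue of a symmetric matrix\<close>

text \<open>Two obstacles shape the argument. \<open>min_eigenvector\<close> is an arbitrary choice
  among minimizers and cannot be integrated directly: it enters only through the coefficients
  \<open>edge_weight\<close>, which agree almost surely with one-sided partial derivatives of the
  smallest eigenvalue, and these are measurable. Moreover the joint law of the copies for different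
  rows is arbitrary, so every estimate over the rows is an expectation of a sum, which sees only the
  law of each pair of input and copy. The factor 2 in \<open>2 E |\<lambda>|\<close> arises because
  the form is linear in the entries and an off-diagonal entry lies in two rows. The scale
  \<open>1 / \<surd>n\<close> is forced: a total excess \<open>O (\<surd>n)\<close> is shared by
  \<open>n\<close> rows, and mixing in \<open>e_i\<close> with weight \<open>1 / \<surd>n\<close>
  costs \<open>|\<lambda>| / n = O (1 / \<surd>n)\<close> while the cross term gains
  \<open>\<surd>(K / n)\<close>, so that a large \<open>K\<close> wins. A logarithmic
  \<open>p\<close> suffices since the \<open>2 p\<close>-th root turns the dimension factor
  \<open>n\<close> of a Hilbert--Schmidt norm into a constant.\<close>

definition edge :: "nat \<Rightarrow> nat \<Rightarrow> nat \<times> nat" where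
  "edge i j = (min i j, max i j)"

definition ip :: "nat \<Rightarrow> (nat \<Rightarrow> real) \<Rightarrow> (nat \<Rightarrow> real) \<Rightarrow> real" where
  "ip n u v = (\<Sum>i\<in>{1..n}. u i * v i)"

definition mv :: "nat \<Rightarrow> (nat \<times> nat \<Rightarrow> real) \<Rightarrow> (nat \<Rightarrow> real) \<Rightarrow> nat \<Rightarrow> real" where
  "mv n x v i = (\<Sum>j\<in>{1..n}. x (edge i j) * v j)"

abbreviation qf :: "nat \<Rightarrow> (nat \<times> nat \<Rightarrow> real) \<Rightarrow> (nat \<Rightarrow> real) \<Rightarrow> real" where
  "qf n x \<equiv> quadratic_form n (sym_matrix x)"

text \<open>The value at the chosen minimizer does not depend on the choice, which is why the
  smallest eigenvalue is measurable even though the vector need not be.\<close>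

definition lam :: "nat \<Rightarrow> (nat \<times> nat \<Rightarrow> real) \<Rightarrow> real" where
  "lam n x = qf n x (min_eigenvector n x)"

lemma edge_commute: "edge i j = edge j i"
  by (auto simp: edge_def min.commute max.commute)

lemma sym_matrix_edge: "sym_matrix x i j = x (edge i j)"
  by (auto simp: sym_matrix_def edge_def min_def max_def)

lemma edge_in_upper: "i \<in> {1..n} \<Longrightarrow> j \<in> {1..n} \<Longrightarrow> edge i j \<in> upper_indices n"
  by (auto simp: edge_def upper_indices_def)

lemma edge_inj: "inj_on (edge i) A"
  by (auto simp: inj_on_def edge_def min_def max_def split: if_splits)

lemma finite_upper [simp]: "finite (upper_indices n)"
  by (rule finite_subset[of _ "{1..n} \<times> {1..n}"]) (auto simp: upper_indices_def)

lemma qf_ip: "qf n x v = ip n v (mv n x v)"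
  by (simp add: quadratic_form_def ip_def mv_def sym_matrix_edge sum_distrib_left mult.assoc)

lemma ip_commute: "ip n u v = ip n v u"
  by (simp add: ip_def mult.commute)

lemma ip_lin: "ip n (\<lambda>i. a * u i + b * v i) w = a * ip n u w + b * ip n v w"
  by (simp add: ip_def sum_distrib_left sum.distrib algebra_simps)

lemma ip_lin': "ip n w (\<lambda>i. a * u i + b * v i) = a * ip n w u + b * ip n w v"
  using ip_lin[where n=n and a=a and u=u and b=b and v=v and w=w] unfolding ip_commute[of n _ w] .

lemma ip_sum: "ip n (\<lambda>i. \<Sum>a\<in>F. c a * u a i) w = (\<Sum>a\<in>F. c a * ip n (u a) w)"
proof -
  have "ip n (\<lambda>i. \<Sum>a\<in>F. c a * u a i) w = (\<Sum>i\<in>{1..n}. \<Sum>a\<in>F. c a * (u a i * w i))"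
    by (simp add: ip_def sum_distrib_right mult.assoc)
  also have "\<dots> = (\<Sum>a\<in>F. c a * ip n (u a) w)"
    by (subst sum.swap) (simp add: ip_def sum_distrib_left)
  finally show ?thesis .
qed

lemma ip_sum': "ip n w (\<lambda>i. \<Sum>a\<in>F. c a * u a i) = (\<Sum>a\<in>F. c a * ip n w (u a))"
  using ip_sum[where n=n and F=F and c=c and u=u and w=w] unfolding ip_commute[of n _ w] .

lemma ip_nonneg: "ip n v v \<ge> 0"
  by (simp add: ip_def sum_nonneg)

lemma ip_eq_0: "ip n v v = 0 \<longleftrightarrow> (\<forall>i\<in>{1..n}. v i = 0)"
  unfolding ip_def by (subst sum_nonneg_eq_0_iff) auto

lemma ip_cong: "(\<And>i. i \<in> {1..n} \<Longrightarrow> u i = u' i) \<Longrightarrow> (\<And>i. i \<in> {1..n} \<Longrightarrow> v i = v' i) \<Longrightarrow> ip n u v = ip n u' v'"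
  by (simp add: ip_def)

lemma mv_cong: "(\<And>i. i \<in> {1..n} \<Longrightarrow> v i = v' i) \<Longrightarrow> mv n x v = mv n x v'"
  by (auto simp: mv_def)

lemma qf_cong: "(\<And>i. i \<in> {1..n} \<Longrightarrow> v i = v' i) \<Longrightarrow> qf n x v = qf n x v'"
  unfolding qf_ip by (metis mv_cong ip_cong)

lemma mv_lin: "mv n x (\<lambda>i. a * u i + b * v i) = (\<lambda>i. a * mv n x u i + b * mv n x v i)"
  by (simp add: mv_def sum_distrib_left sum.distrib algebra_simps fun_eq_iff)

lemma ip_mv_commute: "ip n u (mv n x v) = ip n v (mv n x u)"
proof -
  have "ip n u (mv n x v) = (\<Sum>i\<in>{1..n}. \<Sum>j\<in>{1..n}. u i * x (edge i j) * v j)"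
    by (simp add: ip_def mv_def sum_distrib_left mult.assoc)
  also have "\<dots> = (\<Sum>j\<in>{1..n}. \<Sum>i\<in>{1..n}. u i * x (edge i j) * v j)"
    by (rule sum.swap)
  also have "\<dots> = (\<Sum>j\<in>{1..n}. \<Sum>i\<in>{1..n}. v j * (x (edge j i) * u i))"
    using edge_commute by (intro sum.cong refl) (metis mult.assoc mult.commute)
  also have "\<dots> = ip n v (mv n x u)"
    by (simp only: ip_def mv_def sum_distrib_left)
  finally show ?thesis .
qed

lemma qf_lin:
  "qf n x (\<lambda>i. a * u i + b * v i) = a\<^sup>2 * qf n x u + 2 * a * b * ip n v (mv n x u) + b\<^sup>2 * qf n x v"
  unfolding qf_ip mv_lin ip_lin ip_lin' using ip_mv_commute[of n u x v]
  by (simp add: algebra_simps power2_eq_square)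

lemma qf_scale: "qf n x (\<lambda>i. a * v i) = a\<^sup>2 * qf n x v"
  using qf_lin[of n x a v 0 v] by simp

lemma ip_scale: "ip n (\<lambda>i. a * v i) (\<lambda>i. a * v i) = a\<^sup>2 * ip n v v"
  by (simp add: ip_def sum_distrib_left power2_eq_square mult_ac)

lemma continuous_coord: "continuous_on S (\<lambda>v::nat \<Rightarrow> real. v i)"
  by (rule continuous_on_subset[OF continuous_on_product_coordinates subset_UNIV])

lemma qf_continuous: "continuous_on S (qf n x)"
  unfolding quadratic_form_def by (intro continuous_intros continuous_coord)

lemma ip_continuous: "continuous_on S (\<lambda>v. ip n v v)" "continuous_on S (\<lambda>v. ip n u v)"
  unfolding ip_def by (intro continuous_intros continuous_coord)+

lemma ip_coord_le: "i \<in> {1..n} \<Longrightarrow> (v i)\<^sup>2 \<le> ip n v v"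
  unfolding ip_def power2_eq_square[symmetric] by (rule member_le_sum) auto

text \<open>The parameter \<open>d\<close> is the junk value outside \<open>{1..n}\<close>; fixing it makes the unit sphere compact.\<close>

lemma ex_minimizer:
  fixes C :: "(nat \<Rightarrow> real) set"
  assumes C: "closed C" and v0: "v0 \<in> C" "ip n v0 v0 = 1" "\<forall>i. i \<notin> {1..n} \<longrightarrow> v0 i = d"
  shows "\<exists>v\<in>C. ip n v v = 1 \<and> (\<forall>i. i \<notin> {1..n} \<longrightarrow> v i = d) \<and>
           (\<forall>w\<in>C. ip n w w = 1 \<longrightarrow> (\<forall>i. i \<notin> {1..n} \<longrightarrow> w i = d) \<longrightarrow> qf n x v \<le> qf n x w)"
proof -
  define K where "K = PiE UNIV (\<lambda>i::nat. if i \<in> {1..n} then {-1..1} else {d::real})"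
  have "compactin (product_topology (\<lambda>i. euclidean) UNIV) K"
    unfolding K_def by (subst compactin_PiE) auto
  then have K: "compact K" by (simp add: euclidean_product_topology)
  define S where "S = K \<inter> (C \<inter> {v. ip n v v = 1})"
  have "closed {v. ip n v v = 1}"
    by (intro closed_Collect_eq ip_continuous continuous_intros)
  then have cS: "compact S" unfolding S_def using K C by (intro compact_Int_closed) auto
  have inK: "v \<in> K" if "ip n v v = 1" "\<forall>i. i \<notin> {1..n} \<longrightarrow> v i = d" for v
  proof -
    have "v i \<in> {-1..1}" if "i \<in> {1..n}" for i
      using ip_coord_le[OF that, of v] \<open>ip n v v = 1\<close> by (simp add: abs_square_le_1 abs_le_iff)
    then show ?thesis using that by (auto simp: K_def PiE_def)
  qed
  have "S \<noteq> {}" using v0 inK by (auto simp: S_def)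
  then obtain v where v: "v \<in> S" "\<And>w. w \<in> S \<Longrightarrow> qf n x v \<le> qf n x w"
    using continuous_attains_inf[OF cS _ qf_continuous] by metis
  have "\<forall>i. i \<notin> {1..n} \<longrightarrow> v i = d"
  proof (intro allI impI)
    fix i assume "i \<notin> {1..n}"
    have "v i \<in> (if i \<in> {1..n} then {-1..1} else {d})"
      using v(1) by (auto simp: S_def K_def PiE_iff)
    then show "v i = d" using \<open>i \<notin> {1..n}\<close> by (simp del: atLeastAtMost_iff)
  qed
  with v inK show ?thesis by (intro bexI[of _ v]) (auto simp: S_def)
qed

lemma half_sphere_iff:
  "v \<in> half_sphere n \<longleftrightarrow> (\<forall>i. i \<notin> {1..n} \<longrightarrow> v i = undefined) \<and> ip n v v = 1 \<and> v 1 \<ge> 0"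
  by (auto simp: half_sphere_def ip_def L2_set_def power2_eq_square PiE_iff extensional_def)

lemma min_eigenvector:
  assumes n: "n \<ge> 1"
  shows "min_eigenvector n x \<in> half_sphere n"
    and "v \<in> half_sphere n \<Longrightarrow> lam n x \<le> qf n x v"
proof -
  have cl: "closed {v::nat \<Rightarrow> real. 0 \<le> v 1}"
    by (intro closed_Collect_le continuous_intros continuous_coord)
  define v0 :: "nat \<Rightarrow> real" where "v0 i = (if i \<in> {1..n} then of_bool (i = 1) else undefined)" for i
  have "ip n v0 v0 = (\<Sum>i\<in>{1..n}. if i = 1 then 1 else 0)"
    unfolding ip_def v0_def by (intro sum.cong) auto
  then have "ip n v0 v0 = 1" using n by (subst (asm) sum.delta) auto
  moreover have "v0 1 \<ge> 0" "\<forall>i. i \<notin> {1..n} \<longrightarrow> v0 i = undefined" using n by (auto simp: v0_def)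
  ultimately obtain v where "v \<in> half_sphere n" "\<forall>w\<in>half_sphere n. qf n x v \<le> qf n x w"
    using ex_minimizer[OF cl, of v0 n undefined x]
    unfolding Ball_def half_sphere_iff by auto
  then have "is_arg_min (qf n x) (\<lambda>v. v \<in> half_sphere n) v"
    by (auto simp: is_arg_min_linorder)
  then have "is_arg_min (qf n x) (\<lambda>v. v \<in> half_sphere n) (min_eigenvector n x)"
    unfolding min_eigenvector_def arg_min_on_def arg_min_def by (rule someI[where P = "is_arg_min _ _"])
  then show "min_eigenvector n x \<in> half_sphere n" "v \<in> half_sphere n \<Longrightarrow> lam n x \<le> qf n x v" for v
    by (auto simp: is_arg_min_linorder lam_def)
qed

lemma min_eigenvector_unit: "n \<ge> 1 \<Longrightarrow> ip n (min_eigenvector n x) (min_eigenvector n x) = 1"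
  using min_eigenvector(1) half_sphere_iff by blast

text \<open>Homogeneity extends the variational bound from the half-sphere to all vectors. A vector
  vanishing on \<open>{1..n}\<close> is treated apart because it cannot be normalized.\<close>

lemma lam_le_qf:
  assumes n: "n \<ge> 1"
  shows "lam n x * ip n v v \<le> qf n x v"
proof (cases "ip n v v = 0")
  case True
  then have "\<And>i. i \<in> {1..n} \<Longrightarrow> v i = 0" by (simp add: ip_eq_0)
  then have "qf n x v = qf n x (\<lambda>i. 0)" by (intro qf_cong) auto
  also have "\<dots> = 0" by (simp add: quadratic_form_def)
  finally show ?thesis using True by simp
next
  case False
  define r where "r = sqrt (ip n v v)"
  have r: "r > 0" "r\<^sup>2 = ip n v v" using False ip_nonneg[of n v] by (auto simp: r_def less_le)
  \<comment> \<open>The sign moves the normalized vector into the half-sphere; the form is even, so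
    its value is unaffected.\<close>
  define s where "s = (if v 1 \<ge> 0 then 1 else -1) / r"
  have s2: "s\<^sup>2 * ip n v v = 1" using r by (auto simp: s_def power_divide)
  define w where "w i = (if i \<in> {1..n} then s * v i else undefined)" for i
  have "ip n w w = ip n (\<lambda>i. s * v i) (\<lambda>i. s * v i)" by (rule ip_cong) (auto simp: w_def)
  then have "ip n w w = 1" by (simp add: ip_scale s2)
  moreover have "w 1 \<ge> 0" using n r by (auto simp: w_def s_def divide_simps)
  ultimately have "w \<in> half_sphere n" by (auto simp: half_sphere_iff w_def)
  then have "lam n x \<le> qf n x w" by (rule min_eigenvector(2)[OF n])
  also have "qf n x w = qf n x (\<lambda>i. s * v i)" by (rule qf_cong) (auto simp: w_def)
  also have "\<dots> = s\<^sup>2 * qf n x v" by (rule qf_scale)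
  finally have "lam n x * ip n v v \<le> (s\<^sup>2 * ip n v v) * qf n x v"
    using ip_nonneg[of n v] by (metis mult.assoc mult.commute mult_right_mono)
  then show ?thesis using s2 by simp
qed

text \<open>The partial derivative of the form in the entry \<open>e\<close>: an off-diagonal entry
  occurs twice in the symmetric matrix. The weights are even in \<open>v\<close>, so they do not see
  the sign of a minimizer.\<close>

definition edge_weight :: "(nat \<Rightarrow> real) \<Rightarrow> nat \<times> nat \<Rightarrow> real" where
  "edge_weight v e = (if fst e = snd e then 1 else 2) * v (fst e) * v (snd e)"

lemma qf_edge_weight: "qf n x v = (\<Sum>e\<in>upper_indices n. x e * edge_weight v e)"
proof -
  let ?V = "{1..n}"
  let ?f = "\<lambda>ij. v (fst ij) * x (edge (fst ij) (snd ij)) * v (snd ij)"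
  let ?g = "\<lambda>ij. edge (fst ij) (snd ij)"
  have "qf n x v = sum ?f (?V \<times> ?V)"
    by (simp add: quadratic_form_def sym_matrix_edge sum.cartesian_product case_prod_unfold)
  also have "\<dots> = (\<Sum>e\<in>upper_indices n. \<Sum>ij\<in>{ij \<in> ?V \<times> ?V. ?g ij = e}. ?f ij)"
    by (rule sum.group[symmetric]) (simp, simp, auto simp: upper_indices_def edge_def)
  also have "\<dots> = (\<Sum>e\<in>upper_indices n. x e * edge_weight v e)"
  proof (intro sum.cong refl)
    fix e assume e: "e \<in> upper_indices n"
    have s: "{ij \<in> ?V \<times> ?V. ?g ij = e} = {e, (snd e, fst e)}"
      using e by (auto simp: upper_indices_def edge_def min_def max_def split: if_splits)
    obtain a b where ab: "e = (a, b)" "edge a b = (a, b)" "edge b a = (a, b)"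
      using e by (auto simp: upper_indices_def edge_def min_def max_def)
    show "(\<Sum>ij\<in>{ij \<in> ?V \<times> ?V. ?g ij = e}. ?f ij) = x e * edge_weight v e"
      unfolding s unfolding ab(1) using ab(2,3) by (cases "a = b") (auto simp: edge_weight_def)
  qed
  finally show ?thesis .
qed

lemma edge_weight_le: "ip n v v = 1 \<Longrightarrow> e \<in> upper_indices n \<Longrightarrow> \<bar>edge_weight v e\<bar> \<le> 2"
proof -
  assume v: "ip n v v = 1" and e: "e \<in> upper_indices n"
  have "\<bar>v i\<bar> \<le> 1" if "i \<in> {1..n}" for i
    using ip_coord_le[OF that, of v] v by (simp add: abs_square_le_1)
  then have "\<bar>v (fst e)\<bar> * \<bar>v (snd e)\<bar> \<le> 1"
    using e by (intro mult_le_one) (auto simp: upper_indices_def)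
  then show ?thesis by (auto simp: edge_weight_def abs_mult)
qed

text \<open>A crude bound whose purpose is integrability; the correct order \<open>\<surd>n\<close>
  takes the random sign estimates.\<close>

lemma abs_lam_le:
  assumes "n \<ge> 1" shows "\<bar>lam n x\<bar> \<le> (\<Sum>e\<in>upper_indices n. 2 * \<bar>x e\<bar>)"
proof -
  let ?v = "min_eigenvector n x"
  have "\<bar>lam n x\<bar> \<le> (\<Sum>e\<in>upper_indices n. \<bar>x e * edge_weight ?v e\<bar>)"
    unfolding lam_def qf_edge_weight by (rule sum_abs)
  also have "\<dots> \<le> (\<Sum>e\<in>upper_indices n. 2 * \<bar>x e\<bar>)"
  proof (intro sum_mono)
    fix e assume "e \<in> upper_indices n"
    then have "\<bar>edge_weight ?v e\<bar> \<le> 2" by (rule edge_weight_le[OF min_eigenvector_unit[OF assms]])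
    then have "\<bar>x e\<bar> * \<bar>edge_weight ?v e\<bar> \<le> \<bar>x e\<bar> * 2" by (intro mult_left_mono) auto
    then show "\<bar>x e * edge_weight ?v e\<bar> \<le> 2 * \<bar>x e\<bar>" by (simp add: abs_mult)
  qed
  finally show ?thesis .
qed

text \<open>Vectors carry junk values outside \<open>{1..n}\<close>, so the eigenvector equation is tested against all \<open>z\<close>.\<close>

definition eigsys :: "nat \<Rightarrow> (nat \<times> nat \<Rightarrow> real) \<Rightarrow> nat \<Rightarrow> (nat \<Rightarrow> nat \<Rightarrow> real) \<Rightarrow> (nat \<Rightarrow> real) \<Rightarrow> bool" where
  "eigsys n x k u \<mu> \<longleftrightarrow> (\<forall>a<k. \<forall>b<k. ip n (u a) (u b) = of_bool (a = b)) \<and>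
     (\<forall>a<k. \<forall>z. ip n z (mv n x (u a)) = \<mu> a * ip n z (u a))"

text \<open>Minimizing the form over the unit vectors orthogonal to the given system produces the
  next eigenvector: its first variation vanishes in the orthogonal directions, and symmetry of the
  matrix handles the directions \<open>u a\<close>. Since \<open>r\<close> is an admissible
  competitor after normalization, the new eigenvalue is at most \<open>\<theta>\<close>.\<close>

lemma eigsys_extend:
  assumes n: "n \<ge> 1" and es: "eigsys n x k u \<mu>"
    and r: "\<forall>a<k. ip n (u a) r = 0" "qf n x r < \<theta> * ip n r r"
  shows "\<exists>w m. eigsys n x (Suc k) (u(k := w)) (\<mu>(k := m)) \<and> m \<le> \<theta>"
proof -
  define C where "C = (\<Inter>a\<in>{..<k}. {v. ip n (u a) v = 0})"
  have C: "closed C" unfolding C_def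
    by (intro closed_INT ballI closed_Collect_eq ip_continuous continuous_intros)
  have nz: "ip n r r \<noteq> 0"
  proof
    assume "ip n r r = 0"
    then show False using r(2) lam_le_qf[OF n, of x r] by simp
  qed
  define s where "s = 1 / sqrt (ip n r r)"
  have pos: "ip n r r > 0" using nz ip_nonneg[of n r] by linarith
  have s2: "s\<^sup>2 * ip n r r = 1" using pos by (simp add: s_def power_divide)
  define v0 where "v0 i = (if i \<in> {1..n} then s * r i else 0)" for i
  have e0: "ip n v0 v0 = 1"
    using ip_cong[of n v0 "\<lambda>i. s * r i" v0 "\<lambda>i. s * r i"] s2 by (simp add: v0_def ip_scale)
  have "ip n (u a) v0 = s * ip n (u a) r + 0 * ip n (u a) r" for a
    unfolding ip_lin'[symmetric] by (rule ip_cong) (auto simp: v0_def)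
  then have v0C: "v0 \<in> C" using r(1) by (auto simp: C_def)
  have v0z: "\<forall>i. i \<notin> {1..n} \<longrightarrow> v0 i = 0" by (simp add: v0_def)
  obtain w where w: "w \<in> C" "ip n w w = 1" "\<forall>i. i \<notin> {1..n} \<longrightarrow> w i = 0"
    and wmin: "\<And>v. v \<in> C \<Longrightarrow> ip n v v = 1 \<Longrightarrow> (\<forall>i. i \<notin> {1..n} \<longrightarrow> v i = 0) \<Longrightarrow> qf n x w \<le> qf n x v"
    using ex_minimizer[OF C v0C e0 v0z, of x] by blast
  define m where "m = qf n x w"
  have wmin2: "m * ip n v v \<le> qf n x v" if "\<forall>a<k. ip n (u a) v = 0" for v
  proof (cases "ip n v v = 0")
    case True
    then show ?thesis using lam_le_qf[OF n, of x v] by simp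
  next
    case False
    then have pos: "ip n v v > 0" using ip_nonneg[of n v] by linarith
    define t where "t = 1 / sqrt (ip n v v)"
    have t2: "t\<^sup>2 * ip n v v = 1" using pos by (simp add: t_def power_divide)
    define z where "z i = (if i \<in> {1..n} then t * v i else 0)" for i
    have "ip n z z = 1"
      using ip_cong[of n z "\<lambda>i. t * v i" z "\<lambda>i. t * v i"] t2 by (simp add: z_def ip_scale)
    moreover have "ip n (u a) z = t * ip n (u a) v + 0 * ip n (u a) v" for a
      unfolding ip_lin'[symmetric] by (rule ip_cong) (auto simp: z_def)
    then have "z \<in> C" using that by (auto simp: C_def)
    ultimately have "m \<le> qf n x z" unfolding m_def by (intro wmin) (auto simp: z_def)
    also have "qf n x z = qf n x (\<lambda>i. t * v i)" by (rule qf_cong) (auto simp: z_def)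
    also have "\<dots> = t\<^sup>2 * qf n x v" by (rule qf_scale)
    finally have "m * ip n v v \<le> (t\<^sup>2 * ip n v v) * qf n x v"
      using pos by (metis mult.assoc mult.commute mult_right_mono less_imp_le)
    then show ?thesis using t2 by simp
  qed
  have mth: "m \<le> \<theta>"
  proof -
    have "m * ip n r r \<le> qf n x r" using wmin2 r(1) by blast
    with r(2) have "m * ip n r r < \<theta> * ip n r r" by simp
    then show ?thesis using pos by simp
  qed
  have first: "ip n z (mv n x w) = m * ip n z w" if z: "\<forall>a<k. ip n (u a) z = 0" for z
  proof (rule ccontr)
    define D where "D = ip n z (mv n x w) - m * ip n z w"
    assume "ip n z (mv n x w) \<noteq> m * ip n z w"
    then have D: "D \<noteq> 0" by (simp add: D_def)
    \<comment> \<open>Adding 1 keeps the denominator of \<open>t\<close> positive; at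
      \<open>t = - D / E\<close> the upper bound \<open>2 * t * D + t^2 * E\<close> equals
      \<open>- D^2 / E\<close>, which is negative.\<close>
    define E where "E = \<bar>qf n x z - m * ip n z z\<bar> + 1"
    have E: "E > 0" "qf n x z - m * ip n z z < E" by (auto simp: E_def)
    define t where "t = - D / E"
    have "\<forall>a<k. ip n (u a) (\<lambda>i. 1 * w i + t * z i) = 0"
      unfolding ip_lin' using z w(1) by (auto simp: C_def)
    then have "m * ip n (\<lambda>i. 1 * w i + t * z i) (\<lambda>i. 1 * w i + t * z i) \<le> qf n x (\<lambda>i. 1 * w i + t * z i)"
      by (rule wmin2)
    then have "0 \<le> 2 * t * D + t\<^sup>2 * (qf n x z - m * ip n z z)"
      unfolding qf_lin ip_lin ip_lin' using w(2) ip_commute[of n w z]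
      by (simp add: D_def m_def algebra_simps power2_eq_square)
    also have "\<dots> \<le> 2 * t * D + t\<^sup>2 * E" using E by (intro add_left_mono mult_left_mono) auto
    also have "\<dots> = - D\<^sup>2 / E" using E by (simp add: t_def power2_eq_square field_simps)
    also have "\<dots> < 0" using D E by simp
    finally show False by simp
  qed
  have wu: "ip n (u a) w = 0" if "a < k" for a using w(1) that by (auto simp: C_def)
  have wu': "ip n w (u a) = 0" if "a < k" for a by (subst ip_commute) (rule wu[OF that])
  have full: "ip n z (mv n x w) = m * ip n z w" for z
  proof -
    \<comment> \<open>Any \<open>z\<close> differs from a vector orthogonal to the system by a
      combination of the \<open>u a\<close>, and on those both sides vanish since the matrix is
      symmetric and \<open>w\<close> is orthogonal to the system.\<close>
    define y where "y = (\<lambda>i. 1 * z i + (-1) * (\<Sum>a\<in>{..<k}. ip n (u a) z * u a i))"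
    have on: "\<And>a b. a < k \<Longrightarrow> b < k \<Longrightarrow> ip n (u a) (u b) = of_bool (a = b)"
      and eig: "\<And>a z. a < k \<Longrightarrow> ip n z (mv n x (u a)) = \<mu> a * ip n z (u a)"
      using es by (auto simp: eigsys_def)
    have "ip n (u b) y = 0" if b: "b < k" for b
    proof -
      have "ip n (u b) (\<lambda>i. (\<Sum>a\<in>{..<k}. ip n (u a) z * u a i)) = (\<Sum>a\<in>{..<k}. ip n (u a) z * of_bool (b = a))"
        unfolding ip_sum' using b by (intro sum.cong) (auto simp: on)
      also have "\<dots> = ip n (u b) z" using b by (simp add: of_bool_def if_distrib cong: if_cong)
      finally show ?thesis unfolding y_def ip_lin' by simp
    qed
    then have "ip n y (mv n x w) = m * ip n y w" by (intro first) auto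
    moreover have "ip n y (mv n x w) = ip n z (mv n x w)"
    proof -
      have "ip n (u a) (mv n x w) = 0" if "a < k" for a
        using ip_mv_commute[of n "u a" x w] eig[OF that, of w] wu[OF that] ip_commute by simp
      then show ?thesis unfolding y_def ip_lin ip_sum by simp
    qed
    moreover have "ip n y w = ip n z w" unfolding y_def ip_lin ip_sum using wu by simp
    ultimately show ?thesis by simp
  qed
  have "eigsys n x (Suc k) (u(k := w)) (\<mu>(k := m))"
    unfolding eigsys_def
  proof (intro conjI allI impI)
    fix a b assume "a < Suc k" "b < Suc k"
    then show "ip n ((u(k := w)) a) ((u(k := w)) b) = of_bool (a = b)"
      using es w(1,2) by (cases "a = k"; cases "b = k") (auto simp: eigsys_def wu wu')
  next
    fix a z assume "a < Suc k"
    then show "ip n z (mv n x ((u(k := w)) a)) = (\<mu>(k := m)) a * ip n z ((u(k := w)) a)"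
      using es full by (cases "a = k") (auto simp: eigsys_def)
  qed
  with mth show ?thesis by blast
qed

text \<open>A system of eigenvectors below \<open>\<theta>\<close> is extended as long as some
  orthogonal vector has Rayleigh quotient below \<open>\<theta>\<close>. Either \<open>k\<close> of
  them are found, or the process stops at some \<open>d < k\<close>, and then the form is bounded
  below by \<open>\<theta>\<close> on the orthogonal complement. This stands in for the spectral
  theorem.\<close>

lemma eig_dichotomy:
  assumes n: "n \<ge> 1"
  obtains (many) u \<mu> where "eigsys n x k u \<mu>" "\<And>a. a < k \<Longrightarrow> \<mu> a \<le> \<theta>"
  | (few) d u \<mu> where "d < k" "eigsys n x d u \<mu>" "\<And>a. a < d \<Longrightarrow> \<mu> a \<le> \<theta>"
      "\<And>r. (\<And>a. a < d \<Longrightarrow> ip n (u a) r = 0) \<Longrightarrow> \<theta> * ip n r r \<le> qf n x r"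
proof -
  let ?M = "\<lambda>k. \<exists>u \<mu>. eigsys n x k u \<mu> \<and> (\<forall>a<k. \<mu> a \<le> \<theta>)"
  let ?F = "\<lambda>d. \<exists>u \<mu>. eigsys n x d u \<mu> \<and> (\<forall>a<d. \<mu> a \<le> \<theta>) \<and>
       (\<forall>r. (\<forall>a<d. ip n (u a) r = 0) \<longrightarrow> \<theta> * ip n r r \<le> qf n x r)"
  have step: "?M (Suc k) \<or> ?F k" if M: "?M k" for k
  proof -
    obtain u \<mu> where u: "eigsys n x k u \<mu>" "\<forall>a<k. \<mu> a \<le> \<theta>" using M by metis
    show ?thesis
    proof (cases "\<forall>r. (\<forall>a<k. ip n (u a) r = 0) \<longrightarrow> \<theta> * ip n r r \<le> qf n x r")
      case True
      then have "?F k" using u by (intro exI[of _ u] exI[of _ \<mu>] conjI)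
      then show ?thesis ..
    next
      case False
      then obtain r where "\<forall>a<k. ip n (u a) r = 0" "qf n x r < \<theta> * ip n r r" by (meson not_le)
      from eigsys_extend[OF n u(1) this] obtain w m
        where e: "eigsys n x (Suc k) (u(k := w)) (\<mu>(k := m))" "m \<le> \<theta>" by metis
      have "\<forall>a<Suc k. (\<mu>(k := m)) a \<le> \<theta>" using e(2) u(2) by (simp add: less_Suc_eq)
      then have "?M (Suc k)" using e(1) by (intro exI[of _ "u(k := w)"] exI[of _ "\<mu>(k := m)"] conjI)
      then show ?thesis ..
    qed
  qed
  have ind: "A k \<or> (\<exists>d<k. B d)" if "A 0" "\<And>k. A k \<Longrightarrow> A (Suc k) \<or> B k"
    for A B :: "nat \<Rightarrow> bool" using that by (induction k) (auto intro: less_SucI)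
  have "?M 0" by (simp add: eigsys_def)
  then have "?M k \<or> (\<exists>d<k. ?F d)" using step by (rule ind[of ?M ?F])
  then show thesis
  proof
    assume "?M k"
    then obtain u \<mu> where "eigsys n x k u \<mu>" "\<forall>a<k. \<mu> a \<le> \<theta>" by (elim exE conjE)
    then show thesis by (intro many) auto
  next
    assume "\<exists>d<k. ?F d"
    then obtain d u \<mu> where "d < k" "eigsys n x d u \<mu>" "\<forall>a<d. \<mu> a \<le> \<theta>"
      "\<forall>r. (\<forall>a<d. ip n (u a) r = 0) \<longrightarrow> \<theta> * ip n r r \<le> qf n x r" by (elim exE conjE)
    then show thesis by (intro few) auto
  qed
qed

section \<open>Orthonormal systems and the geometry of near-minimizers\<close>

definition orthonormal :: "nat \<Rightarrow> nat \<Rightarrow> (nat \<Rightarrow> nat \<Rightarrow> real) \<Rightarrow> bool" where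
  "orthonormal n k u \<longleftrightarrow> (\<forall>a<k. \<forall>b<k. ip n (u a) (u b) = of_bool (a = b))"

text \<open>Forcing coordinate \<open>i\<close> to vanish costs one dimension. Rotating the last two
  vectors in their plane yields \<open>w\<close> with \<open>w i = 0\<close>, which is kept, and an
  orthogonal \<open>w'\<close>, which takes their place in a shorter system. The set
  \<open>S\<close> is an arbitrary subspace so that the induction can pass to a smaller one.\<close>

lemma orthonormal_rotate:
  assumes S: "\<And>u v a b. u \<in> S \<Longrightarrow> v \<in> S \<Longrightarrow> (\<lambda>j. a * u j + b * v j) \<in> S"
    and u: "\<And>a. a < Suc k \<Longrightarrow> u a \<in> S" "orthonormal n (Suc k) u"
  shows "\<exists>z. (\<forall>a<k. z a \<in> S \<and> z a i = 0) \<and> orthonormal n k z"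
  using assms
proof (induction k arbitrary: u S)
  case 0
  then show ?case by (simp add: orthonormal_def)
next
  case (Suc k)
  note S = Suc.prems(1)
  have on: "\<And>a b. a < Suc (Suc k) \<Longrightarrow> b < Suc (Suc k) \<Longrightarrow> ip n (u a) (u b) = of_bool (a = b)"
    using Suc.prems(3) by (auto simp: orthonormal_def)
  have uS: "u k \<in> S" "u (Suc k) \<in> S" using Suc.prems(2) by auto
  define p where "p = u k i"
  define q where "q = u (Suc k) i"
  \<comment> \<open>A unit vector orthogonal to \<open>(p, q)\<close>; if both entries vanish, no
    rotation is required.\<close>
  obtain c d :: real where cd: "c\<^sup>2 + d\<^sup>2 = 1" "c * p + d * q = 0"
  proof (cases "p\<^sup>2 + q\<^sup>2 = 0")
    case True
    then show ?thesis using that[of 1 0] by (auto simp: sum_power2_eq_zero_iff)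
  next
    case False
    then have pos: "p\<^sup>2 + q\<^sup>2 > 0" by (metis sum_power2_gt_zero_iff sum_power2_eq_zero_iff)
    show ?thesis
      using pos by (intro that[of "q / sqrt (p\<^sup>2 + q\<^sup>2)" "- p / sqrt (p\<^sup>2 + q\<^sup>2)"])
        (auto simp: power_divide add_divide_distrib[symmetric] add.commute)
  qed
  define w where "w = (\<lambda>j. c * u k j + d * u (Suc k) j)"
  define w' where "w' = (\<lambda>j. (-d) * u k j + c * u (Suc k) j)"
  have wS: "w \<in> S" "w' \<in> S" unfolding w_def w'_def using S uS by blast+
  have wi: "w i = 0" using cd by (simp add: w_def p_def q_def)
  have ww: "ip n w w = 1" "ip n w' w' = 1" "ip n w w' = 0"
    using cd(1) unfolding w_def w'_def ip_lin ip_lin' by (simp_all add: on power2_eq_square)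
  have wu: "ip n w (u a) = 0" "ip n w' (u a) = 0" "ip n (u a) w' = 0" if "a < k" for a
    using that unfolding w_def w'_def ip_lin ip_lin' by (simp_all add: on)
  \<comment> \<open>Passing to the orthogonal complement of \<open>w\<close> makes the vectors from
    the induction hypothesis orthogonal to \<open>w\<close> at once.\<close>
  define S' where "S' = {v \<in> S. ip n w v = 0}"
  define v where "v = u(k := w')"
  have "\<exists>z. (\<forall>a<k. z a \<in> S' \<and> z a i = 0) \<and> orthonormal n k z"
  proof (rule Suc.IH)
    show "(\<lambda>j. a * f j + b * g j) \<in> S'" if "f \<in> S'" "g \<in> S'" for f g a b
      using that S unfolding S'_def by (simp add: ip_lin')
    show "v a \<in> S'" if "a < Suc k" for a
      using that Suc.prems(2) wS ww wu by (cases "a = k") (auto simp: S'_def v_def)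
    show "orthonormal n (Suc k) v"
      unfolding orthonormal_def
    proof (intro allI impI)
      fix a b assume "a < Suc k" "b < Suc k"
      then show "ip n (v a) (v b) = of_bool (a = b)"
        by (cases "a = k"; cases "b = k") (auto simp: v_def ww wu on)
    qed
  qed
  then obtain z where z: "\<And>a. a < k \<Longrightarrow> z a \<in> S' \<and> z a i = 0" "orthonormal n k z" by auto
  have "orthonormal n (Suc k) (z(k := w))"
    unfolding orthonormal_def
  proof (intro allI impI)
    fix a b assume ab: "a < Suc k" "b < Suc k"
    have "ip n w (z a) = 0" if "a < k" for a using z(1)[OF that] by (simp add: S'_def)
    moreover from this have "ip n (z a) w = 0" if "a < k" for a
      using that by (subst ip_commute) auto
    ultimately show "ip n ((z(k := w)) a) ((z(k := w)) b) = of_bool (a = b)"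
      using ab z(2) ww by (cases "a = k"; cases "b = k") (auto simp: orthonormal_def)
  qed
  moreover have "\<forall>a<Suc k. (z(k := w)) a \<in> S \<and> (z(k := w)) a i = 0"
    using z(1) wS wi by (auto simp: S'_def less_Suc_eq)
  ultimately show ?case by blast
qed

lemma ip_sum_orthonormal:
  assumes "orthonormal n k u"
  shows "ip n (\<lambda>i. \<Sum>a<k. c a * u a i) (\<lambda>i. \<Sum>a<k. d a * u a i) = (\<Sum>a<k. c a * d a)"
proof -
  have "ip n (\<lambda>i. \<Sum>a<k. c a * u a i) (\<lambda>i. \<Sum>a<k. d a * u a i) =
      (\<Sum>a<k. c a * (\<Sum>b<k. d b * ip n (u a) (u b)))"
    by (simp add: ip_sum ip_sum')
  also have "\<dots> = (\<Sum>a<k. c a * (\<Sum>b<k. if a = b then d b else 0))"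
    using assms by (intro sum.cong refl arg_cong2[where f="(*)"]) (auto simp: orthonormal_def)
  finally show ?thesis by simp
qed

lemma mv_sum: "mv n x (\<lambda>i. \<Sum>a\<in>F. c a * u a i) i = (\<Sum>a\<in>F. c a * mv n x (u a) i)"
  unfolding mv_def sum_distrib_left by (subst sum.swap) (simp add: mult_ac)

lemma qf_sum_eigsys:
  assumes "eigsys n x k u \<mu>"
  shows "qf n x (\<lambda>i. \<Sum>a<k. c a * u a i) = (\<Sum>a<k. (c a)\<^sup>2 * \<mu> a)"
proof -
  have "qf n x (\<lambda>i. \<Sum>a<k. c a * u a i) =
     (\<Sum>a<k. c a * (\<Sum>b<k. c b * ip n (u a) (mv n x (u b))))"
    unfolding qf_ip mv_sum ip_sum ip_sum' ..
  also have "\<dots> = (\<Sum>a<k. c a * (\<Sum>b<k. if a = b then c b * \<mu> b else 0))"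
    using assms by (intro sum.cong refl arg_cong2[where f="(*)"]) (auto simp: eigsys_def)
  finally show ?thesis by (simp add: power2_eq_square mult.assoc)
qed

text \<open>The part of \<open>v\<close> in the span of the eigenvectors and the residual
  \<open>r v\<close> are orthogonal both for \<open>ip\<close> and for the form, so their
  contributions add up: the first is at least \<open>lam\<close> and the second at least
  \<open>\<theta>\<close> times the squared norm.\<close>

lemma near_minimizer_residual:
  assumes n: "n \<ge> 1" and es: "eigsys n x d u \<mu>"
    and perp: "\<And>r. (\<And>a. a < d \<Longrightarrow> ip n (u a) r = 0) \<Longrightarrow> \<theta> * ip n r r \<le> qf n x r"
  defines "r \<equiv> \<lambda>v i. 1 * v i + (-1) * (\<Sum>a<d. ip n (u a) v * u a i)"
  shows "(\<theta> - lam n x) * ip n (r v) (r v) \<le> qf n x v - lam n x * ip n v v"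
    and "\<And>a. a < d \<Longrightarrow> ip n (u a) (r v) = 0"
proof -
  have on: "orthonormal n d u" using es by (auto simp: eigsys_def orthonormal_def)
  define s where "s = (\<lambda>i. \<Sum>a<d. ip n (u a) v * u a i)"
  have us: "ip n (u a) s = ip n (u a) v" if "a < d" for a
  proof -
    have "ip n (u a) s = (\<Sum>b<d. ip n (u b) v * of_bool (a = b))"
      unfolding s_def ip_sum' using on that by (intro sum.cong) (auto simp: orthonormal_def)
    then show ?thesis using that by (simp add: of_bool_def if_distrib cong: if_cong)
  qed
  show perp': "ip n (u a) (r v) = 0" if "a < d" for a
    unfolding r_def ip_lin' using us[OF that] by (simp add: s_def)
  have sr: "ip n s (r v) = 0" unfolding s_def ip_sum using perp' by simp
  have sAr: "ip n (r v) (mv n x s) = 0"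
  proof -
    have "ip n (r v) (mv n x (u a)) = 0" if "a < d" for a
      using es that perp'[OF that] by (simp add: eigsys_def ip_commute[of n "r v" "u a"])
    then show ?thesis unfolding s_def mv_sum ip_sum' by simp
  qed
  have v: "v = (\<lambda>i. 1 * s i + 1 * r v i)" by (simp add: r_def s_def fun_eq_iff)
  have qv: "qf n x v = qf n x s + qf n x (r v)"
    by (subst v, subst qf_lin) (simp add: sAr)
  have iv: "ip n v v = ip n s s + ip n (r v) (r v)"
    apply (subst (1 2) v) using sr ip_commute[of n s "r v"] unfolding ip_lin ip_lin' by simp
  have "qf n x s \<ge> lam n x * ip n s s" by (rule lam_le_qf[OF n])
  moreover have "qf n x (r v) \<ge> \<theta> * ip n (r v) (r v)" by (rule perp) (rule perp')
  ultimately show "(\<theta> - lam n x) * ip n (r v) (r v) \<le> qf n x v - lam n x * ip n v v"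
    unfolding qv iv by (simp add: algebra_simps)
qed

lemma ip_cauchy_schwarz: "(ip n u v)\<^sup>2 \<le> ip n u u * ip n v v"
  using Cauchy_Schwarz_ineq_sum[of u v "{1..n}"] by (simp add: ip_def power2_eq_square)

text \<open>A near-minimizer is determined, up to its small residual, by its coordinates along the
  \<open>d\<close> eigenvectors, which lie in \<open>[-1, 1]\<close>. Rounding them to a grid of
  mesh \<open>h\<close> is injective on a separated set: two vectors in one cell differ, in squared
  norm, by at most \<open>\<epsilon>^2 / 4\<close> within the span and
  \<open>\<epsilon>^2 / 4\<close> outside it. Each cell coordinate is an integer of modulus at most
  \<open>N\<close>, the ceiling of \<open>1 / h\<close>.\<close>

lemma separated_near_minimizers_card:
  assumes n: "n \<ge> 1" and es: "eigsys n x d u \<mu>" and d: "d \<le> k"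
    and perp: "\<And>r. (\<And>a. a < d \<Longrightarrow> ip n (u a) r = 0) \<Longrightarrow> \<theta> * ip n r r \<le> qf n x r"
    and \<theta>: "\<theta> > lam n x" "\<eta> \<le> (\<theta> - lam n x) * (\<epsilon>\<^sup>2 / 16)" and \<epsilon>: "\<epsilon> > 0"
    and h: "h > 0" "real k * h\<^sup>2 \<le> \<epsilon>\<^sup>2 / 4"
    and V: "\<And>v. v \<in> V \<Longrightarrow> ip n v v = 1 \<and> qf n x v \<le> lam n x + \<eta>"
    and sep: "pairwise (\<lambda>v w. euclid_dist n v w > \<epsilon>) V"
  shows "card V \<le> (2 * nat \<lceil>1 / h\<rceil> + 1) ^ k"
proof -
  define r where "r v = (\<lambda>i. 1 * v i + (-1) * (\<Sum>a<d. ip n (u a) v * u a i))" for v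
  note res = near_minimizer_residual[OF n es perp, folded r_def]
  have on: "orthonormal n d u" using es by (auto simp: eigsys_def orthonormal_def)
  have rb: "ip n (r v) (r v) \<le> \<epsilon>\<^sup>2 / 16" if "v \<in> V" for v
  proof -
    have "(\<theta> - lam n x) * ip n (r v) (r v) \<le> \<eta>" using res(1)[of v] V[OF that] by auto
    with \<theta> have "(\<theta> - lam n x) * ip n (r v) (r v) \<le> (\<theta> - lam n x) * (\<epsilon>\<^sup>2 / 16)" by linarith
    then show ?thesis using \<theta>(1) by (subst (asm) mult_le_cancel_left_pos) auto
  qed
  define N where "N = \<lceil>1 / h\<rceil>"
  \<comment> \<open>Coordinates from \<open>d\<close> up to \<open>k - 1\<close> are filled with 0,
    so that the cells for every \<open>d \<le> k\<close> lie in one function space and the bound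
    does not depend on \<open>d\<close>.\<close>
  define cell where "cell v = (\<lambda>a\<in>{..<k}. if a < d then \<lfloor>ip n (u a) v / h\<rfloor> else 0)" for v
  have "0 \<le> 1 / h" using h(1) by simp
  then have N0: "N \<ge> 0" unfolding N_def by linarith
  have "cell v \<in> {..<k} \<rightarrow>\<^sub>E {-N..N}" if v: "v \<in> V" for v
  proof -
    have "\<lfloor>ip n (u a) v / h\<rfloor> \<in> {-N..N}" if "a < d" for a
    proof -
      have "(ip n (u a) v)\<^sup>2 \<le> 1"
        using ip_cauchy_schwarz[of n "u a" v] V[OF v] on that by (auto simp: orthonormal_def)
      then have "\<bar>ip n (u a) v\<bar> \<le> 1" by (simp add: abs_square_le_1)
      then have "\<bar>ip n (u a) v / h\<bar> \<le> 1 / h" using h(1) by (simp add: divide_simps)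
      moreover have "1 / h \<le> of_int N" unfolding N_def by (rule le_of_int_ceiling)
      ultimately have "ip n (u a) v / h \<le> of_int N" "of_int (-N) \<le> ip n (u a) v / h"
        unfolding of_int_minus by linarith+
      then show ?thesis by (auto simp: le_floor_iff floor_le_iff)
    qed
    then show ?thesis using N0 by (auto simp: cell_def)
  qed
  then have sub: "cell ` V \<subseteq> {..<k} \<rightarrow>\<^sub>E {-N..N}" by blast
  have inj: "inj_on cell V"
  proof (rule inj_onI, rule ccontr)
    fix v w assume v: "v \<in> V" and w: "w \<in> V" and eq: "cell v = cell w" and ne: "v \<noteq> w"
    have close: "(ip n (u a) v - ip n (u a) w)\<^sup>2 \<le> h\<^sup>2" if "a < d" for a
    proof -
      have "\<lfloor>ip n (u a) v / h\<rfloor> = \<lfloor>ip n (u a) w / h\<rfloor>"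
        using fun_cong[OF eq, of a] that d by (simp add: cell_def)
      then have "\<bar>ip n (u a) v / h - ip n (u a) w / h\<bar> \<le> 1" by linarith
      then have "\<bar>ip n (u a) v - ip n (u a) w\<bar> \<le> h" using h(1)
        by (simp add: diff_divide_distrib[symmetric] divide_simps)
      then show ?thesis by (simp add: abs_le_square_iff[symmetric] h(1) less_imp_le)
    qed
    define s where "s = (\<lambda>i. \<Sum>a<d. (ip n (u a) v - ip n (u a) w) * u a i)"
    define t where "t = (\<lambda>i. 1 * r v i + (-1) * r w i)"
    have vw: "(\<lambda>i. v i - w i) = (\<lambda>i. 1 * s i + 1 * t i)"
      by (simp add: s_def t_def r_def fun_eq_iff left_diff_distrib sum_subtractf)
    have st: "ip n s t = 0"
      unfolding s_def t_def ip_sum ip_lin' using res(2) by simp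
    have ss: "ip n s s \<le> \<epsilon>\<^sup>2 / 4"
    proof -
      have "ip n s s = (\<Sum>a<d. (ip n (u a) v - ip n (u a) w)\<^sup>2)"
        unfolding s_def ip_sum_orthonormal[OF on] power2_eq_square ..
      also have "\<dots> \<le> (\<Sum>a<d. h\<^sup>2)" using close by (intro sum_mono) auto
      also have "\<dots> \<le> real k * h\<^sup>2" using d by (simp add: mult_right_mono)
      finally show ?thesis using h(2) by linarith
    qed
    have tt: "ip n t t \<le> \<epsilon>\<^sup>2 / 4"
    proof -
      have "ip n t t \<le> 2 * (ip n (r v) (r v) + ip n (r w) (r w))"
        unfolding ip_def t_def sum_distrib_left sum.distrib[symmetric]
      proof (intro sum_mono)
        fix i
        have "0 \<le> (r v i + r w i) * (r v i + r w i)" by simp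
        then show "(1 * r v i + - 1 * r w i) * (1 * r v i + - 1 * r w i) \<le> 2 * (r v i * r v i + r w i * r w i)"
          by (simp add: algebra_simps)
      qed
      then show ?thesis using rb[OF v] rb[OF w] by simp
    qed
    have "(euclid_dist n v w)\<^sup>2 = ip n (\<lambda>i. v i - w i) (\<lambda>i. v i - w i)"
      by (simp add: euclid_dist_def L2_set_def ip_def sum_nonneg power2_eq_square)
    also have "\<dots> = ip n s s + ip n t t"
      unfolding vw ip_lin ip_lin' using st ip_commute[of n t s] by simp
    also have "\<dots> \<le> \<epsilon>\<^sup>2" using ss tt zero_le_power2[of \<epsilon>] by linarith
    finally have "euclid_dist n v w \<le> \<epsilon>" by (rule power2_le_imp_le) (use \<epsilon> in auto)
    with pairwiseD[OF sep v w ne] show False by simp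
  qed
  have "card V = card (cell ` V)" using inj by (simp add: card_image)
  also have "\<dots> \<le> card ({..<k} \<rightarrow>\<^sub>E {-N..N})" by (rule card_mono[OF _ sub]) (auto intro: finite_PiE)
  also have "\<dots> = card {-N..N} ^ k" by (subst card_PiE) auto
  also have "card {-N..N} = 2 * nat N + 1" using N0 by simp
  finally show ?thesis by (simp add: N_def)
qed

section \<open>Exchanging coordinates of independent copies\<close>

text \<open>Acts on values where \<open>resample\<close> acts on random variables; restricting to
  \<open>I\<close> keeps the result in the extensional product space.\<close>

definition res :: "'i set \<Rightarrow> 'i set \<Rightarrow> ('i \<Rightarrow> real) \<Rightarrow> ('i \<Rightarrow> real) \<Rightarrow> 'i \<Rightarrow> real" where
  "res I J x y = (\<lambda>p\<in>I. if p \<in> J then y p else x p)"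

definition swap_coords :: "'i set \<Rightarrow> 'i set \<Rightarrow> ('i \<Rightarrow> real) \<times> ('i \<Rightarrow> real) \<Rightarrow> ('i \<Rightarrow> real) \<times> ('i \<Rightarrow> real)" where
  "swap_coords I J z = (res I J (fst z) (snd z), res I J (snd z) (fst z))"

lemma random_vector_resample:
  "random_vector I (resample J X Y) \<omega> = res I J (random_vector I X \<omega>) (random_vector I Y \<omega>)"
  by (auto simp: random_vector_def resample_def res_def fun_eq_iff)

lemma measurable_res [measurable]:
  assumes [measurable]: "f \<in> N \<rightarrow>\<^sub>M PiM I (\<lambda>_. P)" "g \<in> N \<rightarrow>\<^sub>M PiM I (\<lambda>_. P)"
  shows "(\<lambda>z. res I J (f z) (g z)) \<in> N \<rightarrow>\<^sub>M PiM I (\<lambda>_. P)"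
  unfolding res_def
proof (rule measurable_restrict)
  fix p assume [measurable]: "p \<in> I"
  show "(\<lambda>z. if p \<in> J then g z p else f z p) \<in> N \<rightarrow>\<^sub>M P"
    by (cases "p \<in> J") (auto intro: measurable_compose[OF _ measurable_component_singleton] assms \<open>p \<in> I\<close>)
qed

lemma measurable_swap_coords [measurable]:
  "swap_coords I J \<in> PiM I (\<lambda>_. P) \<Otimes>\<^sub>M PiM I (\<lambda>_. P) \<rightarrow>\<^sub>M PiM I (\<lambda>_. P) \<Otimes>\<^sub>M PiM I (\<lambda>_. P)"
  unfolding swap_coords_def by measurable

text \<open>Both sides are images of the product over \<open>I \<times> bool\<close>, on which exchanging coordinates is a
  permutation of the index set.\<close>

lemma distr_swap_coords:
  fixes P :: "real measure" and I :: "'i set"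
  assumes P: "prob_space P" and fin: "finite I"
  shows "distr (PiM I (\<lambda>_. P) \<Otimes>\<^sub>M PiM I (\<lambda>_. P)) (PiM I (\<lambda>_. P) \<Otimes>\<^sub>M PiM I (\<lambda>_. P)) (swap_coords I J) =
    PiM I (\<lambda>_. P) \<Otimes>\<^sub>M PiM I (\<lambda>_. P)"
proof -
  interpret Pr: prob_space P by fact
  interpret product_sigma_finite "\<lambda>_::'i \<times> bool. P"
    by unfold_locales
  let ?\<mu> = "PiM I (\<lambda>_. P)"
  define A where "A = I \<times> {True}"
  define B where "B = I \<times> {False}"
  define W where "W = PiM (A \<union> B) (\<lambda>_. P)"
  define \<Phi> where "\<Phi> \<omega> = ((\<lambda>p\<in>I. \<omega> (p, True)), (\<lambda>p\<in>I. \<omega> (p, False)))" for \<omega> :: "'i \<times> bool \<Rightarrow> real"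
  have [measurable]: "(\<lambda>\<omega>. \<lambda>p\<in>I. \<omega> (p, b)) \<in> PiM C (\<lambda>_. P) \<rightarrow>\<^sub>M ?\<mu>" if "I \<times> {b} \<subseteq> C" for b C
    using that by (intro measurable_restrict measurable_component_singleton) auto
  have mPhi [measurable]: "\<Phi> \<in> W \<rightarrow>\<^sub>M ?\<mu> \<Otimes>\<^sub>M ?\<mu>"
    unfolding \<Phi>_def W_def by (intro measurable_Pair) (auto simp: A_def B_def)
  have [measurable]: "merge A B \<in> PiM A (\<lambda>_. P) \<Otimes>\<^sub>M PiM B (\<lambda>_. P) \<rightarrow>\<^sub>M W"
    unfolding W_def by (rule measurable_merge)
  have AB: "A \<inter> B = {}" "finite A" "finite B" using fin by (auto simp: A_def B_def)
  have rA: "distr (PiM A (\<lambda>_. P)) ?\<mu> (\<lambda>\<omega>. \<lambda>p\<in>I. \<omega> (p, True)) = ?\<mu>"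
    by (rule distr_PiM_reindex) (auto simp: P A_def inj_on_def)
  have rB: "distr (PiM B (\<lambda>_. P)) ?\<mu> (\<lambda>\<omega>. \<lambda>p\<in>I. \<omega> (p, False)) = ?\<mu>"
    by (rule distr_PiM_reindex) (auto simp: P B_def inj_on_def)
  interpret mu: prob_space ?\<mu> by (rule prob_space_PiM) (rule P)
  have base: "distr W (?\<mu> \<Otimes>\<^sub>M ?\<mu>) \<Phi> = ?\<mu> \<Otimes>\<^sub>M ?\<mu>"
  proof -
    have "?\<mu> \<Otimes>\<^sub>M ?\<mu> = distr (PiM A (\<lambda>_. P)) ?\<mu> (\<lambda>\<omega>. \<lambda>p\<in>I. \<omega> (p, True)) \<Otimes>\<^sub>M
        distr (PiM B (\<lambda>_. P)) ?\<mu> (\<lambda>\<omega>. \<lambda>p\<in>I. \<omega> (p, False))"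
      unfolding rA rB ..
    also have "\<dots> = distr (PiM A (\<lambda>_. P) \<Otimes>\<^sub>M PiM B (\<lambda>_. P)) (?\<mu> \<Otimes>\<^sub>M ?\<mu>)
        (\<lambda>(x, y). ((\<lambda>p\<in>I. x (p, True)), (\<lambda>p\<in>I. y (p, False))))"
      by (intro pair_measure_distr)
         (auto simp: A_def B_def rB[unfolded B_def] intro!: mu.sigma_finite_measure_axioms)
    also have "\<dots> = distr (PiM A (\<lambda>_. P) \<Otimes>\<^sub>M PiM B (\<lambda>_. P)) (?\<mu> \<Otimes>\<^sub>M ?\<mu>) (\<Phi> \<circ> merge A B)"
      by (intro distr_cong refl) (auto simp: \<Phi>_def merge_def A_def B_def fun_eq_iff)
    also have "\<dots> = distr (distr (PiM A (\<lambda>_. P) \<Otimes>\<^sub>M PiM B (\<lambda>_. P)) W (merge A B)) (?\<mu> \<Otimes>\<^sub>M ?\<mu>) \<Phi>"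
      by (subst distr_distr) auto
    also have "distr (PiM A (\<lambda>_. P) \<Otimes>\<^sub>M PiM B (\<lambda>_. P)) W (merge A B) = W"
      unfolding W_def by (rule distr_merge[OF AB])
    finally show ?thesis ..
  qed
  define \<pi> where "\<pi> k = (fst k, if fst k \<in> J then \<not> snd k else snd k)" for k :: "'i \<times> bool"
  define \<tau> where "\<tau> \<omega> = (\<lambda>k\<in>A \<union> B. \<omega> (\<pi> k))" for \<omega> :: "'i \<times> bool \<Rightarrow> real"
  have K: "A \<union> B = I \<times> UNIV" by (auto simp: A_def B_def)
  have \<tau>: "distr W W \<tau> = W"
    unfolding W_def \<tau>_def
    by (rule distr_PiM_reindex[of "A \<union> B" "\<lambda>_. P" \<pi>]) (auto simp: P K \<pi>_def inj_on_def split: if_splits)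
  have m\<tau> [measurable]: "\<tau> \<in> W \<rightarrow>\<^sub>M W"
    unfolding W_def \<tau>_def K by (intro measurable_restrict measurable_component_singleton) (auto simp: \<pi>_def)
  have "distr (?\<mu> \<Otimes>\<^sub>M ?\<mu>) (?\<mu> \<Otimes>\<^sub>M ?\<mu>) (swap_coords I J) = distr W (?\<mu> \<Otimes>\<^sub>M ?\<mu>) (swap_coords I J \<circ> \<Phi>)"
    by (subst base[symmetric], subst distr_distr) auto
  also have "\<dots> = distr W (?\<mu> \<Otimes>\<^sub>M ?\<mu>) (\<Phi> \<circ> \<tau>)"
    by (intro distr_cong refl)
       (auto simp: swap_coords_def res_def \<Phi>_def \<tau>_def \<pi>_def K fun_eq_iff)
  also have "\<dots> = distr (distr W W \<tau>) (?\<mu> \<Otimes>\<^sub>M ?\<mu>) \<Phi>"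
    by (subst distr_distr) auto
  finally show ?thesis unfolding \<tau> base .
qed

text \<open>What the entry law contributes. The density acts through the absence of atoms, which
  lets a random entry avoid any countable set of values; positivity of \<open>\<sigma>\<close> makes
  the gain of order \<open>\<sigma> * sqrt K\<close> effective.\<close>

locale wigner_input = prob_space P for P :: "real measure" +
  fixes \<sigma> :: real
  assumes sets_P [measurable_cong, simp]: "sets P = sets borel"
    and integrable_pow: "integrable P (\<lambda>x. x ^ k)"
    and mean_zero: "(\<integral>x. x \<partial>P) = 0"
    and second_moment: "(\<integral>x. x\<^sup>2 \<partial>P) = \<sigma>\<^sup>2"
    and sigma_pos: "\<sigma> > 0"
    and atomless: "emeasure P {t} = 0"
begin

definition mu :: "nat \<Rightarrow> (nat \<times> nat \<Rightarrow> real) measure" where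
  "mu n = PiM (upper_indices n) (\<lambda>_. P)"

abbreviation mu2 :: "nat \<Rightarrow> ((nat \<times> nat \<Rightarrow> real) \<times> (nat \<times> nat \<Rightarrow> real)) measure" where
  "mu2 n \<equiv> mu n \<Otimes>\<^sub>M mu n"

abbreviation rs :: "nat \<Rightarrow> (nat \<times> nat) set \<Rightarrow> (nat \<times> nat \<Rightarrow> real) \<Rightarrow> (nat \<times> nat \<Rightarrow> real) \<Rightarrow> nat \<times> nat \<Rightarrow> real" where
  "rs n \<equiv> res (upper_indices n)"

lemma prob_space_mu: "prob_space (mu n)"
  unfolding mu_def by (rule prob_space_PiM) (rule prob_space_axioms)

lemma prob_space_mu2: "prob_space (mu2 n)"
proof -
  interpret mu: prob_space "mu n" by (rule prob_space_mu)
  interpret pair_prob_space "mu n" "mu n" ..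
  show ?thesis by (rule prob_space_axioms)
qed

lemma pair_sigma_finite_mu: "pair_sigma_finite (mu n) (mu n)"
proof -
  interpret mu: prob_space "mu n" by (rule prob_space_mu)
  show ?thesis ..
qed

lemma measurable_coord [measurable]:
  assumes "p \<in> upper_indices n" shows "(\<lambda>x. x p) \<in> borel_measurable (mu n)"
proof -
  have "(\<lambda>x. x p) \<in> mu n \<rightarrow>\<^sub>M P"
    unfolding mu_def using assms by (rule measurable_component_singleton)
  then show ?thesis by (simp add: measurable_cong_sets[OF refl sets_P])
qed

lemma measurable_rs [measurable]:
  "(\<lambda>z. rs n J (fst z) (snd z)) \<in> mu2 n \<rightarrow>\<^sub>M mu n"
  "(\<lambda>z. rs n J (snd z) (fst z)) \<in> mu2 n \<rightarrow>\<^sub>M mu n"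
  unfolding mu_def by measurable

lemma distr_coord:
  assumes "p \<in> upper_indices n" shows "distr (mu n) borel (\<lambda>x. x p) = P"
proof -
  have "distr (mu n) P (\<lambda>x. x p) = P"
    unfolding mu_def by (rule distr_PiM_component[OF _ assms]) (rule prob_space_axioms)
  moreover have "distr (mu n) P (\<lambda>x. x p) = distr (mu n) borel (\<lambda>x. x p)"
    by (intro distr_cong) auto
  ultimately show ?thesis by simp
qed

lemma coord_integral:
  fixes g :: "real \<Rightarrow> real"
  assumes p: "p \<in> upper_indices n" and [measurable]: "g \<in> borel_measurable borel"
  shows "integrable (mu n) (\<lambda>x. g (x p)) \<longleftrightarrow> integrable P g"
    and "(\<integral>x. g (x p) \<partial>mu n) = (\<integral>t. g t \<partial>P)"
proof -
  note [measurable] = p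
  show "integrable (mu n) (\<lambda>x. g (x p)) \<longleftrightarrow> integrable P g"
    by (subst distr_coord[OF p, symmetric], subst integrable_distr_eq) auto
  show "(\<integral>x. g (x p) \<partial>mu n) = (\<integral>t. g t \<partial>P)"
    by (subst (2) distr_coord[OF p, symmetric], subst integral_distr) auto
qed

lemma distr_swap_mu: "distr (mu2 n) (mu2 n) (swap_coords (upper_indices n) J) = mu2 n"
  unfolding mu_def by (rule distr_swap_coords[OF prob_space_axioms finite_upper])

lemma measurable_swap_mu [measurable]: "swap_coords (upper_indices n) J \<in> mu2 n \<rightarrow>\<^sub>M mu2 n"
  unfolding mu_def by measurable

lemma nn_integral_swap:
  assumes [measurable]: "F \<in> borel_measurable (mu2 n)"
  shows "(\<integral>\<^sup>+z. F (swap_coords (upper_indices n) J z) \<partial>mu2 n) = (\<integral>\<^sup>+z. F z \<partial>mu2 n)"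
  by (subst (2) distr_swap_mu[symmetric, of n J], subst nn_integral_distr) auto

lemma distr_fst_mu2: "distr (mu2 n) (mu n) fst = mu n"
proof -
  interpret mu: prob_space "mu n" by (rule prob_space_mu)
  show ?thesis
  proof (rule measure_eqI)
    fix A assume "A \<in> sets (distr (mu2 n) (mu n) fst)"
    then have A: "A \<in> sets (mu n)" by simp
    have "fst -` A \<inter> space (mu2 n) = A \<times> space (mu n)"
      using sets.sets_into_space[OF A] by (auto simp: space_pair_measure)
    then show "emeasure (distr (mu2 n) (mu n) fst) A = emeasure (mu n) A"
      using A by (simp add: emeasure_distr mu.emeasure_pair_measure_Times mu.emeasure_space_1)
  qed simp
qed

lemma distr_snd_mu2: "distr (mu2 n) (mu n) snd = mu n"
proof -
  interpret mu: prob_space "mu n" by (rule prob_space_mu)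
  show ?thesis
  proof (rule measure_eqI)
    fix A assume "A \<in> sets (distr (mu2 n) (mu n) snd)"
    then have A: "A \<in> sets (mu n)" by simp
    have "snd -` A \<inter> space (mu2 n) = space (mu n) \<times> A"
      using sets.sets_into_space[OF A] by (auto simp: space_pair_measure)
    then show "emeasure (distr (mu2 n) (mu n) snd) A = emeasure (mu n) A"
      using A by (simp add: emeasure_distr mu.emeasure_pair_measure_Times mu.emeasure_space_1)
  qed simp
qed

lemma distr_rs: "distr (mu2 n) (mu n) (\<lambda>z. rs n J (fst z) (snd z)) = mu n"
proof -
  have "distr (mu2 n) (mu n) (\<lambda>z. rs n J (fst z) (snd z)) =
      distr (distr (mu2 n) (mu2 n) (swap_coords (upper_indices n) J)) (mu n) fst"
    by (subst distr_distr) (auto simp: swap_coords_def comp_def)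
  then show ?thesis by (simp add: distr_swap_mu distr_fst_mu2)
qed

lemma fst_integral:
  fixes f :: "_ \<Rightarrow> real"
  assumes [measurable]: "f \<in> borel_measurable (mu n)"
  shows "integrable (mu2 n) (\<lambda>z. f (fst z)) \<longleftrightarrow> integrable (mu n) f"
    and "(\<integral>z. f (fst z) \<partial>mu2 n) = (\<integral>x. f x \<partial>mu n)"
    and "integrable (mu2 n) (\<lambda>z. f (snd z)) \<longleftrightarrow> integrable (mu n) f"
    and "(\<integral>z. f (snd z) \<partial>mu2 n) = (\<integral>x. f x \<partial>mu n)"
    and "integrable (mu2 n) (\<lambda>z. f (rs n J (fst z) (snd z))) \<longleftrightarrow> integrable (mu n) f"
    and "(\<integral>z. f (rs n J (fst z) (snd z)) \<partial>mu2 n) = (\<integral>x. f x \<partial>mu n)"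
  apply (subst distr_fst_mu2[symmetric], subst integrable_distr_eq; simp)
  apply (subst (2) distr_fst_mu2[symmetric], subst integral_distr; simp)
  apply (subst distr_snd_mu2[symmetric], subst integrable_distr_eq; simp)
  apply (subst (2) distr_snd_mu2[symmetric], subst integral_distr; simp)
  apply (subst distr_rs[symmetric, of _ J], subst integrable_distr_eq; simp)
  apply (subst (2) distr_rs[symmetric, of _ J], subst integral_distr; simp)
  done

text \<open>Resampling \<open>p\<close> turns the factors into functions of the two independent copies.\<close>

lemma integral_mult_coord:
  fixes f :: "_ \<Rightarrow> real" and g :: "real \<Rightarrow> real"
  assumes p: "p \<in> upper_indices n"
    and f: "integrable (mu n) f" and g: "integrable P g"
    and ign: "\<And>x y. f (rs n {p} x y) = f x"
  shows "integrable (mu n) (\<lambda>x. f x * g (x p))"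
    and "(\<integral>x. f x * g (x p) \<partial>mu n) = (\<integral>x. f x \<partial>mu n) * (\<integral>t. g t \<partial>P)"
proof -
  note [measurable] = p
  interpret mu: prob_space "mu n" by (rule prob_space_mu)
  interpret pr: pair_sigma_finite "mu n" "mu n" by (rule pair_sigma_finite_mu)
  have gm [measurable]: "g \<in> borel_measurable borel"
    using borel_measurable_integrable[OF g] by (simp add: measurable_cong_sets[OF sets_P refl])
  have fm [measurable]: "f \<in> borel_measurable (mu n)" using f by auto
  have g': "integrable (mu n) (\<lambda>x. g (x p))" using coord_integral(1)[OF p gm] g by simp
  have eq: "f (rs n {p} (fst z) (snd z)) * g (rs n {p} (fst z) (snd z) p) = f (fst z) * g (snd z p)" for z
    using p by (simp add: ign) (simp add: res_def)
  have pi: "integrable (mu2 n) (\<lambda>z. f (fst z) * g (snd z p))"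
    using f g' by (intro pr.Fubini_integrable)
      (auto simp: abs_mult norm_mult intro!: integrable_mult_right)
  have m: "(\<lambda>x. f x * g (x p)) \<in> borel_measurable (mu n)" by measurable
  show "integrable (mu n) (\<lambda>x. f x * g (x p))"
    using fst_integral(5)[OF m, of "{p}"] pi unfolding eq by simp
  have "(\<integral>x. f x * g (x p) \<partial>mu n) = (\<integral>z. f (fst z) * g (snd z p) \<partial>mu2 n)"
    using fst_integral(6)[OF m, of "{p}"] unfolding eq by simp
  also have "\<dots> = (\<integral>x. (\<integral>y. f x * g (y p) \<partial>mu n) \<partial>mu n)"
    using pi by (subst pr.integral_fst'[symmetric]) auto
  also have "\<dots> = (\<integral>x. f x \<partial>mu n) * (\<integral>t. g t \<partial>P)"
    using g' f by (simp add: coord_integral(2)[OF p gm])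
  finally show "(\<integral>x. f x * g (x p) \<partial>mu n) = (\<integral>x. f x \<partial>mu n) * (\<integral>t. g t \<partial>P)" .
qed

end

section \<open>Powers of matrices with random signs\<close>

definition toggle :: "'a \<Rightarrow> 'a set \<Rightarrow> 'a set" where
  "toggle e T = (if e \<in> T then T - {e} else insert e T)"

text \<open>A sign pattern is encoded by the set \<open>J\<close> of its negative positions, so that
  averaging over signs is a sum over \<open>Pow I\<close>, and exchanging the coordinates in
  \<open>J\<close> multiplies the difference of two inputs by exactly these signs.\<close>

definition sgn_at :: "'a set \<Rightarrow> 'a \<Rightarrow> real" where
  "sgn_at J e = (if e \<in> J then -1 else 1)"

definition walsh :: "'a set \<Rightarrow> 'a set \<Rightarrow> real" where
  "walsh J S = (\<Prod>e\<in>S. sgn_at J e)"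

lemma toggle_toggle [simp]: "toggle e (toggle e T) = T"
  by (auto simp: toggle_def)

lemma mem_toggle [simp]: "e \<in> toggle e T \<longleftrightarrow> e \<notin> T"
  by (auto simp: toggle_def)

lemma bij_toggle: "e \<in> I \<Longrightarrow> bij_betw (toggle e) (Pow I) (Pow I)"
  by (rule bij_betw_byWitness[where f' = "toggle e"]) (auto simp: toggle_def)

lemma sum_toggle: "e \<in> I \<Longrightarrow> (\<Sum>T\<in>Pow I. g (toggle e T)) = (\<Sum>T\<in>Pow I. g T)"
  by (rule sum.reindex_bij_betw[OF bij_toggle])

lemma sgn_at_sq [simp]: "sgn_at J e * sgn_at J e = 1"
  by (simp add: sgn_at_def)

lemma walsh_toggle:
  assumes "finite S" shows "walsh J (toggle e S) = sgn_at J e * walsh J S"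
proof (cases "e \<in> S")
  case True
  then have "walsh J S = sgn_at J e * walsh J (S - {e})"
    using assms by (simp add: walsh_def prod.remove)
  then show ?thesis using True by (simp add: toggle_def mult.assoc[symmetric])
next
  case False
  then show ?thesis using assms by (simp add: toggle_def walsh_def)
qed

lemma walsh_flip:
  assumes "finite S" shows "walsh (toggle e J) S = (if e \<in> S then - walsh J S else walsh J S)"
proof -
  have "sgn_at (toggle e J) e' = sgn_at J e'" if "e' \<noteq> e" for e'
    using that by (auto simp: sgn_at_def toggle_def)
  moreover have "sgn_at (toggle e J) e = - sgn_at J e" by (auto simp: sgn_at_def)
  ultimately show ?thesis
    using assms unfolding walsh_def
    by (cases "e \<in> S") (auto simp: prod.remove[of S e] intro!: prod.cong, metis)
qed

text \<open>If \<open>e\<close> lies in exactly one of \<open>S\<close> and \<open>T\<close>,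
  flipping the sign at \<open>e\<close> permutes the patterns and negates every summand.\<close>

lemma walsh_orthogonal:
  assumes I: "finite I" and S: "S \<subseteq> I" "T \<subseteq> I"
  shows "(\<Sum>J\<in>Pow I. walsh J S * walsh J T) = 2 ^ card I * of_bool (S = T)"
proof (cases "S = T")
  case True
  have "walsh J S * walsh J S = 1" for J
    unfolding walsh_def by (simp add: prod.distrib[symmetric])
  then show ?thesis using True I by (simp add: card_Pow)
next
  case False
  then obtain e where e: "(e \<in> S) \<noteq> (e \<in> T)" by auto
  then have eI: "e \<in> I" using S by auto
  have fin: "finite S" "finite T" using S I finite_subset by auto
  have "(\<Sum>J\<in>Pow I. walsh J S * walsh J T) = (\<Sum>J\<in>Pow I. walsh (toggle e J) S * walsh (toggle e J) T)"
    by (rule sum_toggle[OF eI, symmetric])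
  also have "\<dots> = (\<Sum>J\<in>Pow I. - (walsh J S * walsh J T))"
    using e by (intro sum.cong) (auto simp: walsh_flip fin)
  finally show ?thesis using False by (simp add: sum_negf)
qed

section \<open>Walsh coefficients of matrix powers and their norms\<close>

definition unitv :: "nat \<Rightarrow> nat \<Rightarrow> real" where "unitv x i = of_bool (i = x)"

text \<open>The total weight, without signs, of the walks of length \<open>k\<close> from
  \<open>v\<close> to \<open>x\<close> whose edges traversed an odd number of times form
  \<open>S\<close>; for edges traversed evenly often the signs cancel.\<close>

fun walk_coeff :: "nat \<Rightarrow> (nat \<times> nat \<Rightarrow> real) \<Rightarrow> nat \<Rightarrow> nat \<Rightarrow> nat \<Rightarrow> (nat \<times> nat) set \<Rightarrow> real" where
  "walk_coeff n b x 0 v S = of_bool (v = x \<and> S = {})"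
| "walk_coeff n b x (Suc k) v S =
     (\<Sum>w\<in>{1..n}. b (edge v w) * walk_coeff n b x k w (toggle (edge v w) S))"

lemma mv_power_walsh:
  assumes "v \<in> {1..n}"
  shows "(mv n (\<lambda>e. sgn_at J e * b e) ^^ k) (unitv x) v =
    (\<Sum>S\<in>Pow (upper_indices n). walk_coeff n b x k v S * walsh J S)"
  using assms
proof (induction k arbitrary: v)
  case 0
  have "(\<Sum>S\<in>Pow (upper_indices n). walk_coeff n b x 0 v S * walsh J S) =
      (\<Sum>S\<in>Pow (upper_indices n). if S = {} then of_bool (v = x) else 0)"
    by (intro sum.cong) (auto simp: walsh_def)
  then show ?case by (simp add: unitv_def)
next
  case (Suc k)
  let ?I = "upper_indices n"
  have fin: "finite S" if "S \<in> Pow ?I" for S using finite_subset[OF _ finite_upper] that by blast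
  have "(mv n (\<lambda>e. sgn_at J e * b e) ^^ Suc k) (unitv x) v =
    (\<Sum>w\<in>{1..n}. sgn_at J (edge v w) * b (edge v w) *
       (\<Sum>S\<in>Pow ?I. walk_coeff n b x k w S * walsh J S))"
    by (simp only: funpow.simps comp_apply, subst mv_def, intro sum.cong refl, simp only: Suc.IH)
  also have "\<dots> = (\<Sum>w\<in>{1..n}. \<Sum>S\<in>Pow ?I. b (edge v w) * walk_coeff n b x k w (toggle (edge v w) S) * walsh J S)"
  proof (intro sum.cong refl)
    fix w assume w: "w \<in> {1..n}"
    have eI: "edge v w \<in> ?I" using edge_in_upper Suc.prems w by blast
    have "sgn_at J (edge v w) * b (edge v w) * (\<Sum>S\<in>Pow ?I. walk_coeff n b x k w S * walsh J S) =
      (\<Sum>S\<in>Pow ?I. b (edge v w) * walk_coeff n b x k w S * walsh J (toggle (edge v w) S))"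
      unfolding sum_distrib_left by (intro sum.cong refl) (simp add: walsh_toggle[OF fin] mult_ac)
    also have "\<dots> = (\<Sum>S\<in>Pow ?I. b (edge v w) * walk_coeff n b x k w (toggle (edge v w) S) * walsh J S)"
      by (subst sum_toggle[OF eI, symmetric]) simp
    finally show "sgn_at J (edge v w) * b (edge v w) * (\<Sum>S\<in>Pow ?I. walk_coeff n b x k w S * walsh J S) =
      (\<Sum>S\<in>Pow ?I. b (edge v w) * walk_coeff n b x k w (toggle (edge v w) S) * walsh J S)" .
  qed
  also have "\<dots> = (\<Sum>S\<in>Pow ?I. walk_coeff n b x (Suc k) v S * walsh J S)"
    by (subst sum.swap) (simp add: sum_distrib_right)
  finally show ?case .
qed

lemma walsh_parseval:
  assumes I: "finite I"
  shows "(\<Sum>J\<in>Pow I. (\<Sum>S\<in>Pow I. c S * walsh J S)\<^sup>2) = 2 ^ card I * (\<Sum>S\<in>Pow I. (c S)\<^sup>2)"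
proof -
  have "(\<Sum>J\<in>Pow I. (\<Sum>S\<in>Pow I. c S * walsh J S)\<^sup>2) =
    (\<Sum>J\<in>Pow I. \<Sum>S\<in>Pow I. \<Sum>T\<in>Pow I. c S * c T * (walsh J S * walsh J T))"
    by (simp add: power2_eq_square sum_product mult_ac)
  also have "\<dots> = (\<Sum>S\<in>Pow I. \<Sum>T\<in>Pow I. \<Sum>J\<in>Pow I. c S * c T * (walsh J S * walsh J T))"
    by (rule trans[OF sum.swap]) (intro sum.cong refl sum.swap)
  also have "\<dots> = (\<Sum>S\<in>Pow I. \<Sum>T\<in>Pow I. if S = T then 2 ^ card I * (c S)\<^sup>2 else 0)"
    using walsh_orthogonal[OF I]
    by (intro sum.cong refl) (auto simp: sum_distrib_left[symmetric] power2_eq_square)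
  also have "\<dots> = 2 ^ card I * (\<Sum>S\<in>Pow I. (c S)\<^sup>2)"
    using I by (simp add: sum_distrib_left)
  finally show ?thesis .
qed

text \<open>Each step of a walk changes the edge set by one edge. This keeps the sets small, hence
  also the degree sums that bound the operator.\<close>

lemma walk_coeff_support:
  "finite S \<Longrightarrow> walk_coeff n b x k v S \<noteq> 0 \<Longrightarrow> card S \<le> k"
proof (induction k arbitrary: v S)
  case (Suc k)
  then obtain w where "walk_coeff n b x k w (toggle (edge v w) S) \<noteq> 0"
    by (auto elim!: sum.not_neutral_contains_not_neutral)
  moreover have "finite (toggle (edge v w) S)" using Suc.prems by (simp add: toggle_def)
  ultimately have "card (toggle (edge v w) S) \<le> k" by (rule Suc.IH[rotated])
  moreover have "card S \<le> Suc (card (toggle (edge v w) S))"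
    using Suc.prems(1) by (auto simp: toggle_def card_insert_if card_Diff_singleton)
  ultimately show ?case by linarith
qed (auto split: if_splits)

definition deg_in :: "nat \<Rightarrow> (nat \<times> nat) set \<Rightarrow> nat \<Rightarrow> nat" where
  "deg_in n S v = card {w \<in> {1..n}. edge v w \<in> S}"

text \<open>Handshake: the incident pairs \<open>(v, w)\<close> lie among the elements of
  \<open>S\<close> and their reversals. A loop is counted once, hence only an inequality.\<close>

lemma sum_deg_in:
  assumes "finite S" shows "(\<Sum>v\<in>{1..n}. deg_in n S v) \<le> 2 * card S"
proof -
  have "(\<Sum>v\<in>{1..n}. deg_in n S v) = card (SIGMA v:{1..n}. {w \<in> {1..n}. edge v w \<in> S})"
    by (simp add: deg_in_def)
  also have "\<dots> \<le> card (S \<union> prod.swap ` S)"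
  proof (rule card_mono)
    show "finite (S \<union> prod.swap ` S)" using assms by simp
    show "(SIGMA v:{1..n}. {w \<in> {1..n}. edge v w \<in> S}) \<subseteq> S \<union> prod.swap ` S"
      by (force simp: edge_def min_def max_def image_iff split: if_splits)
  qed
  also have "\<dots> \<le> card S + card (prod.swap ` S)" by (rule card_Un_le)
  also have "\<dots> \<le> 2 * card S" using card_image_le[OF assms, of prod.swap] by simp
  finally show ?thesis .
qed

lemma deg_in_insert:
  assumes "w \<in> {1..n}" "edge v w \<notin> S"
  shows "deg_in n (insert (edge v w) S) v = Suc (deg_in n S v)"
proof -
  have "{w' \<in> {1..n}. edge v w' \<in> insert (edge v w) S} = insert w {w' \<in> {1..n}. edge v w' \<in> S}"
    using assms edge_inj[of v UNIV] by (auto simp: inj_on_def)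
  then show ?thesis using assms by (simp add: deg_in_def)
qed

text \<open>Inserting a new edge raises the degree at \<open>v\<close> by one. The added ones sum to
  the squared row norm, and by the handshake bound the old degrees contribute at most
  \<open>2 * k\<close> times the largest squared entry.\<close>

lemma weighted_degree_bound:
  assumes w: "w \<in> {1..n}" and S: "finite S" "card S \<le> k"
    and row: "(\<Sum>v\<in>{1..n}. (b (edge v w))\<^sup>2) \<le> \<rho>"
    and entry: "\<And>v. v \<in> {1..n} \<Longrightarrow> (b (edge v w))\<^sup>2 \<le> \<beta>"
  shows "(\<Sum>v\<in>{1..n}. of_bool (edge v w \<notin> S) * real (deg_in n (insert (edge v w) S) v) * (b (edge v w))\<^sup>2)
     \<le> \<rho> + 2 * real k * \<beta>"
proof -
  have b0: "0 \<le> \<beta>" using entry[OF w] by (meson order_trans zero_le_power2)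
  have "(\<Sum>v\<in>{1..n}. of_bool (edge v w \<notin> S) * real (deg_in n (insert (edge v w) S) v) * (b (edge v w))\<^sup>2)
     \<le> (\<Sum>v\<in>{1..n}. (b (edge v w))\<^sup>2 + real (deg_in n S v) * \<beta>)"
  proof (intro sum_mono)
    fix v assume v: "v \<in> {1..n}"
    have "real (deg_in n S v) * (b (edge v w))\<^sup>2 \<le> real (deg_in n S v) * \<beta>"
      using entry[OF v] by (intro mult_left_mono) auto
    then show "of_bool (edge v w \<notin> S) * real (deg_in n (insert (edge v w) S) v) * (b (edge v w))\<^sup>2
       \<le> (b (edge v w))\<^sup>2 + real (deg_in n S v) * \<beta>"
      using b0 by (cases "edge v w \<in> S") (auto simp: deg_in_insert[OF w] distrib_right)
  qed
  also have "\<dots> = (\<Sum>v\<in>{1..n}. (b (edge v w))\<^sup>2) + real (\<Sum>v\<in>{1..n}. deg_in n S v) * \<beta>"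
    by (simp add: sum.distrib sum_distrib_right)
  also have "\<dots> \<le> \<rho> + real (2 * k) * \<beta>"
    using sum_deg_in[OF S(1), of n] S(2) b0 row
    by (intro add_mono mult_right_mono) linarith+
  finally show ?thesis by simp
qed

text \<open>The weight \<open>d\<close> is left free, since the two halves of the operator call for
  different choices: a degree where the edge is removed for \<open>\<psi>\<close>, and
  \<open>u\<close> divided by a degree where it is added.\<close>

lemma young: "0 < d \<Longrightarrow> (s::real) * t \<le> s\<^sup>2 / (4 * d) + d * t\<^sup>2"
proof -
  assume d: "0 < d"
  have "0 \<le> (s / (2 * sqrt d) - sqrt d * t)\<^sup>2" by simp
  also have "\<dots> = s\<^sup>2 / (4 * d) + d * t\<^sup>2 - s * t"
    using d by (simp add: power2_diff power_divide power_mult_distrib)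
  finally show ?thesis by simp
qed

text \<open>The operator splits into the part that adds an edge to \<open>S\<close> and its adjoint; Cauchy--Schwarz with
  the degrees in the larger of the two edge sets as weights bounds both.\<close>

lemma walk_operator_bound:
  fixes \<psi> :: "nat \<Rightarrow> (nat \<times> nat) set \<Rightarrow> real" and b :: "nat \<times> nat \<Rightarrow> real" and n :: nat
  defines "I \<equiv> upper_indices n"
  defines "\<phi> \<equiv> \<lambda>v T. \<Sum>w\<in>{1..n}. b (edge v w) * \<psi> w (toggle (edge v w) T)"
  assumes row: "\<And>w. w \<in> {1..n} \<Longrightarrow> (\<Sum>v\<in>{1..n}. (b (edge v w))\<^sup>2) \<le> \<rho>"
    and entry: "\<And>e. e \<in> I \<Longrightarrow> (b e)\<^sup>2 \<le> \<beta>"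
    and supp: "\<And>v S. S \<subseteq> I \<Longrightarrow> \<psi> v S \<noteq> 0 \<Longrightarrow> card S \<le> k"
    and supp': "\<And>v S. S \<subseteq> I \<Longrightarrow> \<phi> v S \<noteq> 0 \<Longrightarrow> card S \<le> k"
    and u: "u > 0" "\<rho> + 2 * real k * \<beta> \<le> u"
  shows "(\<Sum>v\<in>{1..n}. \<Sum>S\<in>Pow I. (\<phi> v S)\<^sup>2) \<le> 4 * u * (\<Sum>v\<in>{1..n}. \<Sum>S\<in>Pow I. (\<psi> v S)\<^sup>2)"
proof -
  let ?V = "{1..n}"
  define d where "d S v = real (deg_in n S v)" for S v
  have finI: "finite I" by (simp add: I_def)
  have fin: "finite S" if "S \<in> Pow I" for S using finite_subset[OF _ finI] that by blast
  have eI: "edge v w \<in> I" if "v \<in> ?V" "w \<in> ?V" for v w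
    unfolding I_def using edge_in_upper that by blast
  have dpos: "d S v > 0" if "w \<in> ?V" "edge v w \<in> S" for S v w
    using that unfolding d_def deg_in_def by (auto simp: card_gt_0_iff)
  have wdb: "(\<Sum>v\<in>?V. of_bool (edge v w \<notin> S) * d (insert (edge v w) S) v * (b (edge v w))\<^sup>2) \<le> u"
    if "w \<in> ?V" "S \<in> Pow I" "card S \<le> k" for w S
    unfolding d_def using u(2) entry eI that row fin[OF that(2)]
    by (intro order_trans[OF weighted_degree_bound[of w n S k b \<rho> \<beta>]]) auto
  have cnt: "(\<Sum>w\<in>?V. of_bool (edge v w \<in> S) / d S v) \<le> 1" for v S
  proof -
    have "(\<Sum>w\<in>?V. of_bool (edge v w \<in> S) / d S v) = (\<Sum>w\<in>?V. of_bool (edge v w \<in> S)) / d S v"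
      unfolding sum_divide_distrib ..
    also have "(\<Sum>w\<in>?V. of_bool (edge v w \<in> S)) = d S v"
      unfolding d_def deg_in_def by (simp add: Int_def)
    finally show ?thesis by simp
  qed
  \<comment> \<open>\<open>t1\<close> and \<open>t2\<close> come from edges in \<open>T\<close>,
    where the edge set of \<open>\<psi>\<close> is the smaller one; \<open>t3\<close> and
    \<open>t4\<close> come from edges outside \<open>T\<close>, where it is the larger one. The odd
    terms are charged to the norm of \<open>\<phi>\<close>, the even ones to that of
    \<open>\<psi>\<close>.\<close>
  define t1 where "t1 v w T = of_bool (edge v w \<in> T) * ((\<phi> v T)\<^sup>2 / (4 * d T v))" for v w T
  define t2 where "t2 v w T = of_bool (edge v w \<in> T) * (d T v * (b (edge v w))\<^sup>2 * (\<psi> w (toggle (edge v w) T))\<^sup>2)" for v w T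
  define t3 where "t3 v w T = of_bool (edge v w \<notin> T) * (d (insert (edge v w) T) w * (b (edge v w))\<^sup>2 * (\<phi> v T)\<^sup>2 / (4 * u))" for v w T
  define t4 where "t4 v w T = of_bool (edge v w \<notin> T) * (u * (\<psi> w (toggle (edge v w) T))\<^sup>2 / d (toggle (edge v w) T) w)" for v w T
  have pt: "\<phi> v T * (b (edge v w) * \<psi> w (toggle (edge v w) T)) \<le> t1 v w T + t2 v w T + t3 v w T + t4 v w T"
    if vw: "v \<in> ?V" "w \<in> ?V" for v w T
  proof (cases "edge v w \<in> T")
    case True
    show ?thesis
      using young[OF dpos[OF vw(2) True], of "\<phi> v T" "b (edge v w) * \<psi> w (toggle (edge v w) T)"] True
      by (simp add: t1_def t2_def t3_def t4_def power_mult_distrib mult_ac)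
  next
    case False
    have D: "d (insert (edge v w) T) w > 0" using vw edge_commute[of v w] by (intro dpos[of v]) auto
    have "(b (edge v w) * \<phi> v T) * \<psi> w (toggle (edge v w) T) \<le>
      (b (edge v w) * \<phi> v T)\<^sup>2 / (4 * (u / d (insert (edge v w) T) w)) +
      u / d (insert (edge v w) T) w * (\<psi> w (toggle (edge v w) T))\<^sup>2"
      using D u by (intro young) simp
    moreover have "toggle (edge v w) T = insert (edge v w) T" using False by (simp add: toggle_def)
    ultimately show ?thesis using False
      by (simp add: t1_def t2_def t3_def t4_def power_mult_distrib mult_ac)
  qed
  let ?N\<phi> = "\<Sum>v\<in>?V. \<Sum>S\<in>Pow I. (\<phi> v S)\<^sup>2"
  let ?N\<psi> = "\<Sum>v\<in>?V. \<Sum>S\<in>Pow I. (\<psi> v S)\<^sup>2"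
  have T1: "(\<Sum>v\<in>?V. \<Sum>T\<in>Pow I. \<Sum>w\<in>?V. t1 v w T) \<le> ?N\<phi> / 4"
    unfolding sum_divide_distrib
  proof (intro sum_mono)
    fix v T
    have "(\<Sum>w\<in>?V. t1 v w T) = (\<phi> v T)\<^sup>2 / 4 * (\<Sum>w\<in>?V. of_bool (edge v w \<in> T) / d T v)"
      unfolding sum_distrib_left by (intro sum.cong) (auto simp: t1_def)
    also have "\<dots> \<le> (\<phi> v T)\<^sup>2 / 4 * 1" by (intro mult_left_mono cnt) auto
    finally show "(\<Sum>w\<in>?V. t1 v w T) \<le> (\<phi> v T)\<^sup>2 / 4" by simp
  qed
  \<comment> \<open>Substituting the toggled set frees \<open>\<psi>\<close> from the edge, so that
    \<open>t2\<close> and \<open>t4\<close> can be summed over \<open>v\<close> with the square of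
    \<open>\<psi> w T\<close> as a common factor.\<close>
  have swap: "(\<Sum>v\<in>?V. \<Sum>T\<in>Pow I. \<Sum>w\<in>?V. g v w T) = (\<Sum>w\<in>?V. \<Sum>T\<in>Pow I. \<Sum>v\<in>?V. g v w (toggle (edge v w) T))"
    for g :: "nat \<Rightarrow> nat \<Rightarrow> (nat \<times> nat) set \<Rightarrow> real"
  proof -
    have "(\<Sum>v\<in>?V. \<Sum>T\<in>Pow I. \<Sum>w\<in>?V. g v w T) = (\<Sum>v\<in>?V. \<Sum>w\<in>?V. \<Sum>T\<in>Pow I. g v w T)"
      by (intro sum.cong refl sum.swap)
    also have "\<dots> = (\<Sum>v\<in>?V. \<Sum>w\<in>?V. \<Sum>T\<in>Pow I. g v w (toggle (edge v w) T))"
      by (intro sum.cong refl sum_toggle[symmetric] eI)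
    also have "\<dots> = (\<Sum>w\<in>?V. \<Sum>v\<in>?V. \<Sum>T\<in>Pow I. g v w (toggle (edge v w) T))"
      by (rule sum.swap)
    also have "\<dots> = (\<Sum>w\<in>?V. \<Sum>T\<in>Pow I. \<Sum>v\<in>?V. g v w (toggle (edge v w) T))"
      by (intro sum.cong refl sum.swap)
    finally show ?thesis .
  qed
  have T2: "(\<Sum>v\<in>?V. \<Sum>T\<in>Pow I. \<Sum>w\<in>?V. t2 v w T) \<le> u * ?N\<psi>"
  proof (subst swap, unfold sum_distrib_left, intro sum_mono)
    fix w T assume w: "w \<in> ?V" and T: "T \<in> Pow I"
    have "(\<Sum>v\<in>?V. t2 v w (toggle (edge v w) T)) =
      (\<Sum>v\<in>?V. of_bool (edge v w \<notin> T) * d (insert (edge v w) T) v * (b (edge v w))\<^sup>2) * (\<psi> w T)\<^sup>2"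
      unfolding sum_distrib_right by (intro sum.cong) (auto simp: t2_def toggle_def)
    also have "\<dots> \<le> u * (\<psi> w T)\<^sup>2"
    proof (cases "\<psi> w T = 0")
      case False
      then show ?thesis using supp[of T w] T w by (intro mult_right_mono wdb) auto
    qed simp
    finally show "(\<Sum>v\<in>?V. t2 v w (toggle (edge v w) T)) \<le> u * (\<psi> w T)\<^sup>2" .
  qed
  have T3: "(\<Sum>v\<in>?V. \<Sum>T\<in>Pow I. \<Sum>w\<in>?V. t3 v w T) \<le> ?N\<phi> / 4"
    unfolding sum_divide_distrib
  proof (intro sum_mono)
    fix v T assume v: "v \<in> ?V" and T: "T \<in> Pow I"
    have "(\<Sum>w\<in>?V. t3 v w T) =
      (\<Sum>w\<in>?V. of_bool (edge w v \<notin> T) * d (insert (edge w v) T) w * (b (edge w v))\<^sup>2) * ((\<phi> v T)\<^sup>2 / (4 * u))"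
      unfolding sum_distrib_right by (intro sum.cong) (auto simp: t3_def edge_commute[of v])
    also have "\<dots> \<le> u * ((\<phi> v T)\<^sup>2 / (4 * u))"
    proof (cases "\<phi> v T = 0")
      case False
      then show ?thesis using supp'[of T v] T v u by (intro mult_right_mono wdb) auto
    qed simp
    finally show "(\<Sum>w\<in>?V. t3 v w T) \<le> (\<phi> v T)\<^sup>2 / 4" using u by simp
  qed
  have T4: "(\<Sum>v\<in>?V. \<Sum>T\<in>Pow I. \<Sum>w\<in>?V. t4 v w T) \<le> u * ?N\<psi>"
  proof (subst swap, unfold sum_distrib_left, intro sum_mono)
    fix w T assume w: "w \<in> ?V" and T: "T \<in> Pow I"
    have "(\<Sum>v\<in>?V. t4 v w (toggle (edge v w) T)) = u * (\<psi> w T)\<^sup>2 * (\<Sum>v\<in>?V. of_bool (edge w v \<in> T) / d T w)"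
      unfolding sum_distrib_left by (intro sum.cong) (auto simp: t4_def edge_commute[of w])
    also have "\<dots> \<le> u * (\<psi> w T)\<^sup>2 * 1" using u by (intro mult_left_mono cnt) auto
    finally show "(\<Sum>v\<in>?V. t4 v w (toggle (edge v w) T)) \<le> u * (\<psi> w T)\<^sup>2" by simp
  qed
  have "?N\<phi> = (\<Sum>v\<in>?V. \<Sum>T\<in>Pow I. \<Sum>w\<in>?V. \<phi> v T * (b (edge v w) * \<psi> w (toggle (edge v w) T)))"
    unfolding sum_distrib_left[symmetric] by (simp add: \<phi>_def power2_eq_square)
  also have "\<dots> \<le> (\<Sum>v\<in>?V. \<Sum>T\<in>Pow I. \<Sum>w\<in>?V. t1 v w T + t2 v w T + t3 v w T + t4 v w T)"
    by (intro sum_mono pt)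
  also have "\<dots> \<le> ?N\<phi> / 4 + u * ?N\<psi> + ?N\<phi> / 4 + u * ?N\<psi>"
    unfolding sum.distrib using T1 T2 T3 T4 by linarith
  \<comment> \<open>The terms \<open>t1\<close> and \<open>t3\<close> return half of the norm of
    \<open>\<phi>\<close>; absorbing it doubles the remaining \<open>2 * u\<close>, whence the
    factor 4.\<close>
  finally show ?thesis by linarith
qed

text \<open>Iterates the operator bound from a point mass of norm 1. After \<open>k\<close> steps
  the edge sets have at most \<open>k \<le> p\<close> elements, so one \<open>u\<close> serves for
  all steps; the operator bound is applied with \<open>Suc k\<close> to cover the sets after the
  step as well.\<close>

lemma walk_coeff_norm:
  fixes b :: "nat \<times> nat \<Rightarrow> real" and n :: nat
  defines "I \<equiv> upper_indices n"
  assumes x: "x \<in> {1..n}"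
    and row: "\<And>w. w \<in> {1..n} \<Longrightarrow> (\<Sum>v\<in>{1..n}. (b (edge v w))\<^sup>2) \<le> \<rho>"
    and entry: "\<And>e. e \<in> I \<Longrightarrow> (b e)\<^sup>2 \<le> \<beta>"
    and u: "u > 0" "\<rho> + 2 * real p * \<beta> \<le> u" and k: "k \<le> p"
  shows "(\<Sum>v\<in>{1..n}. \<Sum>S\<in>Pow I. (walk_coeff n b x k v S)\<^sup>2) \<le> (4 * u) ^ k"
  using k
proof (induction k)
  case 0
  have finI: "finite I" by (simp add: I_def)
  have "(\<Sum>v\<in>{1..n}. \<Sum>S\<in>Pow I. (walk_coeff n b x 0 v S)\<^sup>2) = (\<Sum>v\<in>{1..n}. \<Sum>S\<in>Pow I. if S = {} then of_bool (v = x) else 0)"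
    by (intro sum.cong) auto
  also have "\<dots> = (\<Sum>v\<in>{1..n}. if v = x then 1 else 0)" using finI by (intro sum.cong) auto
  also have "\<dots> = 1" using x by simp
  finally show ?case by simp
next
  case (Suc k)
  have fin: "finite S" if "S \<subseteq> I" for S using finite_subset[OF that] by (simp add: I_def)
  have b0: "\<beta> \<ge> 0" using entry[of "edge x x"] edge_in_upper[OF x x]
    by (metis I_def order_trans zero_le_power2)
  have "\<rho> + 2 * real (Suc k) * \<beta> \<le> u"
    using Suc.prems b0 u(2) by (intro order_trans[OF _ u(2)] add_left_mono mult_right_mono) auto
  then have "(\<Sum>v\<in>{1..n}. \<Sum>S\<in>Pow I. (walk_coeff n b x (Suc k) v S)\<^sup>2) \<le>
    4 * u * (\<Sum>v\<in>{1..n}. \<Sum>S\<in>Pow I. (walk_coeff n b x k v S)\<^sup>2)"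
    unfolding I_def walk_coeff.simps(2)
    using walk_coeff_support[of _ n b x "k"] walk_coeff_support[of _ n b x "Suc k", unfolded walk_coeff.simps] fin u(1) row entry
    by (intro walk_operator_bound[where \<rho> = \<rho> and \<beta> = \<beta> and k = "Suc k"])
       (auto simp: I_def intro: le_SucI)
  also have "\<dots> \<le> 4 * u * (4 * u) ^ k" using Suc u(1) by (intro mult_left_mono) auto
  finally show ?case by simp
qed

text \<open>Parseval replaces the average over signs by the squared norm of the coefficients.
  Summing over all start vectors \<open>unitv x\<close> turns it into a Hilbert--Schmidt norm and
  accounts for the factor \<open>n\<close>.\<close>

lemma signed_power_bound:
  fixes b :: "nat \<times> nat \<Rightarrow> real" and n :: nat
  defines "I \<equiv> upper_indices n"
  assumes row: "\<And>w. w \<in> {1..n} \<Longrightarrow> (\<Sum>v\<in>{1..n}. (b (edge v w))\<^sup>2) \<le> \<rho>"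
    and entry: "\<And>e. e \<in> I \<Longrightarrow> (b e)\<^sup>2 \<le> \<beta>"
    and u: "u > 0" "\<rho> + 2 * real p * \<beta> \<le> u"
  shows "(\<Sum>J\<in>Pow I. \<Sum>x\<in>{1..n}. \<Sum>v\<in>{1..n}. ((mv n (\<lambda>e. sgn_at J e * b e) ^^ p) (unitv x) v)\<^sup>2)
     \<le> 2 ^ card I * (real n * (4 * u) ^ p)"
proof -
  have finI: "finite I" by (simp add: I_def)
  have "(\<Sum>J\<in>Pow I. \<Sum>x\<in>{1..n}. \<Sum>v\<in>{1..n}. ((mv n (\<lambda>e. sgn_at J e * b e) ^^ p) (unitv x) v)\<^sup>2) =
    (\<Sum>J\<in>Pow I. \<Sum>x\<in>{1..n}. \<Sum>v\<in>{1..n}. (\<Sum>S\<in>Pow I. walk_coeff n b x p v S * walsh J S)\<^sup>2)"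
    unfolding I_def by (intro sum.cong refl) (simp add: mv_power_walsh)
  also have "\<dots> = (\<Sum>x\<in>{1..n}. \<Sum>v\<in>{1..n}. \<Sum>J\<in>Pow I. (\<Sum>S\<in>Pow I. walk_coeff n b x p v S * walsh J S)\<^sup>2)"
    by (rule trans[OF sum.swap]) (intro sum.cong refl sum.swap)
  also have "\<dots> = 2 ^ card I * (\<Sum>x\<in>{1..n}. \<Sum>v\<in>{1..n}. \<Sum>S\<in>Pow I. (walk_coeff n b x p v S)\<^sup>2)"
    unfolding walsh_parseval[OF finI] sum_distrib_left ..
  also have "\<dots> \<le> 2 ^ card I * (\<Sum>x\<in>{1..n}. (4 * u) ^ p)"
    unfolding I_def by (intro mult_left_mono sum_mono walk_coeff_norm[OF _ row entry[unfolded I_def] u order_refl]) auto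
  finally show ?thesis by simp
qed

lemma ip_mv_power_commute: "ip n u ((mv n x ^^ k) w) = ip n ((mv n x ^^ k) u) w"
proof (induction k arbitrary: u)
  case (Suc k)
  have "ip n u ((mv n x ^^ Suc k) w) = ip n ((mv n x ^^ k) w) (mv n x u)"
    by (simp only: funpow.simps comp_apply) (rule ip_mv_commute)
  also have "\<dots> = ip n (mv n x u) ((mv n x ^^ k) w)" by (rule ip_commute)
  also have "\<dots> = ip n ((mv n x ^^ k) (mv n x u)) w" by (rule Suc.IH)
  finally show ?case by (simp only: funpow_Suc_right comp_apply)
qed simp

lemma mv_power_expand:
  assumes "i \<in> {1..n}"
  shows "(mv n x ^^ k) v i = (\<Sum>j\<in>{1..n}. v j * (mv n x ^^ k) (unitv j) i)"
  using assms
proof (induction k arbitrary: i)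
  case 0
  then show ?case by (simp add: unitv_def of_bool_def if_distrib cong: if_cong)
next
  case (Suc k)
  have "(mv n x ^^ Suc k) v i = mv n x (\<lambda>i. \<Sum>j\<in>{1..n}. v j * (mv n x ^^ k) (unitv j) i) i"
    by (simp only: funpow.simps comp_apply, subst (1 2) mv_def, intro sum.cong refl, simp only: Suc.IH)
  also have "\<dots> = (\<Sum>j\<in>{1..n}. v j * mv n x ((mv n x ^^ k) (unitv j)) i)" by (rule mv_sum)
  finally show ?case by simp
qed

text \<open>Each application of Cauchy--Schwarz against the unit vector \<open>v\<close> doubles the
  exponent, which is why powers of two occur; at the end the vector norm is bounded by the
  Hilbert--Schmidt norm.\<close>

lemma qf_power_le:
  assumes v: "ip n v v = 1"
  shows "(qf n x v) ^ (2 ^ Suc m) \<le> (\<Sum>j\<in>{1..n}. \<Sum>i\<in>{1..n}. ((mv n x ^^ (2 ^ m)) (unitv j) i)\<^sup>2)"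
proof -
  have "(qf n x v) ^ (2 ^ Suc m) \<le> ip n ((mv n x ^^ (2 ^ m)) v) ((mv n x ^^ (2 ^ m)) v)"
  proof (induction m)
    case 0
    then show ?case using ip_cauchy_schwarz[of n v "mv n x v"] v by (simp add: qf_ip)
  next
    case (Suc m)
    let ?A = "mv n x ^^ (2 ^ m)"
    have "(qf n x v) ^ (2 ^ Suc (Suc m)) = ((qf n x v) ^ (2 ^ Suc m))\<^sup>2"
      by (simp add: power_mult[symmetric] mult.commute)
    also have "\<dots> \<le> (ip n (?A v) (?A v))\<^sup>2"
      using Suc.IH by (intro power_mono) (auto simp: zero_le_even_power)
    also have "ip n (?A v) (?A v) = ip n v ((mv n x ^^ (2 ^ Suc m)) v)"
      unfolding ip_mv_power_commute[of n v "2 ^ m" x "?A v", symmetric]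
      by (simp add: funpow_add[symmetric] mult_2 flip: comp_apply[of ?A ?A])
    also have "(ip n v ((mv n x ^^ (2 ^ Suc m)) v))\<^sup>2 \<le> ip n v v * ip n ((mv n x ^^ (2 ^ Suc m)) v) ((mv n x ^^ (2 ^ Suc m)) v)"
      by (rule ip_cauchy_schwarz)
    finally show ?case using v by simp
  qed
  also have "\<dots> \<le> (\<Sum>i\<in>{1..n}. \<Sum>j\<in>{1..n}. ((mv n x ^^ (2 ^ m)) (unitv j) i)\<^sup>2)"
    unfolding ip_def power2_eq_square[symmetric]
  proof (intro sum_mono)
    fix i assume i: "i \<in> {1..n}"
    have "((mv n x ^^ 2 ^ m) v i)\<^sup>2 \<le> (\<Sum>j\<in>{1..n}. (v j)\<^sup>2) * (\<Sum>j\<in>{1..n}. ((mv n x ^^ (2 ^ m)) (unitv j) i)\<^sup>2)"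
      by (subst mv_power_expand[OF i]) (rule Cauchy_Schwarz_ineq_sum)
    then show "((mv n x ^^ 2 ^ m) v i)\<^sup>2 \<le> (\<Sum>j\<in>{1..n}. ((mv n x ^^ (2 ^ m)) (unitv j) i)\<^sup>2)"
      using v by (simp add: ip_def power2_eq_square)
  qed
  also have "\<dots> = (\<Sum>j\<in>{1..n}. \<Sum>i\<in>{1..n}. ((mv n x ^^ (2 ^ m)) (unitv j) i)\<^sup>2)" by (rule sum.swap)
  finally show ?thesis .
qed

section \<open>The expected smallest eigenvalue\<close>

context wigner_input begin

lemma measurable_edge_coord [measurable]:
  "i \<in> {1..n} \<Longrightarrow> j \<in> {1..n} \<Longrightarrow> (\<lambda>x. x (edge i j)) \<in> borel_measurable (mu n)"
  by (rule measurable_coord[OF edge_in_upper])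

lemma measurable_qf [measurable]: "(\<lambda>x. qf n x v) \<in> borel_measurable (mu n)"
  unfolding quadratic_form_def sym_matrix_edge by measurable

text \<open>Makes \<open>lam\<close> measurable: the sublevel set is a countable union over vectors
  with coordinates in a grid of mesh \<open>1 / Suc k\<close>. Such vectors are seldom of unit
  length, so the Rayleigh quotient is tested in homogeneous form. Rounding a minimizer down provides
  a witness, because the strict inequality survives small perturbations.\<close>

lemma lam_less_iff:
  assumes n: "n \<ge> 1"
  shows "lam n x < a \<longleftrightarrow> (\<exists>k::nat. \<exists>z\<in>{1..n} \<rightarrow>\<^sub>E (UNIV :: int set).
     qf n x (\<lambda>i. of_int (z i) / real (Suc k)) < a * ip n (\<lambda>i. of_int (z i) / real (Suc k)) (\<lambda>i. of_int (z i) / real (Suc k)))"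
proof (intro iffI; (elim exE bexE)?)
  fix k :: nat and z :: "nat \<Rightarrow> int"
  let ?v = "\<lambda>i. of_int (z i) / real (Suc k)"
  assume "qf n x ?v < a * ip n ?v ?v"
  then have "lam n x * ip n ?v ?v < a * ip n ?v ?v" using lam_le_qf[OF n, of x ?v] by linarith
  then show "lam n x < a" using ip_nonneg[of n ?v] mult_right_mono[of a "lam n x" "ip n ?v ?v"] by linarith
next
  assume lt: "lam n x < a"
  define v where "v = min_eigenvector n x"
  define vk where "vk k i = of_int \<lfloor>v i * real (Suc k)\<rfloor> / real (Suc k)" for k i
  have lim: "(\<lambda>k. vk k i) \<longlonglongrightarrow> v i" for i
  proof (rule real_tendsto_sandwich)
    show "\<forall>\<^sub>F k in sequentially. v i - 1 / real (Suc k) \<le> vk k i"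
    proof (intro always_eventually allI)
      fix k
      have "v i * real (Suc k) - 1 \<le> of_int \<lfloor>v i * real (Suc k)\<rfloor>" by linarith
      then have "(v i * real (Suc k) - 1) / real (Suc k) \<le> vk k i"
        unfolding vk_def by (intro divide_right_mono) auto
      then show "v i - 1 / real (Suc k) \<le> vk k i" by (simp add: diff_divide_distrib)
    qed
    show "\<forall>\<^sub>F k in sequentially. vk k i \<le> v i"
    proof (intro always_eventually allI)
      fix k
      have "vk k i \<le> (v i * real (Suc k)) / real (Suc k)"
        unfolding vk_def by (intro divide_right_mono) auto
      then show "vk k i \<le> v i" by simp
    qed
    show "(\<lambda>k. v i - 1 / real (Suc k)) \<longlonglongrightarrow> v i"
      using tendsto_diff[OF tendsto_const lim_1_over_n[THEN LIMSEQ_Suc], of "v i"] by simp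
  qed auto
  have "(\<lambda>k. qf n x (vk k) - a * ip n (vk k) (vk k)) \<longlonglongrightarrow> qf n x v - a * ip n v v"
    unfolding quadratic_form_def ip_def by (intro tendsto_intros lim)
  moreover have "qf n x v - a * ip n v v < 0"
    using lt min_eigenvector_unit[OF n, of x] by (simp add: v_def lam_def)
  ultimately have "\<forall>\<^sub>F k in sequentially. qf n x (vk k) - a * ip n (vk k) (vk k) < 0"
    by (rule order_tendstoD(2))
  then obtain k where k: "qf n x (vk k) < a * ip n (vk k) (vk k)"
    by (auto simp: eventually_sequentially)
  define z where "z = (\<lambda>i\<in>{1..n}. \<lfloor>v i * real (Suc k)\<rfloor>)"
  have "qf n x (\<lambda>i. of_int (z i) / real (Suc k)) = qf n x (vk k)"
    by (rule qf_cong) (auto simp: z_def vk_def)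
  moreover have "ip n (\<lambda>i. of_int (z i) / real (Suc k)) (\<lambda>i. of_int (z i) / real (Suc k)) = ip n (vk k) (vk k)"
    by (rule ip_cong) (auto simp: z_def vk_def)
  ultimately show "\<exists>k::nat. \<exists>z\<in>{1..n} \<rightarrow>\<^sub>E (UNIV :: int set).
     qf n x (\<lambda>i. of_int (z i) / real (Suc k)) < a * ip n (\<lambda>i. of_int (z i) / real (Suc k)) (\<lambda>i. of_int (z i) / real (Suc k))"
    using k by (intro exI[of _ k] bexI[of _ z]) (auto simp: z_def)
qed

lemma measurable_lam [measurable]:
  assumes n: "n \<ge> 1" shows "lam n \<in> borel_measurable (mu n)"
proof -
  have c: "countable ({1..n} \<rightarrow>\<^sub>E (UNIV :: int set))" by (intro countable_PiE) auto
  have "{x \<in> space (mu n). lam n x < a} \<in> sets (mu n)" for a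
  proof -
    let ?v = "\<lambda>(k::nat) z (i::nat). of_int (z i) / real (Suc k)"
    have "{x \<in> space (mu n). lam n x < a} = (\<Union>k. \<Union>z\<in>{1..n} \<rightarrow>\<^sub>E (UNIV :: int set).
        {x \<in> space (mu n). qf n x (?v k z) < a * ip n (?v k z) (?v k z)})"
      unfolding lam_less_iff[OF n] by blast
    also have "\<dots> \<in> sets (mu n)"
      by (intro sets.countable_nat_UN image_subsetI sets.countable_UN' c) measurable
    finally show ?thesis .
  qed
  then show ?thesis by (simp add: borel_measurable_iff_less)
qed

lemma coord_pow: 
  assumes "p \<in> upper_indices n"
  shows "integrable (mu n) (\<lambda>x. x p ^ k)" "(\<integral>x. x p ^ k \<partial>mu n) = (\<integral>t. t ^ k \<partial>P)"
  using coord_integral[OF assms, of "\<lambda>t. t ^ k"] integrable_pow by auto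

lemma integrable_coord: "p \<in> upper_indices n \<Longrightarrow> integrable (mu n) (\<lambda>x. x p)"
  and integral_coord: "p \<in> upper_indices n \<Longrightarrow> (\<integral>x. x p \<partial>mu n) = 0"
  using coord_pow[of p n 1] mean_zero by auto

lemma integrable_lam:
  assumes n: "n \<ge> 1" shows "integrable (mu n) (lam n)"
proof (rule Bochner_Integration.integrable_bound)
  show "integrable (mu n) (\<lambda>x. \<Sum>e\<in>upper_indices n. 2 * \<bar>x e\<bar>)"
    by (intro Bochner_Integration.integrable_sum integrable_mult_right integrable_abs integrable_coord)
  show "AE x in mu n. norm (lam n x) \<le> norm (\<Sum>e\<in>upper_indices n. 2 * \<bar>x e\<bar>)"
    using abs_lam_le[OF n] by (simp add: sum_nonneg)
qed (use n in measurable)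

text \<open>When one independent centered summand \<open>T\<close> is added to \<open>S\<close>, all
  mixed moments with a first power vanish: in the fourth power only \<open>6 S^2 T^2\<close>
  survives next to the pure powers. The function \<open>g\<close> is general since the lemma serves
  both the entries themselves and their centered squares.\<close>

lemma sum_moments:
  fixes g :: "real \<Rightarrow> real" and c :: "'j \<Rightarrow> real"
  assumes fin: "finite F" and inj: "inj_on \<phi> F" "\<phi> ` F \<subseteq> upper_indices n"
    and g: "\<And>k. integrable P (\<lambda>t. g t ^ k)" "(\<integral>t. g t \<partial>P) = 0" "(\<integral>t. (g t)\<^sup>2 \<partial>P) = s"
    and D: "(\<integral>t. g t ^ 4 \<partial>P) \<le> D" "3 * s\<^sup>2 \<le> D"
  defines "S \<equiv> \<lambda>F x. \<Sum>j\<in>F. c j * g (x (\<phi> j))"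
  shows "(\<forall>k. integrable (mu n) (\<lambda>x. S F x ^ k)) \<and> (\<integral>x. S F x \<partial>mu n) = 0 \<and>
    (\<integral>x. (S F x)\<^sup>2 \<partial>mu n) = s * (\<Sum>j\<in>F. (c j)\<^sup>2) \<and>
    (\<integral>x. S F x ^ 4 \<partial>mu n) \<le> D * (\<Sum>j\<in>F. (c j)\<^sup>2)\<^sup>2"
  using fin inj
proof (induction F)
  case empty
  interpret mu: prob_space "mu n" by (rule prob_space_mu)
  show ?case by (simp add: S_def)
next
  case (insert a F)
  have "inj_on \<phi> F" "\<phi> ` F \<subseteq> upper_indices n" using insert.prems by auto
  note ih = insert.IH[OF this]
  have IH: "\<And>k. integrable (mu n) (\<lambda>x. S F x ^ k)" "(\<integral>x. S F x \<partial>mu n) = 0"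
    "(\<integral>x. (S F x)\<^sup>2 \<partial>mu n) = s * (\<Sum>j\<in>F. (c j)\<^sup>2)"
    "(\<integral>x. S F x ^ 4 \<partial>mu n) \<le> D * (\<Sum>j\<in>F. (c j)\<^sup>2)\<^sup>2"
    using ih by simp_all
  define p where "p = \<phi> a"
  have p: "p \<in> upper_indices n" using insert by (auto simp: p_def)
  define T where "T x = c a * g (x p)" for x
  have SI: "S (insert a F) x = S F x + T x" for x
    using insert by (simp add: S_def T_def p_def)
  have ign: "S F (rs n {p} x y) = S F x" for x y
    unfolding S_def using insert.prems insert.hyps
    by (intro sum.cong refl) (auto simp: res_def p_def inj_on_def)
  have prod: "integrable (mu n) (\<lambda>x. S F x ^ k * T x ^ l)"
    "(\<integral>x. S F x ^ k * T x ^ l \<partial>mu n) = (\<integral>x. S F x ^ k \<partial>mu n) * (c a ^ l * (\<integral>t. g t ^ l \<partial>P))" for k l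
    using integral_mult_coord[OF p IH(1)[of k] g(1)[of l]]
    by (auto simp: ign T_def power_mult_distrib mult.left_commute[of _ "c a ^ l"])
  have hb: "has_bochner_integral (mu n) (\<lambda>x. S F x ^ k * T x ^ l)
      ((\<integral>x. S F x ^ k \<partial>mu n) * (c a ^ l * (\<integral>t. g t ^ l \<partial>P)))" for k l
    using prod[of k l] by (simp add: has_bochner_integral_iff)
  have R1: "integrable (mu n) (\<lambda>x. S (insert a F) x ^ k)" for k
    unfolding SI binomial_ring mult.assoc
    by (intro Bochner_Integration.integrable_sum integrable_mult_right prod(1))
  interpret mu: prob_space "mu n" by (rule prob_space_mu)
  have R2: "(\<integral>x. S (insert a F) x \<partial>mu n) = 0"
    using prod[of 1 0] prod[of 0 1] IH(2) g(2) mu.prob_space unfolding SI by simp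
  have e2: "(S (insert a F) x)\<^sup>2 = S F x ^ 2 * T x ^ 0 + 2 * (S F x ^ 1 * T x ^ 1) + S F x ^ 0 * T x ^ 2" for x
    unfolding SI by (simp add: power2_sum)
  have R3: "(\<integral>x. (S (insert a F) x)\<^sup>2 \<partial>mu n) = s * (\<Sum>j\<in>insert a F. (c j)\<^sup>2)"
    unfolding e2 has_bochner_integral_integral_eq[OF has_bochner_integral_add[OF has_bochner_integral_add[OF
        hb has_bochner_integral_mult_right[OF hb]] hb]]
    using insert.hyps IH(2,3) g(2,3) mu.prob_space prob_space by (simp add: algebra_simps)
  have e4: "S (insert a F) x ^ 4 = S F x ^ 4 * T x ^ 0 + 4 * (S F x ^ 3 * T x ^ 1) + 6 * (S F x ^ 2 * T x ^ 2)
      + 4 * (S F x ^ 1 * T x ^ 3) + S F x ^ 0 * T x ^ 4" for x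
    unfolding SI by (simp add: power4_eq_xxxx power3_eq_cube power2_eq_square algebra_simps)
  have "(\<integral>x. S (insert a F) x ^ 4 \<partial>mu n) = (\<integral>x. S F x ^ 4 \<partial>mu n) + 6 * ((s * (\<Sum>j\<in>F. (c j)\<^sup>2)) * ((c a)\<^sup>2 * s))
     + (c a)^4 * (\<integral>t. g t ^ 4 \<partial>P)"
    unfolding e4 has_bochner_integral_integral_eq[OF has_bochner_integral_add[OF has_bochner_integral_add[OF
        has_bochner_integral_add[OF has_bochner_integral_add[OF
        hb has_bochner_integral_mult_right[OF hb]] has_bochner_integral_mult_right[OF hb]]
        has_bochner_integral_mult_right[OF hb]] hb]]
    using insert.hyps IH(2,3) g(2,3) mu.prob_space prob_space by (simp add: algebra_simps)
  also have "\<dots> \<le> D * (\<Sum>j\<in>F. (c j)\<^sup>2)\<^sup>2 + 2 * D * (\<Sum>j\<in>F. (c j)\<^sup>2) * (c a)\<^sup>2 + (c a)^4 * D"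
  proof (intro add_mono IH mult_left_mono D)
    \<comment> \<open>The bound \<open>3 * s^2 \<le> D\<close> turns the mixed term into the cross
      term of a completed square.\<close>
    have "3 * s\<^sup>2 * (2 * (\<Sum>j\<in>F. (c j)\<^sup>2) * (c a)\<^sup>2) \<le> D * (2 * (\<Sum>j\<in>F. (c j)\<^sup>2) * (c a)\<^sup>2)"
      by (intro mult_right_mono D mult_nonneg_nonneg sum_nonneg) auto
    then show "6 * ((s * (\<Sum>j\<in>F. (c j)\<^sup>2)) * ((c a)\<^sup>2 * s)) \<le> 2 * D * (\<Sum>j\<in>F. (c j)\<^sup>2) * (c a)\<^sup>2"
      by (simp add: power2_eq_square algebra_simps)
  qed auto
  also have "\<dots> = D * (\<Sum>j\<in>insert a F. (c j)\<^sup>2)\<^sup>2"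
    using insert.hyps by (simp add: power2_sum power_mult[symmetric] algebra_simps)
  finally have "(\<integral>x. S (insert a F) x ^ 4 \<partial>mu n) \<le> D * (\<Sum>j\<in>insert a F. (c j)\<^sup>2)\<^sup>2" .
  with R1 R2 R3 show ?case by blast
qed

end

lemma mv_cong_entries:
  assumes "\<And>e. e \<in> upper_indices n \<Longrightarrow> x e = x' e" "i \<in> {1..n}"
    and "\<And>j. j \<in> {1..n} \<Longrightarrow> v j = v' j"
  shows "mv n x v i = mv n x' v' i"
  unfolding mv_def using assms edge_in_upper by (intro sum.cong refl) auto

lemma mv_power_cong_entries:
  assumes x: "\<And>e. e \<in> upper_indices n \<Longrightarrow> x e = x' e" and i: "i \<in> {1..n}"
  shows "(mv n x ^^ k) v i = (mv n x' ^^ k) v i"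
  using i
proof (induction k arbitrary: i)
  case (Suc k)
  show ?case unfolding funpow.simps comp_apply
    by (rule mv_cong_entries[OF x Suc.prems Suc.IH])
qed simp

text \<open>With \<open>m\<close> least such that \<open>4 ^ (2 ^ m)\<close> reaches
  \<open>n\<close>, the exponent \<open>p = 2 ^ m\<close> is logarithmic in \<open>n\<close>. The
  first bound absorbs the dimension factor in the power estimate; the second one is what the entry
  term of \<open>norm_proxy\<close> tolerates, and it follows from minimality by halving
  \<open>p\<close>.\<close>

lemma dyadic_exponent:
  assumes "n \<ge> 1"
  shows "\<exists>m. real n \<le> 4 ^ (2 ^ m) \<and> real ((2 ^ m) ^ 4) \<le> 16 * real n"
proof -
  have ex: "\<exists>m. n \<le> 4 ^ (2 ^ m)"
  proof
    have "n < 2 ^ n" by (rule less_exp)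
    also have "(2::nat) ^ n \<le> 4 ^ n" by (intro power_mono) auto
    also have "(4::nat) ^ n \<le> 4 ^ (2 ^ n)" using less_exp[of n] by (intro power_increasing) auto
    finally show "n \<le> 4 ^ (2 ^ n)" by simp
  qed
  define m where "m = (LEAST m. n \<le> 4 ^ (2 ^ m))"
  have m: "n \<le> 4 ^ (2 ^ m)" unfolding m_def by (rule LeastI_ex[OF ex])
  have p4: "(2 ^ Suc k) ^ 4 \<le> 16 * (4::nat) ^ (2 ^ k)" for k
  proof -
    have "2 * k \<le> 2 ^ k"
    proof (induction k)
      case (Suc k)
      have "k = 0 \<or> (2::nat) \<le> 2 ^ k" by (cases k) auto
      with Suc show ?case by auto
    qed simp
    then have "(2::nat) ^ (2 * (2 * k)) \<le> 2 ^ (2 * 2 ^ k)" by (intro power_increasing) auto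
    moreover have "(2::nat) ^ (2 * 2 ^ k) = 4 ^ (2 ^ k)" by (simp add: power_mult)
    moreover have "((2::nat) ^ Suc k) ^ 4 = 16 * 2 ^ (2 * (2 * k))"
      by (simp add: power_mult_distrib power_mult[symmetric] mult.commute)
    ultimately show ?thesis by simp
  qed
  show ?thesis
  proof (cases m)
    case 0
    then show ?thesis using m assms by (intro exI[of _ m]) (auto simp: of_nat_le_iff[symmetric])
  next
    case (Suc k)
    then have "\<not> n \<le> 4 ^ (2 ^ k)" unfolding m_def by (intro not_less_Least) (simp add: m_def[symmetric])
    then have "16 * 4 ^ (2 ^ k) \<le> 16 * n" by simp
    with p4[of k] have "(2 ^ m) ^ 4 \<le> 16 * n" unfolding Suc by (rule order_trans)
    then have "real ((2 ^ m) ^ 4) \<le> real (16 * n)" unfolding of_nat_le_iff .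
    moreover have "real n \<le> real (4 ^ (2 ^ m))" using m unfolding of_nat_le_iff .
    ultimately show ?thesis by (intro exI[of _ m]) simp
  qed
qed

text \<open>Below the scale \<open>c\<close> the first summand suffices, above it the second one.
  This trades a maximum or a root for moments that can be integrated.\<close>

lemma le_scale_plus: "0 < c \<Longrightarrow> 0 \<le> t \<Longrightarrow> (t::real) \<le> c + t ^ Suc k / c ^ k"
proof (cases "t \<le> c")
  case False
  assume c: "0 < c" "0 \<le> t"
  then have "t * c ^ k \<le> t * t ^ k" using False by (intro mult_left_mono power_mono) auto
  then have "t \<le> t ^ Suc k / c ^ k" using c by (simp add: pos_le_divide_eq)
  then show ?thesis using c by linarith
qed (auto simp: add_increasing2)

section \<open>A proxy for the squared norm of the symmetrized matrix\<close>

context wigner_input begin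

definition pairsq :: "(nat \<times> nat \<Rightarrow> real) \<times> (nat \<times> nat \<Rightarrow> real) \<Rightarrow> nat \<times> nat \<Rightarrow> real" where
  "pairsq z e = (fst z e)\<^sup>2 + (snd z e)\<^sup>2"

text \<open>A bound for the squared norm of the symmetrised matrix with entries \<open>fst z e - snd z e\<close>; it depends on
  \<open>z\<close> only through \<^const>\<open>pairsq\<close>, which is invariant under \<^const>\<open>swap_coords\<close>.\<close>

definition norm_proxy :: "nat \<Rightarrow> nat \<Rightarrow> (nat \<times> nat \<Rightarrow> real) \<times> (nat \<times> nat \<Rightarrow> real) \<Rightarrow> real" where
  "norm_proxy n p z = 4 * real n * \<sigma>\<^sup>2 + 2 * real n
     + (\<Sum>i\<in>{1..n}. ((\<Sum>j\<in>{1..n}. pairsq z (edge i j)) - 2 * real n * \<sigma>\<^sup>2)\<^sup>2) / real n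
     + (\<Sum>e\<in>upper_indices n. (4 * real p * pairsq z e) ^ 4) / real n ^ 3"

text \<open>The squared Hilbert--Schmidt norm of the \<open>p\<close>-th power of the matrix
  \<open>b\<close>.\<close>

definition power_norm :: "nat \<Rightarrow> nat \<Rightarrow> (nat \<times> nat \<Rightarrow> real) \<Rightarrow> real" where
  "power_norm n p b = (\<Sum>j\<in>{1..n}. \<Sum>i\<in>{1..n}. ((mv n b ^^ p) (unitv j) i)\<^sup>2)"

lemma norm_proxy_pos: "n \<ge> 1 \<Longrightarrow> norm_proxy n p z > 0"
proof -
  assume "n \<ge> 1"
  then have "0 < 2 * real n" by simp
  moreover have "0 \<le> 4 * real n * \<sigma>\<^sup>2" by simp
  moreover have "0 \<le> (\<Sum>i\<in>{1..n}. ((\<Sum>j\<in>{1..n}. pairsq z (edge i j)) - 2 * real n * \<sigma>\<^sup>2)\<^sup>2) / real n"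
    by (intro divide_nonneg_nonneg sum_nonneg) auto
  moreover have "0 \<le> (\<Sum>e\<in>upper_indices n. (4 * real p * pairsq z e) ^ 4) / real n ^ 3"
    by (intro divide_nonneg_nonneg sum_nonneg) (auto simp: zero_le_even_power)
  ultimately show ?thesis unfolding norm_proxy_def by linarith
qed

text \<open>Maxima over rows and entries are replaced by sums. A row sum of \<open>pairsq\<close>
  has mean \<open>2 * n * \<sigma>^2\<close>; its deviation is controlled by a square over
  \<open>n\<close>, an entry by a fourth power over \<open>n ^ 3\<close>, each at the price of one
  summand \<open>n\<close>, which explains \<open>2 * real n\<close> in the proxy. Passing from
  squared differences to \<open>pairsq\<close> costs a factor 2.\<close>

lemma norm_proxy_bounds:
  fixes z :: "(nat \<times> nat \<Rightarrow> real) \<times> (nat \<times> nat \<Rightarrow> real)"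
  assumes n: "n \<ge> 1" and p: "p \<ge> 1"
  obtains \<rho> \<beta> where "\<And>w. w \<in> {1..n} \<Longrightarrow> (\<Sum>v\<in>{1..n}. (fst z (edge v w) - snd z (edge v w))\<^sup>2) \<le> \<rho>"
    "\<And>e. e \<in> upper_indices n \<Longrightarrow> (fst z e - snd z e)\<^sup>2 \<le> \<beta>" "\<rho> + 2 * real p * \<beta> = norm_proxy n p z"
proof -
  have sq: "(fst z e - snd z e)\<^sup>2 \<le> 2 * pairsq z e" for e
  proof -
    have "0 \<le> (fst z e + snd z e)\<^sup>2" by simp
    then show ?thesis by (simp add: pairsq_def power2_sum power2_diff)
  qed
  define R where "R i = (\<Sum>j\<in>{1..n}. pairsq z (edge i j))" for i
  define \<rho> where "\<rho> = 4 * real n * \<sigma>\<^sup>2 + real n + (\<Sum>i\<in>{1..n}. (R i - 2 * real n * \<sigma>\<^sup>2)\<^sup>2) / real n"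
  define \<beta> where "\<beta> = (real n + (\<Sum>e\<in>upper_indices n. (4 * real p * pairsq z e) ^ 4) / real n ^ 3) / (2 * real p)"
  show thesis
  proof (rule that[of \<rho> \<beta>])
    show "\<rho> + 2 * real p * \<beta> = norm_proxy n p z"
      using p by (simp add: \<rho>_def \<beta>_def norm_proxy_def R_def)
    fix w assume w: "w \<in> {1..n}"
    have "(\<Sum>v\<in>{1..n}. (fst z (edge v w) - snd z (edge v w))\<^sup>2) \<le> (\<Sum>v\<in>{1..n}. 2 * pairsq z (edge v w))"
      by (intro sum_mono sq)
    also have "\<dots> = 2 * R w" unfolding R_def sum_distrib_left by (simp add: edge_commute[of w])
    also have "\<dots> \<le> 4 * real n * \<sigma>\<^sup>2 + real n + (R w - 2 * real n * \<sigma>\<^sup>2)\<^sup>2 / real n"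
    proof -
      define t where "t = R w - 2 * real n * \<sigma>\<^sup>2"
      have "0 \<le> (t - real n)\<^sup>2 / real n" by simp
      also have "\<dots> = t\<^sup>2 / real n - 2 * t + real n"
        using n by (simp add: power2_eq_square field_simps)
      finally show ?thesis unfolding t_def by (simp add: algebra_simps)
    qed
    also have "(R w - 2 * real n * \<sigma>\<^sup>2)\<^sup>2 / real n \<le> (\<Sum>i\<in>{1..n}. (R i - 2 * real n * \<sigma>\<^sup>2)\<^sup>2) / real n"
      using w by (intro divide_right_mono member_le_sum) auto
    finally show "(\<Sum>v\<in>{1..n}. (fst z (edge v w) - snd z (edge v w))\<^sup>2) \<le> \<rho>"
      by (simp add: \<rho>_def)
  next
    fix e assume e: "e \<in> upper_indices n"
    have "4 * real p * pairsq z e \<le> real n + (4 * real p * pairsq z e) ^ Suc 3 / real n ^ 3"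
      using n by (intro le_scale_plus) (auto simp: pairsq_def)
    also have "(4 * real p * pairsq z e) ^ Suc 3 \<le> (\<Sum>e\<in>upper_indices n. (4 * real p * pairsq z e) ^ 4)"
      using e member_le_sum[of e "upper_indices n" "\<lambda>e. (4 * real p * pairsq z e) ^ 4"]
      by (simp add: zero_le_even_power)
    finally have "2 * pairsq z e \<le> \<beta>"
      using p by (simp add: \<beta>_def pos_le_divide_eq divide_right_mono mult_ac)
    with sq show "(fst z e - snd z e)\<^sup>2 \<le> \<beta>" by (rule order_trans)
  qed
qed

lemma pairsq_swap: "e \<in> upper_indices n \<Longrightarrow> pairsq (swap_coords (upper_indices n) J z) e = pairsq z e"
  by (auto simp: pairsq_def swap_coords_def res_def)

lemma norm_proxy_swap: "norm_proxy n p (swap_coords (upper_indices n) J z) = norm_proxy n p z"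
proof -
  have "(\<Sum>j\<in>{1..n}. pairsq (swap_coords (upper_indices n) J z) (edge i j)) = (\<Sum>j\<in>{1..n}. pairsq z (edge i j))"
    if "i \<in> {1..n}" for i
    using that by (intro sum.cong refl pairsq_swap edge_in_upper)
  then show ?thesis
    unfolding norm_proxy_def
    by (intro arg_cong2[where f = "(+)"] arg_cong2[where f = "(/)"] sum.cong refl) (simp_all add: pairsq_swap)
qed

text \<open>Exchanging the coordinates in \<open>J\<close> negates the difference of the two inputs
  exactly on \<open>J\<close>, so the sum runs over all sign patterns of one fixed matrix.\<close>

lemma sum_power_norm_swap:
  assumes n: "n \<ge> 1" and p: "p \<ge> 1"
  shows "(\<Sum>J\<in>Pow (upper_indices n).
      power_norm n p (\<lambda>e. fst (swap_coords (upper_indices n) J z) e - snd (swap_coords (upper_indices n) J z) e))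
    \<le> 2 ^ card (upper_indices n) * (real n * (4 * norm_proxy n p z) ^ p)"
proof -
  let ?b = "\<lambda>e. fst z e - snd z e"
  have eq: "power_norm n p (\<lambda>e. fst (swap_coords (upper_indices n) J z) e - snd (swap_coords (upper_indices n) J z) e)
      = power_norm n p (\<lambda>e. sgn_at J e * ?b e)" for J
    unfolding power_norm_def
    by (intro sum.cong refl arg_cong[where f = "\<lambda>t. t\<^sup>2"] mv_power_cong_entries)
       (auto simp: swap_coords_def res_def sgn_at_def)
  obtain \<rho> \<beta> where rb: "\<And>w. w \<in> {1..n} \<Longrightarrow> (\<Sum>v\<in>{1..n}. (?b (edge v w))\<^sup>2) \<le> \<rho>"
    "\<And>e. e \<in> upper_indices n \<Longrightarrow> (?b e)\<^sup>2 \<le> \<beta>" "\<rho> + 2 * real p * \<beta> = norm_proxy n p z"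
    using norm_proxy_bounds[OF n p] by blast
  show ?thesis
    unfolding eq unfolding power_norm_def
    by (rule signed_power_bound[OF rb(1) rb(2) norm_proxy_pos[OF n] eq_refl[OF rb(3)]])
qed

lemma measurable_pairsq [measurable]: "e \<in> upper_indices n \<Longrightarrow> (\<lambda>z. pairsq z e) \<in> borel_measurable (mu2 n)"
  unfolding pairsq_def
  by (intro borel_measurable_add borel_measurable_power measurable_compose[OF measurable_fst measurable_coord]
      measurable_compose[OF measurable_snd measurable_coord])

lemma measurable_norm_proxy [measurable]: "norm_proxy n p \<in> borel_measurable (mu2 n)"
proof -
  have [measurable]: "i \<in> {1..n} \<Longrightarrow> j \<in> {1..n} \<Longrightarrow> (\<lambda>z. pairsq z (edge i j)) \<in> borel_measurable (mu2 n)" for i j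
    by (intro measurable_pairsq edge_in_upper)
  show ?thesis unfolding norm_proxy_def by measurable
qed

lemma measurable_power_norm [measurable]:
  "(\<lambda>z. power_norm n p (\<lambda>e. fst z e - snd z e)) \<in> borel_measurable (mu2 n)"
proof -
  have e [measurable]: "(\<lambda>z. fst z (edge i j) - snd z (edge i j)) \<in> borel_measurable (mu2 n)"
    if "i \<in> {1..n}" "j \<in> {1..n}" for i j
    using edge_in_upper[OF that]
    by (intro borel_measurable_diff measurable_compose[OF measurable_fst measurable_coord]
      measurable_compose[OF measurable_snd measurable_coord])
  have "(\<lambda>z. (mv n (\<lambda>e. fst z e - snd z e) ^^ p) v i) \<in> borel_measurable (mu2 n)" if "i \<in> {1..n}" for v i
    using that
  proof (induction p arbitrary: i)
    case (Suc p)
    show ?case unfolding funpow.simps comp_apply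
      by (subst mv_def) (intro borel_measurable_sum borel_measurable_times e Suc)
  qed simp
  then show ?thesis unfolding power_norm_def by measurable
qed

end

lemma finite_card_upper: "card (upper_indices n) \<le> n\<^sup>2"
proof -
  have "card (upper_indices n) \<le> card ({1..n} \<times> {1..n})"
    by (rule card_mono) (auto simp: upper_indices_def)
  then show ?thesis by (simp add: power2_eq_square)
qed

lemma sum_power2_le: "((a::real) + b)\<^sup>2 \<le> 2 * a\<^sup>2 + 2 * b\<^sup>2"
proof -
  have "0 \<le> (a - b)\<^sup>2" by simp
  then show ?thesis by (simp add: power2_sum power2_diff)
qed

context wigner_input begin

lemma integrable_poly_pow: "integrable P (\<lambda>t. (t\<^sup>2 - \<sigma>\<^sup>2) ^ k)"
proof -
  have "(t\<^sup>2 - \<sigma>\<^sup>2) ^ k = (\<Sum>j\<le>k. real (k choose j) * t ^ (2 * j) * (- \<sigma>\<^sup>2) ^ (k - j))" for t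
    using binomial_ring[of "t\<^sup>2" "- \<sigma>\<^sup>2" k] unfolding power_mult[symmetric] by simp
  then show ?thesis
    by (simp only:) (intro Bochner_Integration.integrable_sum integrable_mult_left integrable_mult_right integrable_pow)
qed

lemma row_sum_second_moment:
  assumes i: "i \<in> {1..n}"
  defines "S \<equiv> \<lambda>x. (\<Sum>j\<in>{1..n}. (x (edge i j))\<^sup>2) - real n * \<sigma>\<^sup>2"
  shows "integrable (mu n) (\<lambda>x. (S x)\<^sup>2)" "(\<integral>x. (S x)\<^sup>2 \<partial>mu n) = real n * (\<integral>t. (t\<^sup>2 - \<sigma>\<^sup>2)\<^sup>2 \<partial>P)"
proof -
  let ?s = "\<integral>t. (t\<^sup>2 - \<sigma>\<^sup>2)\<^sup>2 \<partial>P" and ?g = "\<lambda>t. t\<^sup>2 - \<sigma>\<^sup>2"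
  let ?D = "max (\<integral>t. (t\<^sup>2 - \<sigma>\<^sup>2) ^ 4 \<partial>P) (3 * ?s\<^sup>2)"
  have g0: "(\<integral>t. ?g t \<partial>P) = 0"
    using integrable_pow[of 2] second_moment prob_space by simp
  have eq: "S x = (\<Sum>j\<in>{1..n}. 1 * ?g (x (edge i j)))" for x
    by (simp add: S_def sum_subtractf)
  note m = sum_moments[of "{1..n}" "edge i" n ?g ?s ?D "\<lambda>_. 1", OF _ edge_inj _ integrable_poly_pow g0 refl]
  have "(\<forall>k. integrable (mu n) (\<lambda>x. S x ^ k)) \<and> (\<integral>x. (S x)\<^sup>2 \<partial>mu n) = ?s * (\<Sum>j\<in>{1..n}. 1\<^sup>2)"
    unfolding eq using m edge_in_upper[OF i] by (simp add: image_subset_iff)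
  then show "integrable (mu n) (\<lambda>x. (S x)\<^sup>2)" "(\<integral>x. (S x)\<^sup>2 \<partial>mu n) = real n * ?s"
    by simp_all
qed

text \<open>The row term has \<open>n\<close> variances of order \<open>n\<close>, divided by
  \<open>n\<close>. The entry term has at most \<open>n ^ 2\<close> eighth moments weighted by a
  multiple of \<open>p ^ 4 \<le> 16 * n\<close>, divided by \<open>n ^ 3\<close>, hence it is
  bounded.\<close>

lemma expected_norm_proxy:
  "\<exists>C>0. \<forall>n\<ge>1. \<forall>p. real (p ^ 4) \<le> 16 * real n \<longrightarrow>
     (\<integral>\<^sup>+z. ennreal (norm_proxy n p z) \<partial>mu2 n) \<le> ennreal (C * real n)"
proof (intro exI conjI allI impI)
  define s where "s = (\<integral>t. (t\<^sup>2 - \<sigma>\<^sup>2)\<^sup>2 \<partial>P)"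
  define m8 where "m8 = (\<integral>t. t ^ 8 \<partial>P)"
  have s0: "s \<ge> 0" unfolding s_def by simp
  have m0: "m8 \<ge> 0" unfolding m8_def by (intro integral_nonneg_AE) (auto simp: zero_le_even_power)
  \<comment> \<open>\<open>4 * s\<close> collects twice the variances of both copies;
    \<open>65536 = 2048 * 16 * 2\<close> comes from the entry term of both copies.\<close>
  let ?C = "4 * \<sigma>\<^sup>2 + 2 + 4 * s + 65536 * m8"
  show "?C > 0" using s0 m0 by (intro add_pos_nonneg add_nonneg_pos) auto
  fix n p :: nat
  assume n: "n \<ge> 1" and p: "real (p ^ 4) \<le> 16 * real n"
  let ?V = "{1..n}" and ?I = "upper_indices n"
  define S where "S i x = (\<Sum>j\<in>?V. (x (edge i j))\<^sup>2) - real n * \<sigma>\<^sup>2" for i x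
  \<comment> \<open>\<open>2048 = 4 ^ 4 * 8\<close>, where the 8 stems from
    \<open>(a + b) ^ 4 \<le> 8 * (a ^ 4 + b ^ 4)\<close>.\<close>
  define K where "K = 2048 * real p ^ 4"
  define H where "H z = (4 * real n * \<sigma>\<^sup>2 + 2 * real n) +
     (\<Sum>i\<in>?V. 2 * (S i (fst z))\<^sup>2 + 2 * (S i (snd z))\<^sup>2) / real n +
     (\<Sum>e\<in>?I. K * (fst z e ^ 8 + snd z e ^ 8)) / real n ^ 3" for z
  have le: "norm_proxy n p z \<le> H z" for z
    unfolding norm_proxy_def H_def
  proof (intro add_mono divide_right_mono sum_mono order_refl)
    fix i assume "i \<in> ?V"
    have "(\<Sum>j\<in>?V. pairsq z (edge i j)) - 2 * real n * \<sigma>\<^sup>2 = S i (fst z) + S i (snd z)"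
      by (simp add: pairsq_def S_def sum.distrib)
    then show "((\<Sum>j\<in>?V. pairsq z (edge i j)) - 2 * real n * \<sigma>\<^sup>2)\<^sup>2 \<le> 2 * (S i (fst z))\<^sup>2 + 2 * (S i (snd z))\<^sup>2"
      using sum_power2_le by simp
  next
    fix e assume "e \<in> ?I"
    define a where "a = (fst z e)\<^sup>2"
    define b where "b = (snd z e)\<^sup>2"
    have "(a + b) ^ 4 = ((a + b)\<^sup>2)\<^sup>2" by simp
    also have "\<dots> \<le> (2 * a\<^sup>2 + 2 * b\<^sup>2)\<^sup>2" by (intro power_mono sum_power2_le) auto
    also have "\<dots> \<le> 2 * (2 * a\<^sup>2)\<^sup>2 + 2 * (2 * b\<^sup>2)\<^sup>2" by (rule sum_power2_le)
    also have "\<dots> = 8 * (a ^ 4 + b ^ 4)" by (simp add: power_mult_distrib)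
    finally have "(4 * real p) ^ 4 * (a + b) ^ 4 \<le> (4 * real p) ^ 4 * (8 * (a ^ 4 + b ^ 4))"
      by (intro mult_left_mono) auto
    moreover have "(4 * real p * pairsq z e) ^ 4 = (4 * real p) ^ 4 * (a + b) ^ 4"
      by (simp only: pairsq_def a_def b_def power_mult_distrib)
    moreover have "(4 * real p) ^ 4 * (8 * (a ^ 4 + b ^ 4)) = K * (fst z e ^ 8 + snd z e ^ 8)"
      by (simp add: K_def a_def b_def power_mult_distrib power_mult[symmetric])
    ultimately show "(4 * real p * pairsq z e) ^ 4 \<le> K * (fst z e ^ 8 + snd z e ^ 8)" by simp
  qed auto
  have hbS: "has_bochner_integral (mu2 n) (\<lambda>z. (S i (fst z))\<^sup>2) (real n * s)"
    "has_bochner_integral (mu2 n) (\<lambda>z. (S i (snd z))\<^sup>2) (real n * s)" if "i \<in> ?V" for i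
    using row_sum_second_moment[OF that] fst_integral(1-4)[of "\<lambda>x. (S i x)\<^sup>2" n]
    unfolding has_bochner_integral_iff s_def S_def by (auto dest: borel_measurable_integrable)
  have hb8: "has_bochner_integral (mu2 n) (\<lambda>z. fst z e ^ 8) m8" "has_bochner_integral (mu2 n) (\<lambda>z. snd z e ^ 8) m8"
    if "e \<in> ?I" for e
    using coord_pow[OF that, of 8] fst_integral(1-4)[of "\<lambda>x. x e ^ 8" n]
    unfolding has_bochner_integral_iff m8_def by (auto dest: borel_measurable_integrable)
  interpret mu2: prob_space "mu2 n" by (rule prob_space_mu2)
  have hbc: "has_bochner_integral (mu2 n) (\<lambda>z. c) c" for c :: real
    using mu2.prob_space by (simp add: has_bochner_integral_iff)
  have hbH: "has_bochner_integral (mu2 n) H ((4 * real n * \<sigma>\<^sup>2 + 2 * real n) +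
     (\<Sum>i\<in>?V. 2 * (real n * s) + 2 * (real n * s)) / real n + (\<Sum>e\<in>?I. K * (m8 + m8)) / real n ^ 3)"
    unfolding H_def
    by (intro has_bochner_integral_add has_bochner_integral_divide_zero has_bochner_integral_sum
        has_bochner_integral_mult_right hbc hbS hb8)
  let ?E = "(4 * real n * \<sigma>\<^sup>2 + 2 * real n) +
     (\<Sum>i\<in>?V. 2 * (real n * s) + 2 * (real n * s)) / real n + (\<Sum>e\<in>?I. K * (m8 + m8)) / real n ^ 3"
  have "?E \<le> ?C * real n"
  proof -
    have "(\<Sum>e\<in>?I. K * (m8 + m8)) \<le> real (n\<^sup>2) * ((2048 * (16 * real n)) * (m8 + m8))"
      using finite_card_upper[of n] p m0 unfolding K_def
      by (simp only: sum_constant, intro mult_mono) auto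
    also have "\<dots> = (65536 * m8) * real n ^ 3" by (simp add: power2_eq_square power3_eq_cube)
    finally have "(\<Sum>e\<in>?I. K * (m8 + m8)) / real n ^ 3 \<le> 65536 * m8"
      using n by (simp add: divide_le_eq)
    also have "\<dots> \<le> 65536 * m8 * real n" using n m0 by (simp add: mult_le_cancel_left1)
    finally show ?thesis using n by (simp add: algebra_simps)
  qed
  have H0: "0 \<le> H z" for z using le[of z] norm_proxy_pos[OF n, of p z] by linarith
  have "(\<integral>\<^sup>+z. ennreal (norm_proxy n p z) \<partial>mu2 n) \<le> (\<integral>\<^sup>+z. ennreal (H z) \<partial>mu2 n)"
    by (intro nn_integral_mono ennreal_leI le)
  also have "\<dots> = ennreal ?E"
    using hbH H0 by (subst nn_integral_eq_integral) (simp_all only: has_bochner_integral_iff, simp)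
  also have "\<dots> \<le> ennreal (?C * real n)" using \<open>?E \<le> ?C * real n\<close> by (rule ennreal_leI)
  finally show "(\<integral>\<^sup>+z. ennreal (norm_proxy n p z) \<partial>mu2 n) \<le> ennreal (?C * real n)" .
qed

text \<open>Every exchange of coordinates preserves the joint law and the scale \<open>c\<close>, so
  the integrand may be averaged over all exchanges; the average is bounded pointwise by the estimate
  for random signs.\<close>

lemma symmetrized_power_average:
  assumes n: "n \<ge> 1" and p: "p \<ge> 1" and c: "real n \<le> 4 ^ p"
  defines "c \<equiv> \<lambda>z. 4 * sqrt (norm_proxy n p z)"
  shows "(\<integral>\<^sup>+z. ennreal (power_norm n p (\<lambda>e. fst z e - snd z e) / c z ^ (2 * p - 1)) \<partial>mu2 n) \<le> (\<integral>\<^sup>+z. ennreal (c z) \<partial>mu2 n)"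
proof -
  let ?I = "upper_indices n"
  define F where "F z = power_norm n p (\<lambda>e. fst z e - snd z e) / c z ^ (2 * p - 1)" for z
  have cpos: "c z > 0" for z using norm_proxy_pos[OF n] by (simp add: c_def)
  have cswap: "c (swap_coords ?I J z) = c z" for J z by (simp add: c_def norm_proxy_swap)
  have c_meas [measurable]: "c \<in> borel_measurable (mu2 n)" unfolding c_def by measurable
  have F_meas [measurable]: "F \<in> borel_measurable (mu2 n)" unfolding F_def by measurable
  have F0: "F z \<ge> 0" for z
    unfolding F_def power_norm_def using cpos[of z] by (intro divide_nonneg_nonneg sum_nonneg) auto
  have avg: "(\<Sum>J\<in>Pow ?I. F (swap_coords ?I J z)) \<le> 2 ^ card ?I * c z" for z
  proof -
    have "(\<Sum>J\<in>Pow ?I. F (swap_coords ?I J z)) \<le> 2 ^ card ?I * (real n * (4 * norm_proxy n p z) ^ p) / c z ^ (2 * p - 1)"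
      unfolding F_def cswap sum_divide_distrib[symmetric]
      using cpos[of z] sum_power_norm_swap[OF n p] by (intro divide_right_mono) auto
    also have "\<dots> \<le> 2 ^ card ?I * c z"
    proof -
      \<comment> \<open>This is where the factor 4 in \<open>c\<close> comes from:
        \<open>c ^ (2 * p)\<close> is \<open>4 ^ p\<close> times the \<open>p\<close>-th power in
        the sign estimate, and \<open>4 ^ p\<close> absorbs \<open>n\<close>.\<close>
      have "c z * c z ^ (2 * p - 1) = c z ^ (2 * p)" using p by (simp add: power_eq_if)
      also have "\<dots> = (16 * norm_proxy n p z) ^ p"
        using norm_proxy_pos[OF n, of p z] by (simp add: power_mult c_def power_mult_distrib)
      also have "\<dots> = 4 ^ p * (4 * norm_proxy n p z) ^ p" by (subst power_mult_distrib[symmetric]) simp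
      also have "\<dots> \<ge> real n * (4 * norm_proxy n p z) ^ p"
        using norm_proxy_pos[OF n, of p z] by (intro mult_right_mono assms) auto
      finally have "real n * (4 * norm_proxy n p z) ^ p \<le> c z * c z ^ (2 * p - 1)" .
      then have "real n * (4 * norm_proxy n p z) ^ p / c z ^ (2 * p - 1) \<le> c z"
        using cpos[of z] by (simp add: divide_le_eq)
      then have "2 ^ card ?I * (real n * (4 * norm_proxy n p z) ^ p / c z ^ (2 * p - 1)) \<le> 2 ^ card ?I * c z"
        by (intro mult_left_mono) auto
      then show ?thesis by simp
    qed
    finally show ?thesis .
  qed
  define N :: ennreal where "N = 2 ^ card ?I"
  have N: "N = ennreal (2 ^ card ?I)" by (simp add: N_def ennreal_power[symmetric])
  have "N * (\<integral>\<^sup>+z. ennreal (F z) \<partial>mu2 n) = (\<Sum>J\<in>Pow ?I. \<integral>\<^sup>+z. ennreal (F z) \<partial>mu2 n)"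
    by (simp add: card_Pow N_def)
  also have "\<dots> = (\<Sum>J\<in>Pow ?I. \<integral>\<^sup>+z. ennreal (F (swap_coords ?I J z)) \<partial>mu2 n)"
    by (intro sum.cong refl nn_integral_swap[symmetric]) measurable
  also have "\<dots> = (\<integral>\<^sup>+z. (\<Sum>J\<in>Pow ?I. ennreal (F (swap_coords ?I J z))) \<partial>mu2 n)"
    by (rule nn_integral_sum[symmetric]) measurable
  also have "\<dots> \<le> (\<integral>\<^sup>+z. N * ennreal (c z) \<partial>mu2 n)"
  proof (intro nn_integral_mono)
    fix z
    have "(\<Sum>J\<in>Pow ?I. ennreal (F (swap_coords ?I J z))) = ennreal (\<Sum>J\<in>Pow ?I. F (swap_coords ?I J z))"
      using F0 by (simp add: sum_ennreal)
    also have "\<dots> \<le> ennreal (2 ^ card ?I * c z)" by (rule ennreal_leI[OF avg])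
    also have "\<dots> = N * ennreal (c z)" using cpos[of z] by (simp add: N ennreal_mult)
    finally show "(\<Sum>J\<in>Pow ?I. ennreal (F (swap_coords ?I J z))) \<le> N * ennreal (c z)" .
  qed
  also have "\<dots> = N * (\<integral>\<^sup>+z. ennreal (c z) \<partial>mu2 n)" by (rule nn_integral_cmult) measurable
  finally have "N * (\<integral>\<^sup>+z. ennreal (F z) \<partial>mu2 n) \<le> N * (\<integral>\<^sup>+z. ennreal (c z) \<partial>mu2 n)" .
  then show ?thesis
    unfolding F_def[symmetric] N by (subst (asm) ennreal_mult_le_mult_iff) auto
qed

section \<open>The expected modulus of the smallest eigenvalue\<close>

lemma qf_diff: "qf n (\<lambda>e. x e - y e) v = qf n x v - qf n y v"
  unfolding quadratic_form_def sym_matrix_edge by (simp add: algebra_simps sum_subtractf)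

lemma integrable_qf: "integrable (mu n) (\<lambda>x. qf n x v)" and integral_qf: "(\<integral>x. qf n x v \<partial>mu n) = 0"
proof -
  have hb: "has_bochner_integral (mu n) (\<lambda>x. x (edge i j)) 0" if "i \<in> {1..n}" "j \<in> {1..n}" for i j
    using integrable_coord integral_coord edge_in_upper[OF that] by (simp add: has_bochner_integral_iff)
  have "has_bochner_integral (mu n) (\<lambda>x. qf n x v) (\<Sum>i\<in>{1..n}. \<Sum>j\<in>{1..n}. v i * 0 * v j)"
    unfolding quadratic_form_def sym_matrix_edge
    by (intro has_bochner_integral_sum has_bochner_integral_mult_left has_bochner_integral_mult_right hb)
  then show "integrable (mu n) (\<lambda>x. qf n x v)" "(\<integral>x. qf n x v \<partial>mu n) = 0"
    by (simp_all add: has_bochner_integral_iff)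
qed

text \<open>Jensen: the independent copy \<open>y\<close> contributes mean zero. The vector
  \<open>v\<close> is fixed during the integration over \<open>y\<close>, so it may depend on
  \<open>x\<close>, in particular be a minimizer for \<open>x\<close>.\<close>

lemma abs_qf_symmetrize:
  "ennreal \<bar>qf n x v\<bar> \<le> (\<integral>\<^sup>+y. ennreal \<bar>qf n (\<lambda>e. x e - y e) v\<bar> \<partial>mu n)"
proof -
  interpret mu: prob_space "mu n" by (rule prob_space_mu)
  have int: "integrable (mu n) (\<lambda>y. qf n x v - qf n y v)" using integrable_qf by simp
  have "qf n x v = (\<integral>y. qf n x v - qf n y v \<partial>mu n)"
    using integrable_qf integral_qf mu.prob_space by simp
  then have "\<bar>qf n x v\<bar> \<le> (\<integral>y. \<bar>qf n x v - qf n y v\<bar> \<partial>mu n)"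
    using integral_abs_bound[of "mu n" "\<lambda>y. qf n x v - qf n y v"] by simp
  then have "ennreal \<bar>qf n x v\<bar> \<le> ennreal (\<integral>y. \<bar>qf n x v - qf n y v\<bar> \<partial>mu n)" by (rule ennreal_leI)
  also have "\<dots> = (\<integral>\<^sup>+y. ennreal \<bar>qf n x v - qf n y v\<bar> \<partial>mu n)"
    using int by (intro nn_integral_eq_integral[symmetric]) auto
  finally show ?thesis by (simp add: qf_diff)
qed

lemma expected_abs_lam: "\<exists>C>0. \<forall>n\<ge>1. (\<integral>x. \<bar>lam n x\<bar> \<partial>mu n) \<le> C * sqrt (real n)"
proof -
  obtain C where C: "C > 0" "\<And>n p. n \<ge> 1 \<Longrightarrow> real (p ^ 4) \<le> 16 * real n \<Longrightarrow>
     (\<integral>\<^sup>+z. ennreal (norm_proxy n p z) \<partial>mu2 n) \<le> ennreal (C * real n)"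
    using expected_norm_proxy by blast
  have "(\<integral>x. \<bar>lam n x\<bar> \<partial>mu n) \<le> (8 * (1 + C)) * sqrt (real n)" if n: "n \<ge> 1" for n
  proof -
    obtain m where m: "real n \<le> 4 ^ (2 ^ m)" "real ((2 ^ m) ^ 4) \<le> 16 * real n"
      using dyadic_exponent[OF n] by blast
    define p :: nat where "p = 2 ^ m"
    have p: "p \<ge> 1" by (simp add: p_def)
    define c where "c z = 4 * sqrt (norm_proxy n p z)" for z
    have cpos: "c z > 0" for z using norm_proxy_pos[OF n] by (simp add: c_def)
    \<comment> \<open>Applying \<open>le_scale_plus\<close> at scale \<open>c z\<close> with
      exponent \<open>2 * p\<close> bounds the form of the difference matrix by one measurable
      function, simultaneously for all unit vectors.\<close>
    define G where "G z = c z + power_norm n p (\<lambda>e. fst z e - snd z e) / c z ^ (2 * p - 1)" for z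
    have c_meas [measurable]: "c \<in> borel_measurable (mu2 n)" unfolding c_def by measurable
    have G_meas [measurable]: "G \<in> borel_measurable (mu2 n)" unfolding G_def by measurable
    have pn0: "power_norm n p b \<ge> 0" for b unfolding power_norm_def by (intro sum_nonneg) auto
    have qG: "\<bar>qf n (\<lambda>e. x e - y e) v\<bar> \<le> G (x, y)" if v: "ip n v v = 1" for x y v
    proof -
      let ?q = "\<bar>qf n (\<lambda>e. x e - y e) v\<bar>"
      have two: "2 * p = Suc (2 * p - 1)" using p by simp
      have "?q \<le> c (x, y) + ?q ^ Suc (2 * p - 1) / c (x, y) ^ (2 * p - 1)"
        by (rule le_scale_plus[OF cpos]) simp
      also have "?q ^ Suc (2 * p - 1) = (qf n (\<lambda>e. x e - y e) v) ^ (2 ^ Suc m)"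
        unfolding two[symmetric] by (simp add: p_def power_even_abs)
      also have "\<dots> \<le> power_norm n p (\<lambda>e. x e - y e)"
        unfolding power_norm_def p_def by (rule qf_power_le[OF v])
      finally show ?thesis unfolding G_def using cpos[of "(x, y)"]
        by (simp add: divide_right_mono)
    qed
    interpret mu: prob_space "mu n" by (rule prob_space_mu)
    have "ennreal (\<integral>x. \<bar>lam n x\<bar> \<partial>mu n) = (\<integral>\<^sup>+x. ennreal \<bar>lam n x\<bar> \<partial>mu n)"
      using integrable_lam[OF n] by (intro nn_integral_eq_integral[symmetric]) auto
    also have "\<dots> \<le> (\<integral>\<^sup>+x. (\<integral>\<^sup>+y. ennreal (G (x, y)) \<partial>mu n) \<partial>mu n)"
    proof (intro nn_integral_mono)
      fix x
      let ?v = "min_eigenvector n x"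
      have "ennreal \<bar>lam n x\<bar> \<le> (\<integral>\<^sup>+y. ennreal \<bar>qf n (\<lambda>e. x e - y e) ?v\<bar> \<partial>mu n)"
        unfolding lam_def by (rule abs_qf_symmetrize)
      also have "\<dots> \<le> (\<integral>\<^sup>+y. ennreal (G (x, y)) \<partial>mu n)"
        by (intro nn_integral_mono ennreal_leI qG min_eigenvector_unit n)
      finally show "ennreal \<bar>lam n x\<bar> \<le> (\<integral>\<^sup>+y. ennreal (G (x, y)) \<partial>mu n)" .
    qed
    also have "\<dots> = (\<integral>\<^sup>+z. ennreal (G z) \<partial>mu2 n)" by (rule mu.nn_integral_fst) measurable
    also have "\<dots> = (\<integral>\<^sup>+z. ennreal (c z) \<partial>mu2 n) +
        (\<integral>\<^sup>+z. ennreal (power_norm n p (\<lambda>e. fst z e - snd z e) / c z ^ (2 * p - 1)) \<partial>mu2 n)"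
      unfolding G_def using cpos pn0 by (subst nn_integral_add[symmetric]) (auto simp: ennreal_plus less_imp_le)
    also have "\<dots> \<le> (\<integral>\<^sup>+z. ennreal (c z) \<partial>mu2 n) + (\<integral>\<^sup>+z. ennreal (c z) \<partial>mu2 n)"
      using symmetrized_power_average[OF n p] m(1)
      by (intro add_mono order_refl) (simp add: p_def c_def)
    \<comment> \<open>A second splitting, now at scale \<open>sqrt n\<close>, replaces the root of
      the proxy by its first moment.\<close>
    also have "(\<integral>\<^sup>+z. ennreal (c z) \<partial>mu2 n) \<le> (\<integral>\<^sup>+z. ennreal (4 * sqrt (real n)) + ennreal (4 / sqrt (real n)) * ennreal (norm_proxy n p z) \<partial>mu2 n)"
    proof (intro nn_integral_mono)
      fix z
      define s where "s = sqrt (norm_proxy n p z)"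
      have s: "s > 0" "norm_proxy n p z = s\<^sup>2" using norm_proxy_pos[OF n, of p z] by (auto simp: s_def)
      have "s \<le> sqrt (real n) + s ^ Suc 1 / sqrt (real n) ^ 1"
        using n s by (intro le_scale_plus) auto
      then have "c z \<le> 4 * sqrt (real n) + 4 / sqrt (real n) * norm_proxy n p z"
        using s by (simp add: c_def power2_eq_square)
      then have "ennreal (c z) \<le> ennreal (4 * sqrt (real n) + 4 / sqrt (real n) * norm_proxy n p z)"
        by (rule ennreal_leI)
      also have "\<dots> = ennreal (4 * sqrt (real n)) + ennreal (4 / sqrt (real n)) * ennreal (norm_proxy n p z)"
        using s by (subst ennreal_plus, simp, simp, subst ennreal_mult[symmetric]) auto
      finally show "ennreal (c z) \<le> ennreal (4 * sqrt (real n)) + ennreal (4 / sqrt (real n)) * ennreal (norm_proxy n p z)" .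
    qed
    also have "\<dots> = ennreal (4 * sqrt (real n)) + ennreal (4 / sqrt (real n)) * (\<integral>\<^sup>+z. ennreal (norm_proxy n p z) \<partial>mu2 n)"
      using prob_space.emeasure_space_1[OF prob_space_mu2[of n]]
      by (subst nn_integral_add) (auto simp: nn_integral_cmult)
    also have "\<dots> \<le> ennreal (4 * sqrt (real n)) + ennreal (4 / sqrt (real n)) * ennreal (C * real n)"
      using C(2)[OF n, of p] m(2) by (intro add_mono mult_left_mono order_refl) (simp_all add: p_def)
    also have "\<dots> = ennreal (4 * (1 + C) * sqrt (real n))"
    proof -
      have "4 / sqrt (real n) * (C * real n) = 4 * C * (real n / sqrt (real n))" by simp
      also have "real n / sqrt (real n) = sqrt (real n)" by (simp add: real_div_sqrt)
      finally have eq: "4 / sqrt (real n) * (C * real n) = 4 * C * sqrt (real n)" .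
      have "ennreal (4 / sqrt (real n)) * ennreal (C * real n) = ennreal (4 * C * sqrt (real n))"
        unfolding eq[symmetric] using C(1) by (intro ennreal_mult[symmetric]) auto
      moreover have "ennreal (4 * sqrt (real n)) + ennreal (4 * C * sqrt (real n)) = ennreal (4 * (1 + C) * sqrt (real n))"
        using C(1) by (subst ennreal_plus[symmetric]) (auto simp: algebra_simps)
      ultimately show ?thesis by simp
    qed
    finally have "ennreal (\<integral>x. \<bar>lam n x\<bar> \<partial>mu n) \<le> ennreal (4 * (1 + C) * sqrt (real n)) + ennreal (4 * (1 + C) * sqrt (real n))"
      by (meson add_mono order_trans)
    also have "\<dots> = ennreal ((8 * (1 + C)) * sqrt (real n))"
      using C(1) by (subst ennreal_plus[symmetric]) (auto simp: algebra_simps)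
    finally show ?thesis using C(1) by (subst (asm) ennreal_le_iff) auto
  qed
  then show ?thesis using C(1) by (intro exI[of _ "8 * (1 + C)"]) auto
qed

end

section \<open>Almost sure uniqueness of the minimizer\<close>

lemma qf_upd:
  assumes "e \<in> upper_indices n"
  shows "qf n (x(e := t)) v = qf n x v + (t - x e) * edge_weight v e"
proof -
  have "qf n (x(e := t)) v - qf n x v = (\<Sum>p\<in>upper_indices n. if p = e then (t - x e) * edge_weight v e else 0)"
    unfolding qf_edge_weight sum_subtractf[symmetric] by (intro sum.cong) (auto simp: algebra_simps)
  also have "\<dots> = (t - x e) * edge_weight v e" using assms by simp
  finally show ?thesis by simp
qed

text \<open>No sign is imposed, so \<open>v\<close> and \<open>- v\<close> are minimizers together;
  uniqueness is meant for the edge weights, which determine a vector up to sign.\<close>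

definition minimizer :: "nat \<Rightarrow> (nat \<times> nat \<Rightarrow> real) \<Rightarrow> (nat \<Rightarrow> real) \<Rightarrow> bool" where
  "minimizer n x v \<longleftrightarrow> ip n v v = 1 \<and> qf n x v = lam n x"

lemma ex_minimizer_lam: "n \<ge> 1 \<Longrightarrow> minimizer n x (min_eigenvector n x)"
  by (simp add: minimizer_def min_eigenvector_unit lam_def)

lemma lam_le_unit: "n \<ge> 1 \<Longrightarrow> ip n v v = 1 \<Longrightarrow> lam n x \<le> qf n x v"
  using lam_le_qf[of n x v] by simp

lemma lam_upd_le:
  assumes "n \<ge> 1" "e \<in> upper_indices n" "minimizer n x v"
  shows "lam n (x(e := t)) \<le> lam n x + (t - x e) * edge_weight v e"
  using lam_le_unit[of n v "x(e := t)"] assms qf_upd[OF assms(2)] by (simp add: minimizer_def)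

text \<open>For concave \<open>L\<close> the supremum over \<open>m\<close> is the right derivative,
  and the infimum of the left quotients is the left one. Only steps \<open>1 / Suc m\<close> are
  used, so that both are countable operations and preserve measurability.\<close>

definition diff_quot_right :: "(real \<Rightarrow> real) \<Rightarrow> real \<Rightarrow> nat \<Rightarrow> real" where
  "diff_quot_right L t m = real (Suc m) * (L (t + 1 / real (Suc m)) - L t)"

definition diff_quot_left :: "(real \<Rightarrow> real) \<Rightarrow> real \<Rightarrow> nat \<Rightarrow> real" where
  "diff_quot_left L t m = real (Suc m) * (L t - L (t - 1 / real (Suc m)))"

text \<open>The intervals between the one-sided slopes at distinct kinks of a concave function are disjoint.\<close>

lemma countable_concave_kinks:
  fixes L :: "real \<Rightarrow> real"
  assumes concave: "\<And>s t \<theta>. 0 \<le> \<theta> \<Longrightarrow> \<theta> \<le> 1 \<Longrightarrow> (1 - \<theta>) * L s + \<theta> * L t \<le> L ((1 - \<theta>) * s + \<theta> * t)"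
    and bdd: "\<And>t. bdd_above (range (diff_quot_right L t))" "\<And>t. bdd_below (range (diff_quot_left L t))"
  shows "countable {t. (SUP m. diff_quot_right L t m) < (INF m. diff_quot_left L t m)}"
proof -
  define R where "R t = (SUP m. diff_quot_right L t m)" for t
  define D where "D t = (INF m. diff_quot_left L t m)" for t
  let ?B = "{t. R t < D t}"
  \<comment> \<open>One common step \<open>h < t - s\<close> is taken to the right of
    \<open>s\<close> and to the left of \<open>t\<close>; concavity compares both increments with
    the chord from \<open>s\<close> to \<open>t\<close>.\<close>
  have key: "D t \<le> R s" if st: "s < t" for s t
  proof -
    obtain m where m: "1 / real (Suc m) < t - s" using st nat_approx_posE[of "t - s"] by auto
    define h where "h = 1 / real (Suc m)"
    define \<theta> where "\<theta> = h / (t - s)"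
    have h: "h > 0" "real (Suc m) * h = 1" unfolding h_def by auto
    have "h < t - s" using m by (simp only: h_def)
    then have th: "0 \<le> \<theta>" "\<theta> \<le> 1" "\<theta> * (t - s) = h" using st h(1) by (auto simp: \<theta>_def)
    have p1: "(1 - \<theta>) * s + \<theta> * t = s + h" "(1 - \<theta>) * t + \<theta> * s = t - h"
      using th(3) by (simp_all add: algebra_simps)
    have "\<theta> * (L t - L s) \<le> L (s + h) - L s"
      using concave[OF th(1,2), of s t] unfolding p1 by (simp add: algebra_simps)
    moreover have "L t - L (t - h) \<le> \<theta> * (L t - L s)"
      using concave[OF th(1,2), of t s] unfolding p1 by (simp add: algebra_simps)
    ultimately have "L t - L (t - h) \<le> L (s + h) - L s" by simp
    then have "diff_quot_left L t m \<le> diff_quot_right L s m"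
      unfolding diff_quot_left_def diff_quot_right_def h_def[symmetric] by (intro mult_left_mono) auto
    moreover have "D t \<le> diff_quot_left L t m" unfolding D_def by (intro cINF_lower bdd) auto
    moreover have "diff_quot_right L s m \<le> R s" unfolding R_def by (intro cSUP_upper bdd) auto
    ultimately show ?thesis by linarith
  qed
  have "\<exists>q::rat. t \<in> ?B \<longrightarrow> R t < of_rat q \<and> of_rat q < D t" for t
    using of_rat_dense[of "R t" "D t"] by auto
  then obtain q :: "real \<Rightarrow> rat" where q: "\<And>t. t \<in> ?B \<Longrightarrow> R t < of_rat (q t) \<and> of_rat (q t) < D t" by metis
  have lt: "q t \<noteq> q s" if "s \<in> ?B" "t \<in> ?B" "s < t" for s t
    using q[OF that(1)] q[OF that(2)] key[OF that(3)] by auto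
  have "inj_on q ?B"
  proof (rule inj_onI)
    fix s t assume st: "s \<in> ?B" "t \<in> ?B" "q s = q t"
    show "s = t" using lt[OF st(1,2)] lt[OF st(2,1)] st(3) by (cases s t rule: linorder_cases) auto
  qed
  then have "countable ?B" by (rule countableI') 
  then show ?thesis by (simp add: R_def D_def)
qed

text \<open>A minimum of functions that are affine in the entry \<open>e\<close>.\<close>

lemma lam_line_concave:
  assumes n: "n \<ge> 1" and e: "e \<in> upper_indices n" and \<theta>: "0 \<le> \<theta>" "\<theta> \<le> 1"
  shows "(1 - \<theta>) * lam n (x(e := s)) + \<theta> * lam n (x(e := t)) \<le> lam n (x(e := (1 - \<theta>) * s + \<theta> * t))"
proof -
  let ?y = "x(e := (1 - \<theta>) * s + \<theta> * t)"
  define v where "v = min_eigenvector n ?y"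
  have v: "ip n v v = 1" "qf n ?y v = lam n ?y" using ex_minimizer_lam[OF n, of ?y] by (auto simp: v_def minimizer_def)
  have "(1 - \<theta>) * lam n (x(e := s)) + \<theta> * lam n (x(e := t)) \<le> (1 - \<theta>) * qf n (x(e := s)) v + \<theta> * qf n (x(e := t)) v"
    using \<theta> lam_le_unit[OF n v(1)] by (intro add_mono mult_left_mono) auto
  also have "\<dots> = qf n ?y v" unfolding qf_upd[OF e] by (simp add: algebra_simps)
  finally show ?thesis using v by simp
qed

text \<open>The right partial derivative of the smallest eigenvalue in the entry \<open>e\<close>:
  the measurable substitute for the edge weight of a minimizer.\<close>

definition line_slope_right :: "nat \<Rightarrow> nat \<times> nat \<Rightarrow> (nat \<times> nat \<Rightarrow> real) \<Rightarrow> real" where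
  "line_slope_right n e x = (SUP m. diff_quot_right (\<lambda>t. lam n (x(e := t))) (x e) m)"

definition line_slope_left :: "nat \<Rightarrow> nat \<times> nat \<Rightarrow> (nat \<times> nat \<Rightarrow> real) \<Rightarrow> real" where
  "line_slope_left n e x = (INF m. diff_quot_left (\<lambda>t. lam n (x(e := t))) (x e) m)"

text \<open>A minimizer at \<open>t\<close> stays a competitor when the entry moves, so its edge
  weight is the slope of a line above the concave function that touches it at \<open>t\<close>. The
  same comparison makes the function Lipschitz with constant 2, the bound on edge weights.\<close>

lemma lam_line_quots:
  assumes n: "n \<ge> 1" and e: "e \<in> upper_indices n" and v: "minimizer n (x(e := t)) v"
  shows "diff_quot_right (\<lambda>t. lam n (x(e := t))) t m \<le> edge_weight v e"
    and "edge_weight v e \<le> diff_quot_left (\<lambda>t. lam n (x(e := t))) t m"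
    and "\<bar>diff_quot_right (\<lambda>t. lam n (x(e := t))) t m\<bar> \<le> 2"
    and "\<bar>diff_quot_left (\<lambda>t. lam n (x(e := t))) t m\<bar> \<le> 2"
proof -
  have up: "lam n (x(e := r)) \<le> lam n (x(e := t)) + (r - t) * edge_weight w e" if "minimizer n (x(e := t)) w" for r t w
    using lam_upd_le[OF n e that, of r] by simp
  define h where "h = 1 / real (Suc m)"
  have h: "h > 0" "real (Suc m) * h = 1" unfolding h_def by auto
  have lip: "\<bar>lam n (x(e := r)) - lam n (x(e := t))\<bar> \<le> 2 * \<bar>r - t\<bar>" for r t
  proof -
    have one: "lam n (x(e := r)) - lam n (x(e := t)) \<le> 2 * \<bar>r - t\<bar>" for r t
    proof -
      obtain w where w: "minimizer n (x(e := t)) w" using ex_minimizer_lam[OF n] by blast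
      have "(r - t) * edge_weight w e \<le> \<bar>r - t\<bar> * \<bar>edge_weight w e\<bar>" by (metis abs_ge_self abs_mult)
      also have "\<dots> \<le> \<bar>r - t\<bar> * 2"
        using edge_weight_le[of n w e] e w by (intro mult_left_mono) (auto simp: minimizer_def)
      finally show ?thesis using up[OF w, of r] by linarith
    qed
    show ?thesis using one[of r t] one[of t r] by (auto simp: abs_minus_commute)
  qed
  have sc: "real (Suc m) * (h * c) = c" for c using h(2) by (simp add: mult.assoc[symmetric])
  show "diff_quot_right (\<lambda>t. lam n (x(e := t))) t m \<le> edge_weight v e"
  proof -
    have "lam n (x(e := t + h)) - lam n (x(e := t)) \<le> h * edge_weight v e" using up[OF v, of "t + h"] by simp
    then have "real (Suc m) * (lam n (x(e := t + h)) - lam n (x(e := t))) \<le> real (Suc m) * (h * edge_weight v e)"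
      by (intro mult_left_mono) auto
    then show ?thesis unfolding sc unfolding diff_quot_right_def h_def .
  qed
  show "edge_weight v e \<le> diff_quot_left (\<lambda>t. lam n (x(e := t))) t m"
  proof -
    have "h * edge_weight v e \<le> lam n (x(e := t)) - lam n (x(e := t - h))" using up[OF v, of "t - h"] by simp
    then have "real (Suc m) * (h * edge_weight v e) \<le> real (Suc m) * (lam n (x(e := t)) - lam n (x(e := t - h)))"
      by (intro mult_left_mono) auto
    then show ?thesis unfolding sc unfolding diff_quot_left_def h_def .
  qed
  show "\<bar>diff_quot_right (\<lambda>t. lam n (x(e := t))) t m\<bar> \<le> 2"
  proof -
    have "real (Suc m) * \<bar>lam n (x(e := t + h)) - lam n (x(e := t))\<bar> \<le> real (Suc m) * (h * 2)"
      using lip[of "t + h" t] h(1) by (intro mult_left_mono) auto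
    then show ?thesis unfolding sc unfolding diff_quot_right_def h_def by (simp add: abs_mult)
  qed
  show "\<bar>diff_quot_left (\<lambda>t. lam n (x(e := t))) t m\<bar> \<le> 2"
  proof -
    have "real (Suc m) * \<bar>lam n (x(e := t)) - lam n (x(e := t - h))\<bar> \<le> real (Suc m) * (h * 2)"
      using lip[of t "t - h"] h(1) by (intro mult_left_mono) auto
    then show ?thesis unfolding sc unfolding diff_quot_left_def h_def by (simp add: abs_mult)
  qed
qed

lemma lam_line_bdd:
  assumes n: "n \<ge> 1" and e: "e \<in> upper_indices n"
  shows "bdd_above (range (diff_quot_right (\<lambda>t. lam n (x(e := t))) t))"
    and "bdd_below (range (diff_quot_left (\<lambda>t. lam n (x(e := t))) t))"
proof -
  note q = lam_line_quots[OF n e ex_minimizer_lam[OF n], of x t]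
  show "bdd_above (range (diff_quot_right (\<lambda>t. lam n (x(e := t))) t))"
    by (rule bdd_aboveI2[where M = 2]) (use q(3) in \<open>simp add: abs_le_iff\<close>)
  show "bdd_below (range (diff_quot_left (\<lambda>t. lam n (x(e := t))) t))"
    by (rule bdd_belowI2[where m = "-2"]) (use q(4) in \<open>simp add: abs_le_iff minus_le_iff\<close>)
qed

lemma line_slope_bounds:
  assumes n: "n \<ge> 1" and e: "e \<in> upper_indices n" and v: "minimizer n x v"
  shows "line_slope_right n e x \<le> edge_weight v e" "edge_weight v e \<le> line_slope_left n e x"
    "\<bar>line_slope_right n e x\<bar> \<le> 2"
proof -
  have v': "minimizer n (x(e := x e)) v" using v by simp
  note q = lam_line_quots[OF n e v']
  show "line_slope_right n e x \<le> edge_weight v e"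
    unfolding line_slope_right_def by (intro cSUP_least q) auto
  show "edge_weight v e \<le> line_slope_left n e x"
    unfolding line_slope_left_def by (intro cINF_greatest q) auto
  have "diff_quot_right (\<lambda>t. lam n (x(e := t))) (x e) 0 \<le> line_slope_right n e x"
    unfolding line_slope_right_def by (intro cSUP_upper lam_line_bdd n e) auto
  moreover have "line_slope_right n e x \<le> 2"
    unfolding line_slope_right_def using q(3) by (intro cSUP_least) (auto simp: abs_le_iff)
  ultimately show "\<bar>line_slope_right n e x\<bar> \<le> 2" using q(3)[of 0] by (simp add: abs_le_iff)
qed

context wigner_input begin

lemma measurable_upd [measurable]:
  assumes "e \<in> upper_indices n" "f \<in> borel_measurable (mu n)"
  shows "(\<lambda>x. x(e := f x)) \<in> mu n \<rightarrow>\<^sub>M mu n"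
  unfolding mu_def
  by (rule measurable_fun_upd[of _ "upper_indices n"])
     (use assms in \<open>auto simp: mu_def[symmetric] measurable_cong_sets[OF refl sets_P]\<close>)

lemma measurable_line_slope [measurable]:
  assumes n: "n \<ge> 1" and e: "e \<in> upper_indices n"
  shows "line_slope_right n e \<in> borel_measurable (mu n)" "line_slope_left n e \<in> borel_measurable (mu n)"
proof -
  note [measurable] = measurable_coord[OF e] measurable_lam[OF n]
  have l: "(\<lambda>x. lam n (x(e := x e + c))) \<in> borel_measurable (mu n)"
       "(\<lambda>x. lam n (x(e := x e - c))) \<in> borel_measurable (mu n)" for c
    by (rule measurable_compose[OF measurable_upd[OF e] measurable_lam[OF n]]; measurable)+
  show "line_slope_right n e \<in> borel_measurable (mu n)"
    unfolding line_slope_right_def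
    by (intro borel_measurable_cSUP lam_line_bdd n e)
       (auto simp: diff_quot_right_def intro!: borel_measurable_times borel_measurable_diff l)
  show "line_slope_left n e \<in> borel_measurable (mu n)"
    unfolding line_slope_left_def
    by (intro borel_measurable_cINF lam_line_bdd n e)
       (auto simp: diff_quot_left_def intro!: borel_measurable_times borel_measurable_diff l)
qed

lemma AE_coord:
  assumes "e \<in> upper_indices n" "AE t in P. Q t"
  shows "AE x in mu n. Q (x e)"
proof (rule AE_distrD[OF measurable_coord[OF assms(1)]])
  show "AE t in distr (mu n) borel (\<lambda>x. x e). Q t"
    unfolding distr_coord[OF assms(1)] by (rule assms(2))
qed

lemma countable_AE_notin:
  assumes "countable B" shows "AE t in P. t \<notin> B"
proof -
  have "B \<in> null_sets P"
    using atomless by (subst UN_singleton[symmetric], intro null_sets_UN' assms) (auto simp: null_sets_def)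
  then show ?thesis by (rule AE_not_in)
qed

text \<open>Resampling the single entry \<open>e\<close> preserves the law; with the other entries
  fixed, the fresh entry avoids the countably many kinks. Fubini combines the two.\<close>

lemma AE_smooth_line:
  assumes n: "n \<ge> 1" and e: "e \<in> upper_indices n"
  shows "AE x in mu n. \<not> line_slope_right n e x < line_slope_left n e x"
proof -
  note [measurable] = measurable_line_slope[OF n e]
  interpret mu: prob_space "mu n" by (rule prob_space_mu)
  interpret pr: pair_sigma_finite "mu n" "mu n" by (rule pair_sigma_finite_mu)
  let ?Q = "\<lambda>x. \<not> line_slope_right n e x < line_slope_left n e x"
  have "AE z in mu2 n. ?Q (rs n {e} (fst z) (snd z))"
  proof (rule pr.AE_pair_measure)
    show "{z \<in> space (mu2 n). ?Q (rs n {e} (fst z) (snd z))} \<in> sets (mu2 n)" by measurable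
    show "AE x in mu n. AE y in mu n. ?Q (rs n {e} (fst (x, y)) (snd (x, y)))"
    proof (rule AE_I2)
      fix x assume x: "x \<in> space (mu n)"
      have upd: "rs n {e} x y = x(e := y e)" for y
        using x e by (auto simp: res_def mu_def space_PiM PiE_def extensional_def fun_eq_iff)
      let ?L = "\<lambda>t. lam n (x(e := t))"
      let ?B = "{t. (SUP m. diff_quot_right ?L t m) < (INF m. diff_quot_left ?L t m)}"
      have "countable ?B"
        by (rule countable_concave_kinks) (use lam_line_concave[OF n e] lam_line_bdd[OF n e] in auto)
      then have "AE t in P. t \<notin> ?B" by (rule countable_AE_notin)
      then have "AE t in P. ?Q (x(e := t))"
        by (simp add: line_slope_right_def line_slope_left_def)
      from AE_coord[OF e this] show "AE y in mu n. ?Q (rs n {e} (fst (x, y)) (snd (x, y)))"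
        by (simp add: upd)
    qed
  qed
  then have "AE x in distr (mu2 n) (mu n) (\<lambda>z. rs n {e} (fst z) (snd z)). ?Q x"
    by (subst AE_distr_iff) measurable
  then show ?thesis unfolding distr_rs .
qed

text \<open>The edge weight of every minimizer lies between the two one-sided slopes, which coincide
  off the kinks. The quantifier over \<open>v\<close> stands inside the almost sure statement, so
  the identity also covers minimizers chosen in a non-measurable way.\<close>

lemma AE_edge_weight_eq:
  assumes n: "n \<ge> 1"
  shows "AE x in mu n. \<forall>e\<in>upper_indices n. \<forall>v. minimizer n x v \<longrightarrow> edge_weight v e = line_slope_right n e x"
proof (rule AE_finite_allI)
  fix e assume e: "e \<in> upper_indices n"
  show "AE x in mu n. \<forall>v. minimizer n x v \<longrightarrow> edge_weight v e = line_slope_right n e x"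
    using AE_smooth_line[OF n e]
  proof eventually_elim
    case (elim x)
    then show ?case using line_slope_bounds(1,2)[OF n e, of x] by (metis antisym not_less order_trans)
  qed
qed simp

end

section \<open>Resampling a row\<close>

lemma row_block_iff:
  "e \<in> row_block n i \<longleftrightarrow> (fst e = i \<and> i \<le> snd e \<and> snd e \<in> {1..n}) \<or> (snd e = i \<and> fst e \<le> i \<and> fst e \<in> {1..n})"
  by (cases e) (auto simp: row_block_def)

lemma row_block_subset: "i \<in> {1..n} \<Longrightarrow> row_block n i \<subseteq> upper_indices n"
  by (auto simp: row_block_def upper_indices_def)

lemma edge_in_row_block: "j \<in> {1..n} \<Longrightarrow> edge i j \<in> row_block n i"
  by (auto simp: row_block_iff edge_def min_def max_def)

lemma sum_row_blocks:
  fixes f :: "nat \<times> nat \<Rightarrow> real"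
  shows "(\<Sum>i\<in>{1..n}. \<Sum>e\<in>row_block n i. f e) = 2 * (\<Sum>e\<in>upper_indices n. f e) - (\<Sum>i\<in>{1..n}. f (i, i))"
proof -
  let ?V = "{1..n}" and ?I = "upper_indices n"
  have "(\<Sum>e\<in>row_block n i. f e) = (\<Sum>e\<in>?I. if e \<in> row_block n i then f e else 0)" if "i \<in> ?V" for i
    using row_block_subset[OF that] by (subst sum.inter_restrict[symmetric]) (auto intro: sum.cong)
  then have "(\<Sum>i\<in>?V. \<Sum>e\<in>row_block n i. f e) = (\<Sum>e\<in>?I. \<Sum>i\<in>?V. if e \<in> row_block n i then f e else 0)"
    by (rule trans[OF sum.cong[OF refl] sum.swap])
  also have "\<dots> = (\<Sum>e\<in>?I. 2 * f e - (if fst e = snd e then f e else 0))"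
  proof (intro sum.cong refl)
    fix e assume e: "e \<in> ?I"
    have "(\<Sum>i\<in>?V. if e \<in> row_block n i then f e else 0) = (\<Sum>i\<in>{i \<in> ?V. e \<in> row_block n i}. f e)"
      by (rule sum.inter_filter[symmetric]) simp
    also have "{i \<in> ?V. e \<in> row_block n i} = {fst e, snd e}"
      using e by (auto simp: row_block_iff upper_indices_def)
    finally show "(\<Sum>i\<in>?V. if e \<in> row_block n i then f e else 0) = 2 * f e - (if fst e = snd e then f e else 0)"
      by (cases "fst e = snd e") (auto simp: card_insert_if)
  qed
  also have "\<dots> = 2 * (\<Sum>e\<in>?I. f e) - (\<Sum>e\<in>?I. if fst e = snd e then f e else 0)"
    by (simp add: sum_subtractf sum_distrib_left)
  also have "(\<Sum>e\<in>?I. if fst e = snd e then f e else 0) = (\<Sum>e\<in>{e \<in> ?I. fst e = snd e}. f e)"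
    by (rule sum.inter_filter[symmetric]) simp
  also have "{e \<in> ?I. fst e = snd e} = (\<lambda>i. (i, i)) ` ?V"
    by (auto simp: upper_indices_def)
  also have "sum f ((\<lambda>i. (i, i)) ` ?V) = (\<Sum>i\<in>?V. f (i, i))"
    by (subst sum.reindex) (auto simp: inj_on_def)
  finally show ?thesis .
qed

lemma qf_res_row:
  assumes "i \<in> {1..n}"
  shows "qf n (res (upper_indices n) (row_block n i) x y) v =
    qf n x v + (\<Sum>e\<in>row_block n i. (y e - x e) * edge_weight v e)"
proof -
  let ?I = "upper_indices n"
  have "qf n (res ?I (row_block n i) x y) v - qf n x v =
     (\<Sum>e\<in>?I. if e \<in> row_block n i then (y e - x e) * edge_weight v e else 0)"
    unfolding qf_edge_weight sum_subtractf[symmetric]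
    by (intro sum.cong) (auto simp: res_def algebra_simps)
  also have "\<dots> = (\<Sum>e\<in>row_block n i. (y e - x e) * edge_weight v e)"
    using row_block_subset[OF assms] by (subst sum.inter_restrict[symmetric]) (auto intro: sum.cong)
  finally show ?thesis by simp
qed

text \<open>Removing all rows in turn changes the form at a minimizer \<open>v\<close> by
  \<open>- 2 * lam\<close> plus the sum of \<open>x (i, i) * (v i)^2\<close>, where each diagonal
  entry is at most \<open>sqrt n + x (i, i)^2 / sqrt n\<close>. The modulus makes the bound
  nonnegative.\<close>

definition defect_bound :: "nat \<Rightarrow> (nat \<times> nat \<Rightarrow> real) \<Rightarrow> real" where
  "defect_bound n x = 2 * \<bar>lam n x\<bar> + sqrt (real n) + (\<Sum>i\<in>{1..n}. (x (i, i))\<^sup>2) / sqrt (real n)"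

lemma row_removal_le_defect_bound:
  assumes n: "n \<ge> 1" and v: "minimizer n x v"
  shows "- (\<Sum>i\<in>{1..n}. \<Sum>e\<in>row_block n i. x e * edge_weight v e) \<le> defect_bound n x"
proof -
  have v1: "ip n v v = 1" "qf n x v = lam n x" using v by (auto simp: minimizer_def)
  have "- (\<Sum>i\<in>{1..n}. \<Sum>e\<in>row_block n i. x e * edge_weight v e) = - 2 * lam n x + (\<Sum>i\<in>{1..n}. x (i, i) * (v i)\<^sup>2)"
    unfolding sum_row_blocks qf_edge_weight[symmetric] v1(2)
    by (simp add: edge_weight_def power2_eq_square)
  also have "(\<Sum>i\<in>{1..n}. x (i, i) * (v i)\<^sup>2) \<le> (\<Sum>i\<in>{1..n}. sqrt (real n) * (v i)\<^sup>2 + (x (i, i))\<^sup>2 / sqrt (real n))"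
  proof (intro sum_mono)
    fix i assume i: "i \<in> {1..n}"
    have vi: "0 \<le> (v i)\<^sup>2" "(v i)\<^sup>2 \<le> 1" using ip_coord_le[OF i, of v] v1(1) by auto
    have "\<bar>x (i, i)\<bar> \<le> sqrt (real n) + \<bar>x (i, i)\<bar> ^ Suc 1 / sqrt (real n) ^ 1"
      using n by (intro le_scale_plus) auto
    then have "x (i, i) \<le> sqrt (real n) + (x (i, i))\<^sup>2 / sqrt (real n)"
      by (simp add: power2_eq_square)
    then have "x (i, i) * (v i)\<^sup>2 \<le> (sqrt (real n) + (x (i, i))\<^sup>2 / sqrt (real n)) * (v i)\<^sup>2"
      using vi by (intro mult_right_mono) auto
    also have "\<dots> = sqrt (real n) * (v i)\<^sup>2 + (x (i, i))\<^sup>2 / sqrt (real n) * (v i)\<^sup>2"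
      by (simp add: algebra_simps)
    also have "(x (i, i))\<^sup>2 / sqrt (real n) * (v i)\<^sup>2 \<le> (x (i, i))\<^sup>2 / sqrt (real n) * 1"
      using vi by (intro mult_left_mono) auto
    finally show "x (i, i) * (v i)\<^sup>2 \<le> sqrt (real n) * (v i)\<^sup>2 + (x (i, i))\<^sup>2 / sqrt (real n)" by simp
  qed
  also have "\<dots> = sqrt (real n) * ip n v v + (\<Sum>i\<in>{1..n}. (x (i, i))\<^sup>2) / sqrt (real n)"
    unfolding sum.distrib ip_def power2_eq_square by (simp add: sum_distrib_left sum_divide_distrib)
  finally show ?thesis using v1(1) unfolding defect_bound_def by simp
qed

lemma mv_unitv: "i \<in> {1..n} \<Longrightarrow> ip n (unitv i) w = w i"
  by (simp add: ip_def unitv_def of_bool_def if_distrib[of "\<lambda>t. t * _"] cong: if_cong)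

lemma qf_unitv: "i \<in> {1..n} \<Longrightarrow> qf n x (unitv i) = x (i, i)"
  unfolding qf_ip mv_unitv by (simp add: mv_def unitv_def of_bool_def if_distrib edge_def cong: if_cong)

definition eig_span :: "nat \<Rightarrow> (nat \<Rightarrow> nat \<Rightarrow> real) \<Rightarrow> (nat \<Rightarrow> real) set" where
  "eig_span k u = range (\<lambda>c j. \<Sum>a<k. c a * u a j)"

lemma eig_span_closed:
  assumes "v \<in> eig_span k u" "w \<in> eig_span k u"
  shows "(\<lambda>j. a * v j + b * w j) \<in> eig_span k u"
proof -
  obtain c d where "v = (\<lambda>j. \<Sum>i<k. c i * u i j)" "w = (\<lambda>j. \<Sum>i<k. d i * u i j)"
    using assms by (auto simp: eig_span_def)
  then have "(\<lambda>j. a * v j + b * w j) = (\<lambda>j. \<Sum>i<k. (a * c i + b * d i) * u i j)"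
    by (simp add: sum_distrib_left sum.distrib algebra_simps)
  then show ?thesis by (auto simp: eig_span_def)
qed

lemma eig_span_sum:
  fixes m :: nat
  assumes "\<And>a. a < m \<Longrightarrow> z a \<in> eig_span k u"
  shows "(\<lambda>j. \<Sum>a<m. c a * z a j) \<in> eig_span k u"
  using assms
proof (induction m)
  case 0
  show ?case unfolding eig_span_def by (rule image_eqI[where x = "\<lambda>_. 0"]) simp_all
next
  case (Suc m)
  have "(\<lambda>j. 1 * (\<Sum>a<m. c a * z a j) + c m * z m j) \<in> eig_span k u"
    by (rule eig_span_closed) (use Suc in auto)
  then show ?case by simp
qed

lemma eig_span_base: "a < k \<Longrightarrow> u a \<in> eig_span k u"
proof -
  assume "a < k"
  then have "u a = (\<lambda>j. \<Sum>b<k. of_bool (b = a) * u b j)"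
    by (simp add: of_bool_def if_distrib[of "\<lambda>t. t * _"] cong: if_cong)
  then show ?thesis unfolding eig_span_def
    by (rule image_eqI[where x = "\<lambda>b. of_bool (b = a)"]) simp
qed

lemma eig_span_qf_le:
  assumes es: "eigsys n x k u \<mu>" and \<mu>: "\<And>a. a < k \<Longrightarrow> \<mu> a \<le> \<theta>" and v: "v \<in> eig_span k u"
  shows "qf n x v \<le> \<theta> * ip n v v"
proof -
  obtain c where c: "v = (\<lambda>j. \<Sum>a<k. c a * u a j)" using v by (auto simp: eig_span_def)
  have on: "orthonormal n k u" using es by (auto simp: eigsys_def orthonormal_def)
  have "qf n x v = (\<Sum>a<k. (c a)\<^sup>2 * \<mu> a)" unfolding c by (rule qf_sum_eigsys[OF es])
  also have "\<dots> \<le> (\<Sum>a<k. (c a)\<^sup>2 * \<theta>)" using \<mu> by (intro sum_mono mult_left_mono) auto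
  also have "\<dots> = \<theta> * ip n v v"
    unfolding c ip_sum_orthonormal[OF on] by (simp add: sum_distrib_left power2_eq_square mult_ac)
  finally show ?thesis .
qed

text \<open>The test vector mixes \<open>e\<^sub>i\<close> into the projection of the fresh row onto the near-minimizers vanishing
  at \<open>i\<close>.\<close>

lemma lam_res_row_le:
  fixes x y :: "nat \<times> nat \<Rightarrow> real"
  assumes n: "n \<ge> 1" and i: "i \<in> {1..n}" and K: "K \<ge> 1"
    and es: "eigsys n x k u \<mu>" and \<mu>: "\<And>a. a < k \<Longrightarrow> \<mu> a \<le> lam n x + \<tau>" and \<tau>: "\<tau> \<ge> 0"
    and z: "\<And>a. a < K \<Longrightarrow> z a \<in> eig_span k u" "\<And>a. a < K \<Longrightarrow> z a i = 0" "orthonormal n K z"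
    and b: "b > 0" "b\<^sup>2 \<le> 3 / 4"
  shows "lam n (res (upper_indices n) (row_block n i) x y) \<le>
    lam n x - b\<^sup>2 * lam n x + \<tau> - b * sqrt (\<Sum>a<K. (mv n y (z a) i)\<^sup>2) + b\<^sup>2 * y (i, i)"
proof -
  define t where "t = (\<Sum>a<K. (mv n y (z a) i)\<^sup>2)"
  let ?x = "res (upper_indices n) (row_block n i) x y"
  have t0: "t \<ge> 0" unfolding t_def by (intro sum_nonneg) auto
  \<comment> \<open>The normalized projection of the fresh row onto the span of the
    \<open>z a\<close> has inner product \<open>sqrt t\<close> with that row. If the projection
    vanishes, any of the \<open>z a\<close> will do, and \<open>K \<ge> 1\<close> supplies
    one.\<close>
  obtain \<zeta> where \<zeta>: "\<zeta> \<in> eig_span k u" "ip n \<zeta> \<zeta> = 1" "\<zeta> i = 0" "mv n y \<zeta> i = sqrt t"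
  proof (cases "t = 0")
    case True
    then have "(mv n y (z 0) i)\<^sup>2 = 0"
      using K unfolding t_def by (subst (asm) sum_nonneg_eq_0_iff) auto
    then show thesis using K z True by (intro that[of "z 0"]) (auto simp: orthonormal_def)
  next
    case False
    then have pos: "t > 0" using t0 by simp
    define c where "c a = mv n y (z a) i / sqrt t" for a
    have c2: "(\<Sum>a<K. c a * c a) = 1"
    proof -
      have "(\<Sum>a<K. c a * c a) = (\<Sum>a<K. (mv n y (z a) i)\<^sup>2 / t)"
        using pos by (intro sum.cong refl) (simp add: c_def power2_eq_square)
      also have "\<dots> = t / t" unfolding sum_divide_distrib[symmetric] t_def[symmetric] ..
      finally
show ?thesis using pos by simp
    qed
    show thesis
    proof (rule that[of "\<lambda>j. \<Sum>a<K. c a * z a j"])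
      show "(\<lambda>j. \<Sum>a<K. c a * z a j) \<in> eig_span k u" by (rule eig_span_sum) (rule z)
      show "ip n (\<lambda>j. \<Sum>a<K. c a * z a j) (\<lambda>j. \<Sum>a<K. c a * z a j) = 1"
        unfolding ip_sum_orthonormal[OF z(3)] by (rule c2)
      show "(\<Sum>a<K. c a * z a i) = 0" using z(2) by simp
      have "mv n y (\<lambda>j. \<Sum>a<K. c a * z a j) i = (\<Sum>a<K. c a * mv n y (z a) i)" by (rule mv_sum)
      also have "\<dots> = t / sqrt t" by (simp add: c_def t_def sum_divide_distrib power2_eq_square)
      finally show "mv n y (\<lambda>j. \<Sum>a<K. c a * z a j) i = sqrt t" using t0 by (simp add: real_div_sqrt)
    qed
  qed
  \<comment> \<open>\<open>b^2 \<le> 3 / 4\<close> gives \<open>a \<ge> 1 / 2\<close>, so the cross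
    term \<open>2 * a * b * sqrt t\<close> is at least \<open>b * sqrt t\<close>. The minus sign in
    \<open>v\<close> makes it a decrease.\<close>
  define a where "a = sqrt (1 - b\<^sup>2)"
  have "(1 / 2)\<^sup>2 \<le> 1 - b\<^sup>2" using b(2) by (simp add: power_divide)
  then have a: "a\<^sup>2 = 1 - b\<^sup>2" "a \<ge> 1 / 2"
    using b(2) unfolding a_def by (simp, intro real_le_rsqrt)
  define v where "v = (\<lambda>j. a * \<zeta> j + (- b) * unitv i j)"
  have iz: "ip n \<zeta> (unitv i) = 0" "ip n (unitv i) \<zeta> = 0"
    using mv_unitv[OF i, of \<zeta>] \<zeta>(3) ip_commute by auto
  have "ip n v v = a\<^sup>2 + b\<^sup>2"
    using iz \<zeta>(2) mv_unitv[OF i, of "unitv i"] unfolding v_def ip_lin ip_lin'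
    by (simp add: power2_eq_square unitv_def[of i i])
  then have "ip n v v = 1" using a by simp
  then have "lam n ?x \<le> qf n ?x v" by (rule lam_le_unit[OF n])
  also have "\<dots> = a\<^sup>2 * qf n ?x \<zeta> - 2 * a * b * mv n ?x \<zeta> i + b\<^sup>2 * ?x (i, i)"
    unfolding v_def qf_lin mv_unitv[OF i] qf_unitv[OF i] by simp
  \<comment> \<open>\<open>\<zeta> i = 0\<close> makes every edge weight on the resampled row
    vanish: the form at \<open>\<zeta>\<close> does not notice the resampling.\<close>
  also have "qf n ?x \<zeta> = qf n x \<zeta>"
  proof -
    have "edge_weight \<zeta> e = 0" if "e \<in> row_block n i" for e
      using that \<zeta>(3) by (auto simp: edge_weight_def row_block_iff)
    then show ?thesis unfolding qf_res_row[OF i] by simp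
  qed
  also have "mv n ?x \<zeta> i = sqrt t"
  proof -
    have "mv n ?x \<zeta> i = mv n y \<zeta> i"
      unfolding mv_def using edge_in_row_block edge_in_upper[OF i]
      by (intro sum.cong refl) (auto simp: res_def)
    then show ?thesis using \<zeta>(4) by simp
  qed
  also have "?x (i, i) = y (i, i)"
    using i by (auto simp: res_def upper_indices_def row_block_iff)
  also have "a\<^sup>2 * qf n x \<zeta> \<le> a\<^sup>2 * (lam n x + \<tau>)"
    using eig_span_qf_le[OF es \<mu> \<zeta>(1)] \<zeta>(2) by (intro mult_left_mono) auto
  also have "a\<^sup>2 * (lam n x + \<tau>) \<le> lam n x - b\<^sup>2 * lam n x + \<tau>"
    unfolding a(1) using \<tau> by (simp add: algebra_simps)
  finally have "lam n ?x \<le> lam n x - b\<^sup>2 * lam n x + \<tau> - 2 * a * b * sqrt t + b\<^sup>2 * y (i, i)"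
    by simp
  moreover have "b * sqrt t \<le> 2 * a * b * sqrt t"
  proof -
    have "1 * (b * sqrt t) \<le> (2 * a) * (b * sqrt t)" using a b t0 by (intro mult_right_mono) auto
    then show ?thesis by simp
  qed
  ultimately show ?thesis unfolding t_def by linarith
qed

text \<open>Bounds a square root from below by a polynomial, so that its expectation is controlled
  by two moments. With \<open>s = sqrt (t / m)\<close> it follows from
  \<open>s * (s - 1)^2 * (s + 2) \<ge> 0\<close>.\<close>

lemma sqrt_ge_quadratic:
  assumes "m > 0" "t \<ge> 0"
  shows "sqrt m * (3 * (t / m) - (t / m)\<^sup>2) / 2 \<le> sqrt t"
proof -
  define s where "s = sqrt (t / m)"
  have s: "s \<ge> 0" "sqrt t = sqrt m * s" using assms by (auto simp: s_def real_sqrt_divide)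
  have s2: "t / m = s\<^sup>2" using assms by (simp add: s_def)
  have "0 \<le> s / 2 * ((s - 1)\<^sup>2 * (s + 2))" using s by (intro mult_nonneg_nonneg) auto
  then have "(3 * s\<^sup>2 - (s\<^sup>2)\<^sup>2) / 2 \<le> s" by (simp add: power2_eq_square algebra_simps)
  then have "sqrt m * ((3 * s\<^sup>2 - (s\<^sup>2)\<^sup>2) / 2) \<le> sqrt m * s" using assms by (intro mult_left_mono) auto
  then show ?thesis unfolding s s2 by simp
qed

section \<open>Expected effects of resampling one row\<close>

context wigner_input begin

lemma hb_pair_product:
  fixes f g :: "_ \<Rightarrow> real"
  assumes f: "integrable (mu n) f" and g: "integrable (mu n) g"
  shows "has_bochner_integral (mu2 n) (\<lambda>z. f (fst z) * g (snd z)) ((\<integral>x. f x \<partial>mu n) * (\<integral>x. g x \<partial>mu n))"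
proof -
  interpret mu: prob_space "mu n" by (rule prob_space_mu)
  interpret pr: pair_sigma_finite "mu n" "mu n" by (rule pair_sigma_finite_mu)
  have [measurable]: "f \<in> borel_measurable (mu n)" "g \<in> borel_measurable (mu n)" using f g by auto
  have pi: "integrable (mu2 n) (\<lambda>z. f (fst z) * g (snd z))"
    using f g by (intro pr.Fubini_integrable) (auto simp: abs_mult norm_mult intro!: integrable_mult_right)
  moreover have "(\<integral>z. f (fst z) * g (snd z) \<partial>mu2 n) = (\<integral>x. (\<integral>y. f x * g y \<partial>mu n) \<partial>mu n)"
    using pi by (subst pr.integral_fst'[symmetric]) auto
  ultimately show ?thesis by (simp add: has_bochner_integral_iff)
qed

text \<open>The kurtosis of the entry law, raised to at least 3 as \<open>sum_moments\<close>
  requires.\<close>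

definition fourth :: real where
  "fourth = max (\<integral>t. t ^ 4 \<partial>P) (3 * \<sigma> ^ 4) / \<sigma> ^ 4"

lemma fourth_pos: "fourth > 0"
proof -
  have "max (\<integral>t. t ^ 4 \<partial>P) (3 * \<sigma> ^ 4) > 0" using sigma_pos by (simp add: less_max_iff_disj)
  then show ?thesis unfolding fourth_def using sigma_pos by simp
qed

lemma row_linear_moments:
  assumes i: "i \<in> {1..n}" and v: "ip n v v = 1"
  shows "integrable (mu n) (\<lambda>y. mv n y v i ^ k)"
    and "(\<integral>y. (mv n y v i)\<^sup>2 \<partial>mu n) = \<sigma>\<^sup>2"
    and "(\<integral>y. mv n y v i ^ 4 \<partial>mu n) \<le> fourth * \<sigma> ^ 4"
proof -
  let ?D = "max (\<integral>t. t ^ 4 \<partial>P) (3 * \<sigma> ^ 4)"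
  have eq: "mv n y v i = (\<Sum>j\<in>{1..n}. v j * y (edge i j))" for y
    by (simp add: mv_def mult.commute)
  have s: "(\<Sum>j\<in>{1..n}. (v j)\<^sup>2) = 1" using v by (simp add: ip_def power2_eq_square)
  have D: "fourth * \<sigma> ^ 4 = ?D" using sigma_pos by (simp add: fourth_def)
  have "(\<forall>k. integrable (mu n) (\<lambda>y. mv n y v i ^ k)) \<and> (\<integral>y. mv n y v i \<partial>mu n) = 0 \<and>
    (\<integral>y. (mv n y v i)\<^sup>2 \<partial>mu n) = \<sigma>\<^sup>2 * (\<Sum>j\<in>{1..n}. (v j)\<^sup>2) \<and>
    (\<integral>y. mv n y v i ^ 4 \<partial>mu n) \<le> ?D * (\<Sum>j\<in>{1..n}. (v j)\<^sup>2)\<^sup>2"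
    unfolding eq
  proof (rule sum_moments[where \<phi> = "edge i" and g = "\<lambda>t. t" and c = v])
    show "edge i ` {1..n} \<subseteq> upper_indices n" using edge_in_upper[OF i] by blast
  qed (use integrable_pow mean_zero second_moment in \<open>auto intro: edge_inj simp: power_mult[symmetric]\<close>)
  then show "integrable (mu n) (\<lambda>y. mv n y v i ^ k)" "(\<integral>y. (mv n y v i)\<^sup>2 \<partial>mu n) = \<sigma>\<^sup>2"
    "(\<integral>y. mv n y v i ^ 4 \<partial>mu n) \<le> fourth * \<sigma> ^ 4"
    unfolding s D by simp_all
qed

definition resample_mean :: "nat \<Rightarrow> nat \<Rightarrow> (nat \<times> nat \<Rightarrow> real) \<Rightarrow> real" where
  "resample_mean n i x = (\<integral>y. lam n (rs n (row_block n i) x y) \<partial>mu n)"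

lemma integrable_lam_rs:
  assumes n: "n \<ge> 1" and x: "x \<in> space (mu n)"
  shows "integrable (mu n) (\<lambda>y. lam n (rs n J x y))"
proof (rule Bochner_Integration.integrable_bound)
  interpret mu: prob_space "mu n" by (rule prob_space_mu)
  show "integrable (mu n) (\<lambda>y. \<Sum>e\<in>upper_indices n. 2 * (\<bar>x e\<bar> + \<bar>y e\<bar>))"
    by (intro Bochner_Integration.integrable_sum integrable_mult_right Bochner_Integration.integrable_add
        integrable_abs integrable_coord) auto
  have "(\<lambda>z. rs n J (fst z) (snd z)) \<circ> Pair x \<in> mu n \<rightarrow>\<^sub>M mu n"
    using x by (intro measurable_comp[OF measurable_Pair1'] measurable_rs) auto
  then have "(\<lambda>y. rs n J x y) \<in> mu n \<rightarrow>\<^sub>M mu n" by (simp add: comp_def)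
  then show "(\<lambda>y. lam n (rs n J x y)) \<in> borel_measurable (mu n)"
    by (rule measurable_compose[OF _ measurable_lam[OF n]])
  have "\<bar>lam n (rs n J x y)\<bar> \<le> (\<Sum>e\<in>upper_indices n. 2 * (\<bar>x e\<bar> + \<bar>y e\<bar>))" for y
    by (rule order_trans[OF abs_lam_le[OF n]]) (intro sum_mono, auto simp: res_def)
  then show "AE y in mu n. norm (lam n (rs n J x y)) \<le> norm (\<Sum>e\<in>upper_indices n. 2 * (\<bar>x e\<bar> + \<bar>y e\<bar>))"
    by (intro AE_I2) (smt (verit) real_norm_def)
qed

text \<open>Of \<open>Suc K\<close> dimensions one is spent on vanishing at \<open>i\<close>. The
  squared projection \<open>t\<close> of the fresh row has mean \<open>K * \<sigma>^2\<close> and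
  second moment at most \<open>fourth * (K * \<sigma>^2)^2\<close>, which keeps the mean of
  \<open>sqrt t\<close> of order \<open>\<sigma> * sqrt K\<close>.\<close>

lemma resample_mean_gain:
  assumes n: "n \<ge> 1" and x: "x \<in> space (mu n)" and i: "i \<in> {1..n}" and K: "K \<ge> 1"
    and es: "eigsys n x (Suc K) u \<mu>" and \<mu>: "\<And>a. a < Suc K \<Longrightarrow> \<mu> a \<le> lam n x + \<tau>" and \<tau>: "\<tau> \<ge> 0"
    and b: "b > 0" "b\<^sup>2 \<le> 3 / 4" and \<Lambda>: "\<bar>lam n x\<bar> \<le> \<Lambda>"
  shows "resample_mean n i x \<le> lam n x + b\<^sup>2 * \<Lambda> + \<tau> - b * (\<sigma> * sqrt (real K / fourth))"
proof -
  have on: "orthonormal n (Suc K) u" using es by (auto simp: eigsys_def orthonormal_def)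
  have "\<exists>z. (\<forall>a<K. z a \<in> eig_span (Suc K) u \<and> z a i = 0) \<and> orthonormal n K z"
    by (rule orthonormal_rotate[OF eig_span_closed _ on]) (auto intro: eig_span_base)
  then obtain z where z: "\<And>a. a < K \<Longrightarrow> z a \<in> eig_span (Suc K) u" "\<And>a. a < K \<Longrightarrow> z a i = 0" "orthonormal n K z"
    by auto
  have z1: "ip n (z a) (z a) = 1" if "a < K" for a using z(3) that by (simp add: orthonormal_def)
  define t where "t y = (\<Sum>a<K. (mv n y (z a) i)\<^sup>2)" for y
  interpret mu: prob_space "mu n" by (rule prob_space_mu)
  note rm = row_linear_moments[OF i z1]
  \<comment> \<open>At this scale \<open>t / m\<close> has mean \<open>1 / fourth\<close> and second
    moment at most \<open>1 / fourth\<close>, so the polynomial bound yields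
    \<open>sqrt m / fourth\<close>, that is \<open>\<sigma> * sqrt (K / fourth)\<close>.\<close>
  define m where "m = fourth * real K * \<sigma>\<^sup>2"
  have m: "m > 0" using fourth_pos K sigma_pos by (simp add: m_def)
  have hb_t: "has_bochner_integral (mu n) t (real K * \<sigma>\<^sup>2)"
  proof -
    have "has_bochner_integral (mu n) t (\<Sum>a<K. \<sigma>\<^sup>2)"
      unfolding t_def by (intro has_bochner_integral_sum) (use rm(1)[of _ 2] rm(2) in \<open>auto simp: has_bochner_integral_iff\<close>)
    then show ?thesis by simp
  qed
  have t2_le: "(t y)\<^sup>2 \<le> real K * (\<Sum>a<K. mv n y (z a) i ^ 4)" for y
    using Cauchy_Schwarz_ineq_sum[of "\<lambda>_. 1" "\<lambda>a. (mv n y (z a) i)\<^sup>2" "{..<K}"]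
    by (simp add: t_def power_mult[symmetric])
  have int4: "integrable (mu n) (\<lambda>y. real K * (\<Sum>a<K. mv n y (z a) i ^ 4))"
    by (intro integrable_mult_right Bochner_Integration.integrable_sum rm(1)) auto
  have int_t2: "integrable (mu n) (\<lambda>y. (t y)\<^sup>2)"
  proof (rule Bochner_Integration.integrable_bound[OF int4])
    show "(\<lambda>y. (t y)\<^sup>2) \<in> borel_measurable (mu n)"
      using hb_t by (intro borel_measurable_power) (auto simp: has_bochner_integral_iff)
    show "AE y in mu n. norm ((t y)\<^sup>2) \<le> norm (real K * (\<Sum>a<K. mv n y (z a) i ^ 4))"
      by (intro AE_I2) (use t2_le in \<open>auto intro: order_trans[OF _ abs_ge_self]\<close>)
  qed
  have Et2: "(\<integral>y. (t y)\<^sup>2 \<partial>mu n) \<le> (real K)\<^sup>2 * (fourth * \<sigma> ^ 4)"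
  proof -
    have "(\<integral>y. (t y)\<^sup>2 \<partial>mu n) \<le> (\<integral>y. real K * (\<Sum>a<K. mv n y (z a) i ^ 4) \<partial>mu n)"
      by (intro integral_mono int_t2 int4 t2_le)
    also have "\<dots> = real K * (\<Sum>a<K. \<integral>y. mv n y (z a) i ^ 4 \<partial>mu n)"
      using rm(1) by simp
    also have "\<dots> \<le> real K * (\<Sum>a<K. fourth * \<sigma> ^ 4)"
      by (intro mult_left_mono sum_mono rm(3)) auto
    finally show ?thesis by (simp add: power2_eq_square)
  qed
  define lb where "lb y = sqrt m * (3 * (t y / m) - (t y / m)\<^sup>2) / 2" for y
  have hb_lb: "has_bochner_integral (mu n) lb (sqrt m * (3 * (real K * \<sigma>\<^sup>2 / m) - (\<integral>y. (t y)\<^sup>2 \<partial>mu n) / m\<^sup>2) / 2)"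
    unfolding lb_def power_divide
    by (intro has_bochner_integral_divide_zero has_bochner_integral_mult_right has_bochner_integral_diff hb_t)
       (use int_t2 in \<open>simp add: has_bochner_integral_iff\<close>)
  have lb_ge: "\<sigma> * sqrt (real K / fourth) \<le> (\<integral>y. lb y \<partial>mu n)"
  proof -
    have e1: "real K * \<sigma>\<^sup>2 / m = 1 / fourth"
      using K sigma_pos by (simp add: m_def)
    have "(\<integral>y. (t y)\<^sup>2 \<partial>mu n) / m\<^sup>2 \<le> ((real K)\<^sup>2 * (fourth * \<sigma> ^ 4)) / m\<^sup>2"
      by (intro divide_right_mono Et2) auto
    also have "\<dots> = 1 / fourth"
      using K sigma_pos fourth_pos by (simp add: m_def power_mult_distrib power_mult[symmetric] power2_eq_square[of fourth])
    finally have "sqrt m * (3 * (1 / fourth) - 1 / fourth) / 2 \<le> (\<integral>y. lb y \<partial>mu n)"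
      unfolding has_bochner_integral_integral_eq[OF hb_lb] e1
      using m by (intro divide_right_mono mult_left_mono diff_left_mono) auto
    moreover have "sqrt m * (3 * (1 / fourth) - 1 / fourth) / 2 = sqrt m / fourth" by simp
    moreover have "sqrt m / fourth = \<sigma> * sqrt (real K / fourth)"
    proof -
      have "sqrt m = sqrt fourth * sqrt (real K) * \<sigma>"
        using sigma_pos by (simp add: m_def real_sqrt_mult)
      moreover have "sqrt fourth / fourth = 1 / sqrt fourth"
        using fourth_pos by (simp add: sqrt_divide_self_eq inverse_eq_divide)
      ultimately show ?thesis by (simp add: real_sqrt_divide mult_ac) (metis times_divide_eq_left mult.commute mult_1)
    qed
    ultimately show ?thesis by simp
  qed
  have ii: "(i, i) \<in> upper_indices n" using i by (auto simp: upper_indices_def)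
  have le: "lam n (rs n (row_block n i) x y) \<le> (lam n x + b\<^sup>2 * \<Lambda> + \<tau>) - b * lb y + b\<^sup>2 * y (i, i)" for y
  proof -
    have "t y \<ge> 0" unfolding t_def by (intro sum_nonneg) auto
    then have "lb y \<le> sqrt (t y)" unfolding lb_def by (rule sqrt_ge_quadratic[OF m])
    then have "b * lb y \<le> b * sqrt (t y)" using b by (intro mult_left_mono) auto
    moreover have "b\<^sup>2 * - lam n x \<le> b\<^sup>2 * \<Lambda>" using \<Lambda> by (intro mult_left_mono) auto
    ultimately show ?thesis
      using lam_res_row_le[OF n i K es \<mu> \<tau> z b, of y] unfolding t_def by simp
  qed
  have hb_r: "has_bochner_integral (mu n) (\<lambda>y. (lam n x + b\<^sup>2 * \<Lambda> + \<tau>) - b * lb y + b\<^sup>2 * y (i, i))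
     ((lam n x + b\<^sup>2 * \<Lambda> + \<tau>) - b * (\<integral>y. lb y \<partial>mu n) + b\<^sup>2 * 0)"
    using hb_lb integrable_coord[OF ii] integral_coord[OF ii] mu.prob_space
    by (intro has_bochner_integral_add has_bochner_integral_diff has_bochner_integral_mult_right)
       (auto simp: has_bochner_integral_iff)
  have "resample_mean n i x \<le> (\<integral>y. (lam n x + b\<^sup>2 * \<Lambda> + \<tau>) - b * lb y + b\<^sup>2 * y (i, i) \<partial>mu n)"
    unfolding resample_mean_def
    by (intro integral_mono integrable_lam_rs n x le) (use hb_r in \<open>simp add: has_bochner_integral_iff\<close>)
  also have "\<dots> = (lam n x + b\<^sup>2 * \<Lambda> + \<tau>) - b * (\<integral>y. lb y \<partial>mu n)"
    using has_bochner_integral_integral_eq[OF hb_r] by simp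
  also have "\<dots> \<le> (lam n x + b\<^sup>2 * \<Lambda> + \<tau>) - b * (\<sigma> * sqrt (real K / fourth))"
    using lb_ge b by (intro diff_left_mono mult_left_mono) auto
  finally show ?thesis .
qed

lemma expected_defect_bound:
  "\<exists>C>0. \<forall>n\<ge>1. integrable (mu n) (defect_bound n) \<and> (\<integral>x. defect_bound n x \<partial>mu n) \<le> C * sqrt (real n)"
proof -
  obtain C where C: "C > 0" "\<And>n. n \<ge> 1 \<Longrightarrow> (\<integral>x. \<bar>lam n x\<bar> \<partial>mu n) \<le> C * sqrt (real n)"
    using expected_abs_lam by blast
  have "integrable (mu n) (defect_bound n) \<and> (\<integral>x. defect_bound n x \<partial>mu n) \<le> (2 * C + 1 + \<sigma>\<^sup>2) * sqrt (real n)"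
    if n: "n \<ge> 1" for n
  proof -
    interpret mu: prob_space "mu n" by (rule prob_space_mu)
    have hb2: "has_bochner_integral (mu n) (\<lambda>x. (x (i, i))\<^sup>2) (\<sigma>\<^sup>2)" if "i \<in> {1..n}" for i
      using coord_pow[of "(i, i)" n 2] that second_moment by (auto simp: has_bochner_integral_iff upper_indices_def)
    have hb: "has_bochner_integral (mu n) (defect_bound n)
      (2 * (\<integral>x. \<bar>lam n x\<bar> \<partial>mu n) + sqrt (real n) + (\<Sum>i\<in>{1..n}. \<sigma>\<^sup>2) / sqrt (real n))"
      unfolding defect_bound_def
      by (intro has_bochner_integral_add has_bochner_integral_mult_right has_bochner_integral_divide_zero
          has_bochner_integral_sum hb2)
         (use integrable_lam[OF n] mu.prob_space in \<open>auto simp: has_bochner_integral_iff\<close>)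
    have "(\<Sum>i\<in>{1..n}. \<sigma>\<^sup>2) / sqrt (real n) = \<sigma>\<^sup>2 * sqrt (real n)"
    proof -
      have "(\<Sum>i\<in>{1..n}. \<sigma>\<^sup>2) / sqrt (real n) = \<sigma>\<^sup>2 * (real n / sqrt (real n))" by simp
      then show ?thesis by (simp add: real_div_sqrt)
    qed
    with hb C(2)[OF n] show ?thesis
      by (simp add: has_bochner_integral_iff algebra_simps)
  qed
  then show ?thesis using C(1) by (intro exI[of _ "2 * C + 1 + \<sigma>\<^sup>2"]) (auto intro: add_pos_nonneg)
qed

text \<open>A minimizer for the old input remains a competitor after the resampling, and the fresh
  entries average out.\<close>

lemma resample_mean_le:
  assumes n: "n \<ge> 1" and x: "x \<in> space (mu n)" and i: "i \<in> {1..n}" and v: "minimizer n x v"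
  shows "resample_mean n i x - lam n x \<le> - (\<Sum>e\<in>row_block n i. x e * edge_weight v e)"
proof -
  interpret mu: prob_space "mu n" by (rule prob_space_mu)
  have hb: "has_bochner_integral (mu n) (\<lambda>y. lam n x + (\<Sum>e\<in>row_block n i. (y e - x e) * edge_weight v e))
      (lam n x + (\<Sum>e\<in>row_block n i. (0 - x e) * edge_weight v e))"
    using row_block_subset[OF i]
    by (intro has_bochner_integral_add has_bochner_integral_sum has_bochner_integral_mult_left has_bochner_integral_diff)
       (auto simp: has_bochner_integral_iff mu.prob_space intro: integrable_coord integral_coord)
  have "resample_mean n i x \<le> (\<integral>y. lam n x + (\<Sum>e\<in>row_block n i. (y e - x e) * edge_weight v e) \<partial>mu n)"
    unfolding resample_mean_def
  proof (intro integral_mono integrable_lam_rs n x)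
    show "integrable (mu n) (\<lambda>y. lam n x + (\<Sum>e\<in>row_block n i. (y e - x e) * edge_weight v e))"
      using hb by (simp add: has_bochner_integral_iff)
    fix y
    show "lam n (rs n (row_block n i) x y) \<le> lam n x + (\<Sum>e\<in>row_block n i. (y e - x e) * edge_weight v e)"
      using lam_le_unit[OF n, of v] v unfolding minimizer_def by (metis qf_res_row[OF i])
  qed
  then show ?thesis
    unfolding has_bochner_integral_integral_eq[OF hb] by (simp add: sum_negf)
qed

lemma resample_mean_integral:
  assumes n: "n \<ge> 1" and i: "i \<in> {1..n}"
  shows "integrable (mu n) (resample_mean n i)" "(\<integral>x. resample_mean n i x \<partial>mu n) = (\<integral>x. lam n x \<partial>mu n)"
proof -
  interpret mu: prob_space "mu n" by (rule prob_space_mu)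
  interpret pr: pair_sigma_finite "mu n" "mu n" by (rule pair_sigma_finite_mu)
  have int: "integrable (mu2 n) (\<lambda>z. lam n (rs n (row_block n i) (fst z) (snd z)))"
    unfolding fst_integral(5)[OF measurable_lam[OF n]] by (rule integrable_lam[OF n])
  then show "integrable (mu n) (resample_mean n i)"
    using pr.integrable_fst'[OF int] by (simp add: resample_mean_def[abs_def])
  show "(\<integral>x. resample_mean n i x \<partial>mu n) = (\<integral>x. lam n x \<partial>mu n)"
    using pr.integral_fst'[OF int] fst_integral(6)[OF measurable_lam[OF n], of "row_block n i"]
    by (simp add: resample_mean_def)
qed

text \<open>Since resampling a row does not change the law, the nonnegative random variable
  \<open>defect_bound n x - (\<Sum>i. resample_mean n i x - lam n x)\<close> has the expectation of \<open>defect_bound\<close>; it is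
  large when many eigenvalues are close to the smallest one.\<close>

lemma prob_many_eigenvalues:
  assumes n: "n \<ge> 1" and C: "(\<integral>x. defect_bound n x \<partial>mu n) \<le> C" "integrable (mu n) (defect_bound n)" and \<Gamma>: "\<Gamma> > 0"
    and B: "\<And>x. x \<in> space (mu n) \<Longrightarrow> x \<in> B \<Longrightarrow> (\<Sum>i\<in>{1..n}. resample_mean n i x - lam n x) \<le> - \<Gamma>"
  shows "\<exists>A\<in>sets (mu n). B \<inter> space (mu n) \<subseteq> A \<and> measure (mu n) A \<le> C / \<Gamma>"
proof -
  interpret mu: prob_space "mu n" by (rule prob_space_mu)
  define W where "W x = defect_bound n x - (\<Sum>i\<in>{1..n}. resample_mean n i x - lam n x)" for x
  have W0: "W x \<ge> 0" if "x \<in> space (mu n)" for x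
  proof -
    let ?v = "min_eigenvector n x"
    note v = ex_minimizer_lam[OF n, of x]
    have "(\<Sum>i\<in>{1..n}. resample_mean n i x - lam n x) \<le> (\<Sum>i\<in>{1..n}. - (\<Sum>e\<in>row_block n i. x e * edge_weight ?v e))"
      by (intro sum_mono resample_mean_le[OF n that _ v])
    also have "\<dots> \<le> defect_bound n x" unfolding sum_negf by (rule row_removal_le_defect_bound[OF n v])
    finally show ?thesis by (simp add: W_def)
  qed
  have hb: "has_bochner_integral (mu n) W ((\<integral>x. defect_bound n x \<partial>mu n) - (\<Sum>i\<in>{1..n}. (\<integral>x. lam n x \<partial>mu n) - (\<integral>x. lam n x \<partial>mu n)))"
    unfolding W_def
    by (intro has_bochner_integral_diff has_bochner_integral_sum)
       (use C resample_mean_integral[OF n] integrable_lam[OF n] in \<open>auto simp: has_bochner_integral_iff\<close>)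
  have intW: "integrable (mu n) W" "(\<integral>x. W x \<partial>mu n) \<le> C"
    using hb C by (auto simp: has_bochner_integral_iff)
  have [measurable]: "W \<in> borel_measurable (mu n)" using intW by auto
  \<comment> \<open>\<open>B\<close> itself need not be measurable; this level set is its measurable
    cover.\<close>
  let ?A = "{x \<in> space (mu n). W x \<ge> \<Gamma>}"
  have "measure (mu n) ?A \<le> (\<integral>x. W x \<partial>mu n) / \<Gamma>"
    by (rule integral_Markov_inequality_measure[OF intW(1), of "{}"]) (use W0 \<Gamma> in auto)
  also have "\<dots> \<le> C / \<Gamma>" using intW(2) \<Gamma> by (intro divide_right_mono) auto
  finally have "measure (mu n) ?A \<le> C / \<Gamma>" .
  moreover have "B \<inter> space (mu n) \<subseteq> ?A"
  proof
    fix x assume x: "x \<in> B \<inter> space (mu n)"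
    let ?v = "min_eigenvector n x"
    have "0 \<le> defect_bound n x" unfolding defect_bound_def by (intro add_nonneg_nonneg divide_nonneg_nonneg sum_nonneg) auto
    then show "x \<in> ?A" using B[of x] x by (auto simp: W_def)
  qed
  ultimately show ?thesis by (intro bexI[of _ ?A]) auto
qed

text \<open>For a minimizer \<open>v\<close> of the first input this is almost surely the form of
  the resampled input at \<open>v\<close> minus its smallest eigenvalue. The slopes replace the edge
  weights of \<open>v\<close> for the sake of measurability.\<close>

definition excess :: "nat \<Rightarrow> nat \<Rightarrow> (nat \<times> nat \<Rightarrow> real) \<times> (nat \<times> nat \<Rightarrow> real) \<Rightarrow> real" where
  "excess n i z = lam n (fst z) + (\<Sum>e\<in>row_block n i. (snd z e - fst z e) * line_slope_right n e (fst z))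
     - lam n (rs n (row_block n i) (fst z) (snd z))"

lemma integrable_coord_slope:
  assumes n: "n \<ge> 1" and e: "e \<in> upper_indices n"
  shows "integrable (mu n) (line_slope_right n e)" "integrable (mu n) (\<lambda>x. x e * line_slope_right n e x)"
proof -
  interpret mu: prob_space "mu n" by (rule prob_space_mu)
  note [measurable] = measurable_line_slope[OF n e] measurable_coord[OF e]
  have b: "\<bar>line_slope_right n e x\<bar> \<le> 2" for x by (rule line_slope_bounds(3)[OF n e ex_minimizer_lam[OF n]])
  show "integrable (mu n) (line_slope_right n e)"
    by (rule mu.integrable_const_bound[where B = 2]) (use b in auto)
  show "integrable (mu n) (\<lambda>x. x e * line_slope_right n e x)"
  proof (rule Bochner_Integration.integrable_bound)
    show "integrable (mu n) (\<lambda>x. 2 * \<bar>x e\<bar>)" using integrable_coord[OF e] by auto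
    show "AE x in mu n. norm (x e * line_slope_right n e x) \<le> norm (2 * \<bar>x e\<bar>)"
      using b by (intro AE_I2) (auto simp: abs_mult mult.commute[of "\<bar>_ e\<bar>"] intro: mult_right_mono)
  qed measurable
qed

text \<open>The two \<open>lam\<close> terms have equal expectation, and a fresh entry has mean zero
  and is independent of the slopes. What remains is the expected removal of all rows, which
  \<open>defect_bound\<close> dominates almost surely.\<close>

lemma expected_excess:
  assumes n: "n \<ge> 1"
  shows "\<And>i. i \<in> {1..n} \<Longrightarrow> integrable (mu2 n) (excess n i)"
    and "integrable (mu n) (defect_bound n) \<Longrightarrow>
      (\<Sum>i\<in>{1..n}. \<integral>z. excess n i z \<partial>mu2 n) \<le> (\<integral>x. defect_bound n x \<partial>mu n)"
proof -
  interpret mu: prob_space "mu n" by (rule prob_space_mu)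
  let ?s = "line_slope_right n"
  have hb: "has_bochner_integral (mu2 n) (excess n i) (- (\<Sum>e\<in>row_block n i. \<integral>x. x e * ?s e x \<partial>mu n))"
    if i: "i \<in> {1..n}" for i
  proof -
    have sub: "e \<in> upper_indices n" if "e \<in> row_block n i" for e using row_block_subset[OF i] that by auto
    have h1: "has_bochner_integral (mu2 n) (\<lambda>z. lam n (fst z)) (\<integral>x. lam n x \<partial>mu n)"
      "has_bochner_integral (mu2 n) (\<lambda>z. lam n (rs n (row_block n i) (fst z) (snd z))) (\<integral>x. lam n x \<partial>mu n)"
      using fst_integral[OF measurable_lam[OF n]] integrable_lam[OF n] by (auto simp: has_bochner_integral_iff)
    have h2: "has_bochner_integral (mu2 n) (\<lambda>z. (snd z e - fst z e) * ?s e (fst z)) (0 - (\<integral>x. x e * ?s e x \<partial>mu n))"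
      if e: "e \<in> row_block n i" for e
    proof -
      note e' = sub[OF e]
      have "has_bochner_integral (mu2 n) (\<lambda>z. ?s e (fst z) * snd z e) ((\<integral>x. ?s e x \<partial>mu n) * (\<integral>y. y e \<partial>mu n))"
        by (rule hb_pair_product[OF integrable_coord_slope(1)[OF n e'] integrable_coord[OF e']])
      then have a: "has_bochner_integral (mu2 n) (\<lambda>z. ?s e (fst z) * snd z e) 0"
        using integral_coord[OF e'] by simp
      have b: "has_bochner_integral (mu2 n) (\<lambda>z. fst z e * ?s e (fst z)) (\<integral>x. x e * ?s e x \<partial>mu n)"
        using fst_integral(1,2)[of "\<lambda>x. x e * ?s e x" n] integrable_coord_slope(2)[OF n e']
        by (auto simp: has_bochner_integral_iff dest: borel_measurable_integrable)
      show ?thesis using has_bochner_integral_diff[OF a b] by (simp add: algebra_simps)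
    qed
    have "has_bochner_integral (mu2 n) (excess n i) ((\<integral>x. lam n x \<partial>mu n) +
        (\<Sum>e\<in>row_block n i. 0 - (\<integral>x. x e * ?s e x \<partial>mu n)) - (\<integral>x. lam n x \<partial>mu n))"
      unfolding excess_def by (intro has_bochner_integral_diff has_bochner_integral_add has_bochner_integral_sum h1 h2)
    then show ?thesis by (simp add: sum_negf)
  qed
  show "integrable (mu2 n) (excess n i)" if "i \<in> {1..n}" for i
    using hb[OF that] by (simp add: has_bochner_integral_iff)
  assume intd: "integrable (mu n) (defect_bound n)"
  have int: "integrable (mu n) (\<lambda>x. x e * ?s e x)" if "i \<in> {1..n}" "e \<in> row_block n i" for i e
    using row_block_subset[OF that(1)] that(2) by (intro integrable_coord_slope(2) n) auto
  have "(\<Sum>i\<in>{1..n}. \<integral>z. excess n i z \<partial>mu2 n) = (\<Sum>i\<in>{1..n}. - (\<Sum>e\<in>row_block n i. \<integral>x. x e * ?s e x \<partial>mu n))"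
    by (intro sum.cong refl has_bochner_integral_integral_eq hb)
  also have "\<dots> = (\<integral>x. - (\<Sum>i\<in>{1..n}. \<Sum>e\<in>row_block n i. x e * ?s e x) \<partial>mu n)"
  proof -
    have "(\<integral>x. (\<Sum>i\<in>{1..n}. \<Sum>e\<in>row_block n i. x e * ?s e x) \<partial>mu n) = (\<Sum>i\<in>{1..n}. \<Sum>e\<in>row_block n i. \<integral>x. x e * ?s e x \<partial>mu n)"
      by (intro has_bochner_integral_integral_eq has_bochner_integral_sum)
         (use int in \<open>simp add: has_bochner_integral_iff\<close>)
    then show ?thesis by (simp add: sum_negf)
  qed
  also have "\<dots> \<le> (\<integral>x. defect_bound n x \<partial>mu n)"
  proof (rule integral_mono_AE)
    show "integrable (mu n) (\<lambda>x. - (\<Sum>i\<in>{1..n}. \<Sum>e\<in>row_block n i. x e * ?s e x))"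
      by (intro Bochner_Integration.integrable_minus Bochner_Integration.integrable_sum int)
    show "AE x in mu n. - (\<Sum>i\<in>{1..n}. \<Sum>e\<in>row_block n i. x e * ?s e x) \<le> defect_bound n x"
      using AE_edge_weight_eq[OF n]
    proof eventually_elim
      case (elim x)
      let ?v = "min_eigenvector n x"
      note v = ex_minimizer_lam[OF n, of x]
      have "(\<Sum>i\<in>{1..n}. \<Sum>e\<in>row_block n i. x e * ?s e x) = (\<Sum>i\<in>{1..n}. \<Sum>e\<in>row_block n i. x e * edge_weight ?v e)"
        using elim v row_block_subset by (intro sum.cong refl) (metis subsetD)
      then show ?case using row_removal_le_defect_bound[OF n v] by simp
    qed
  qed (rule intd)
  finally show "(\<Sum>i\<in>{1..n}. \<integral>z. excess n i z \<partial>mu2 n) \<le> (\<integral>x. defect_bound n x \<partial>mu n)" .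
qed

text \<open>Holds for all minimizers at once, so it can be applied to a vector obtained by an
  arbitrary choice.\<close>

lemma AE_excess:
  assumes n: "n \<ge> 1"
  shows "AE z in mu2 n. \<forall>i\<in>{1..n}. \<forall>v. minimizer n (fst z) v \<longrightarrow>
     excess n i z = qf n (rs n (row_block n i) (fst z) (snd z)) v - lam n (rs n (row_block n i) (fst z) (snd z))"
proof -
  have "AE x in distr (mu2 n) (mu n) fst. \<forall>e\<in>upper_indices n. \<forall>v. minimizer n x v \<longrightarrow> edge_weight v e = line_slope_right n e x"
    unfolding distr_fst_mu2 by (rule AE_edge_weight_eq[OF n])
  then have "AE z in mu2 n. \<forall>e\<in>upper_indices n. \<forall>v. minimizer n (fst z) v \<longrightarrow> edge_weight v e = line_slope_right n e (fst z)"
    by (rule AE_distrD[OF measurable_fst])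
  then show ?thesis
  proof eventually_elim
    case (elim z)
    show ?case
    proof (intro ballI allI impI)
      fix i v assume i: "i \<in> {1..n}" and v: "minimizer n (fst z) v"
      have "(\<Sum>e\<in>row_block n i. (snd z e - fst z e) * line_slope_right n e (fst z)) =
        (\<Sum>e\<in>row_block n i. (snd z e - fst z e) * edge_weight v e)"
        using elim v row_block_subset[OF i] by (intro sum.cong refl) (metis subsetD)
      then show "excess n i z = qf n (rs n (row_block n i) (fst z) (snd z)) v - lam n (rs n (row_block n i) (fst z) (snd z))"
        unfolding excess_def qf_res_row[OF i] using v by (simp add: minimizer_def)
    qed
  qed
qed

end

section \<open>Stability\<close>

lemma packing_number_le:
  assumes "\<And>S. S \<subseteq> T \<Longrightarrow> finite S \<Longrightarrow> pairwise (\<lambda>x y. d x y > \<epsilon>) S \<Longrightarrow> card S \<le> N"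
  shows "packing_number T d \<epsilon> \<le> enat N"
  unfolding packing_number_def by (intro SUP_least) (use assms in auto)

text \<open>Markov's inequality for counting: at most \<open>c\<close> indices exceed
  \<open>\<eta>\<close>.\<close>

lemma card_large_values:
  fixes f :: "nat \<Rightarrow> real"
  assumes f: "\<And>i. i \<in> V \<Longrightarrow> 0 \<le> f i" and V: "finite V" and s: "(\<Sum>i\<in>V. f i) \<le> \<eta> * c" and \<eta>: "\<eta> > 0"
  shows "real (card {i \<in> V. f i \<le> \<eta>}) \<ge> real (card V) - c"
proof -
  let ?H = "{i \<in> V. \<not> f i \<le> \<eta>}"
  have "\<eta> * real (card ?H) = (\<Sum>i\<in>?H. \<eta>)" by simp
  also have "\<dots> \<le> (\<Sum>i\<in>?H. f i)" by (intro sum_mono) auto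
  also have "\<dots> \<le> (\<Sum>i\<in>V. f i)" using f V by (intro sum_mono2) auto
  finally have "\<eta> * real (card ?H) \<le> \<eta> * c" using s by linarith
  then have "real (card ?H) \<le> c" using \<eta> by simp
  moreover have "card V = card {i \<in> V. f i \<le> \<eta>} + card ?H"
    using V by (subst card_Un_disjoint[symmetric]) (auto intro: arg_cong[where f = card])
  ultimately show ?thesis by simp
qed

context wigner_input begin

lemma rs_swap_back:
  assumes "x \<in> space (mu n)"
  shows "rs n J (rs n J x y) (rs n J y x) = x"
  using assms by (auto simp: res_def mu_def space_PiM PiE_def extensional_def fun_eq_iff)

text \<open>The bad event is covered by a null set and three events of probability at most
  \<open>\<delta> / 4\<close> each: large total excess, large \<open>|lam|\<close>, and a measurable
  cover of the event of more than \<open>K\<close> eigenvalues near the smallest one at moderate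
  \<open>|lam|\<close>. Only the law of each single pair of \<open>RX\<close> and
  \<open>RY i\<close> enters, through the expectation of a sum over \<open>i\<close>.\<close>

lemma stability_event:
  fixes \<Omega> :: "'w measure" and RX :: "'w \<Rightarrow> nat \<times> nat \<Rightarrow> real" and RY :: "nat \<Rightarrow> 'w \<Rightarrow> nat \<times> nat \<Rightarrow> real"
  assumes n: "n \<ge> 2" and \<Omega>: "prob_space \<Omega>"
    and RX [measurable]: "RX \<in> \<Omega> \<rightarrow>\<^sub>M mu n"
    and RY [measurable]: "\<And>i. i \<in> {1..n} \<Longrightarrow> RY i \<in> \<Omega> \<rightarrow>\<^sub>M mu n"
    and law: "\<And>i. i \<in> {1..n} \<Longrightarrow> distr \<Omega> (mu2 n) (\<lambda>\<omega>. (RX \<omega>, RY i \<omega>)) = mu2 n"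
    and C: "C > 0" "integrable (mu n) (defect_bound n)" "(\<integral>x. defect_bound n x \<partial>mu n) \<le> C * sqrt (real n)"
    and \<epsilon>: "\<epsilon> > 0" and \<delta>: "\<delta> > 0"
    and K: "K \<ge> 1" "8 * C / \<delta> + 128 * C / (\<delta> * \<epsilon> ^ 3) \<le> \<sigma> * sqrt (real K / fourth)"
  shows "outer_measure_of \<Omega> {\<omega> \<in> space \<Omega>.
     (INF A \<in> {A. A \<subseteq> {1..n} \<and> real (card A) > (1 - \<epsilon>) * real (card {1..n})}.
        packing_number ((\<lambda>i. min_eigenvector n (rs n (row_block n i) (RX \<omega>) (RY i \<omega>))) ` A) (euclid_dist n) \<epsilon>)
       \<ge> enat ((2 * nat \<lceil>1 / (\<epsilon> / (2 * sqrt (real K)))\<rceil> + 1) ^ K + 1)} \<le> ennreal \<delta>"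
    (is "outer_measure_of \<Omega> ?Bad \<le> _")
proof -
  have n1: "n \<ge> 1" using n by simp
  interpret \<Omega>: prob_space \<Omega> by fact
  interpret mu: prob_space "mu n" by (rule prob_space_mu)
  let ?V = "{1..n}" and ?r = "sqrt (real n)"
  have r: "?r > 0" "?r * ?r = real n" using n by auto
  \<comment> \<open>Markov's inequality at level \<open>L * sqrt n\<close> gives
    \<open>\<delta> / 4\<close>. A total excess below \<open>L * sqrt n\<close> leaves at most
    \<open>\<epsilon> * n / 2\<close> rows above \<open>\<eta>\<close>. The window
    \<open>\<tau> / sqrt n\<close> is tuned so that \<open>\<eta>\<close> is
    \<open>\<epsilon>^2 / 16\<close> times it, the ratio that the counting of separated
    near-minimizers asks for.\<close>
  define L where "L = 4 * C / \<delta>"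
  define \<tau> where "\<tau> = 128 * C / (\<delta> * \<epsilon> ^ 3)"
  define \<eta> where "\<eta> = 2 * L / (\<epsilon> * ?r)"
  have L: "L > 0" using C \<delta> by (simp add: L_def)
  have \<tau>: "\<tau> > 0" using C \<delta> \<epsilon> by (simp add: \<tau>_def)
  have \<eta>: "\<eta> > 0" using L \<epsilon> r by (simp add: \<eta>_def)
  have \<eta>\<tau>: "\<eta> = \<tau> / ?r * (\<epsilon>\<^sup>2 / 16)"
    using \<epsilon> \<delta> r by (simp add: \<eta>_def \<tau>_def L_def power3_eq_cube power2_eq_square)
  \<comment> \<open>The first component of the exchanged pair is the resampled input, and resampling
    it with the second one restores the original. Thus the excess of \<open>S i\<close> measures the
    minimizer of the resampled input in the form of \<open>RX\<close>.\<close>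
  define S where "S i \<omega> = swap_coords (upper_indices n) (row_block n i) (RX \<omega>, RY i \<omega>)" for i \<omega>
  have S_meas [measurable]: "S i \<in> \<Omega> \<rightarrow>\<^sub>M mu2 n" if "i \<in> ?V" for i
    unfolding S_def using RY[OF that] by measurable
  have S_law: "distr \<Omega> (mu2 n) (S i) = mu2 n" if "i \<in> ?V" for i
  proof -
    have "distr \<Omega> (mu2 n) (S i) = distr (distr \<Omega> (mu2 n) (\<lambda>\<omega>. (RX \<omega>, RY i \<omega>))) (mu2 n) (swap_coords (upper_indices n) (row_block n i))"
      using RY[OF that] by (subst distr_distr) (auto simp: comp_def S_def[abs_def])
    then show ?thesis unfolding law[OF that] distr_swap_mu .
  qed
  have X_law: "distr \<Omega> (mu n) RX = mu n"
  proof -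
    have i: "1 \<in> ?V" using n by simp
    have "distr (distr \<Omega> (mu2 n) (\<lambda>\<omega>. (RX \<omega>, RY 1 \<omega>))) (mu n) fst = distr \<Omega> (mu n) RX"
      using RY[OF i] by (subst distr_distr) (auto simp: comp_def)
    then show ?thesis unfolding law[OF i] distr_fst_mu2 by simp
  qed
  define v where "v i \<omega> = min_eigenvector n (rs n (row_block n i) (RX \<omega>) (RY i \<omega>))" for i \<omega>
  define E where "E i \<omega> = excess n i (S i \<omega>)" for i \<omega>
  have E_eq: "AE \<omega> in \<Omega>. \<forall>i\<in>?V. E i \<omega> = qf n (RX \<omega>) (v i \<omega>) - lam n (RX \<omega>)"
  proof (rule AE_finite_allI)
    fix i assume i: "i \<in> ?V"
    have "AE z in distr \<Omega> (mu2 n) (S i). \<forall>i\<in>?V. \<forall>v. minimizer n (fst z) v \<longrightarrow>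
       excess n i z = qf n (rs n (row_block n i) (fst z) (snd z)) v - lam n (rs n (row_block n i) (fst z) (snd z))"
      unfolding S_law[OF i] by (rule AE_excess[OF n1])
    then have "AE \<omega> in \<Omega>. \<forall>i'\<in>?V. \<forall>v. minimizer n (fst (S i \<omega>)) v \<longrightarrow>
       excess n i' (S i \<omega>) = qf n (rs n (row_block n i') (fst (S i \<omega>)) (snd (S i \<omega>))) v - lam n (rs n (row_block n i') (fst (S i \<omega>)) (snd (S i \<omega>)))"
      by (rule AE_distrD[OF S_meas[OF i]])
    then show "AE \<omega> in \<Omega>. E i \<omega> = qf n (RX \<omega>) (v i \<omega>) - lam n (RX \<omega>)"
      using AE_space
    proof eventually_elim
      case (elim \<omega>)
      have orig: "rs n (row_block n i) (fst (S i \<omega>)) (snd (S i \<omega>)) = RX \<omega>"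
        unfolding S_def swap_coords_def using measurable_space[OF RX elim(2)] by (simp add: rs_swap_back)
      have "minimizer n (fst (S i \<omega>)) (v i \<omega>)"
        unfolding v_def S_def swap_coords_def using ex_minimizer_lam[OF n1] by simp
      then show ?case using bspec[OF elim(1) i] unfolding E_def orig by blast
    qed
  qed simp
  have E_hb: "has_bochner_integral \<Omega> (\<lambda>\<omega>. \<Sum>i\<in>?V. E i \<omega>) (\<Sum>i\<in>?V. \<integral>z. excess n i z \<partial>mu2 n)"
  proof (intro has_bochner_integral_sum)
    fix i assume i: "i \<in> ?V"
    have int: "integrable (mu2 n) (excess n i)" by (rule expected_excess(1)[OF n1 i])
    have m: "excess n i \<in> borel_measurable (mu2 n)" using int by auto
    show "has_bochner_integral \<Omega> (E i) (\<integral>z. excess n i z \<partial>mu2 n)"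
      unfolding E_def has_bochner_integral_iff
      using int integrable_distr_eq[OF S_meas[OF i] m] integral_distr[OF S_meas[OF i] m] unfolding S_law[OF i] by simp
  qed
  have E_int: "integrable \<Omega> (\<lambda>\<omega>. \<Sum>i\<in>?V. E i \<omega>)" "(\<integral>\<omega>. (\<Sum>i\<in>?V. E i \<omega>) \<partial>\<Omega>) \<le> C * ?r"
    using E_hb expected_excess(2)[OF n1 C(2)] C(3) by (auto simp: has_bochner_integral_iff)
  have v_unit: "ip n (v i \<omega>) (v i \<omega>) = 1" for i \<omega> unfolding v_def by (rule min_eigenvector_unit[OF n1])
  have E_nonneg: "AE \<omega> in \<Omega>. 0 \<le> (\<Sum>i\<in>?V. E i \<omega>)"
    using E_eq
  proof eventually_elim
    case (elim \<omega>)
    then show ?case using lam_le_unit[OF n1 v_unit, of "RX \<omega>"] by (intro sum_nonneg) auto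
  qed
  let ?G1 = "{\<omega> \<in> space \<Omega>. (\<Sum>i\<in>?V. E i \<omega>) \<ge> L * ?r}"
  have E_meas [measurable]: "(\<lambda>\<omega>. \<Sum>i\<in>?V. E i \<omega>) \<in> borel_measurable \<Omega>" using E_int(1) by auto
  have G1: "?G1 \<in> sets \<Omega>" "measure \<Omega> ?G1 \<le> \<delta> / 4"
  proof -
    show "?G1 \<in> sets \<Omega>" by measurable
    have "measure \<Omega> ?G1 \<le> (\<integral>\<omega>. (\<Sum>i\<in>?V. E i \<omega>) \<partial>\<Omega>) / (L * ?r)"
      by (rule integral_Markov_inequality_measure[OF E_int(1), of "{}"]) (use E_nonneg L r in auto)
    also have "\<dots> \<le> (C * ?r) / (L * ?r)" using E_int(2) L r by (intro divide_right_mono) auto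
    also have "\<dots> = \<delta> / 4" using r C(1) \<delta> by (simp add: L_def)
    finally show "measure \<Omega> ?G1 \<le> \<delta> / 4" .
  qed
  let ?A2 = "{x \<in> space (mu n). \<bar>lam n x\<bar> \<ge> L * ?r}"
  note [measurable] = measurable_lam[OF n1]
  have A2: "?A2 \<in> sets (mu n)" "measure (mu n) ?A2 \<le> \<delta> / 4"
  proof -
    show "?A2 \<in> sets (mu n)" by measurable
    have "measure (mu n) ?A2 \<le> (\<integral>x. \<bar>lam n x\<bar> \<partial>mu n) / (L * ?r)"
      by (rule integral_Markov_inequality_measure[of _ _ "{}"]) (use integrable_lam[OF n1] L r in auto)
    also have "(\<integral>x. \<bar>lam n x\<bar> \<partial>mu n) \<le> (\<integral>x. defect_bound n x \<partial>mu n)"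
    proof (intro integral_mono C integrable_abs integrable_lam n1)
      fix x
      have "0 \<le> sqrt (real n) + (\<Sum>i\<in>{1..n}. (x (i, i))\<^sup>2) / sqrt (real n)"
        by (intro add_nonneg_nonneg divide_nonneg_nonneg sum_nonneg) auto
      then show "\<bar>lam n x\<bar> \<le> defect_bound n x" unfolding defect_bound_def by linarith
    qed
    also have "\<dots> \<le> C * ?r" by (rule C(3))
    finally have "measure (mu n) ?A2 \<le> (C * ?r) / (L * ?r)" using L r by (simp add: divide_right_mono)
    also have "\<dots> = \<delta> / 4" using r C(1) \<delta> by (simp add: L_def)
    finally show "measure (mu n) ?A2 \<le> \<delta> / 4" .
  qed
  \<comment> \<open>Given by an existential over eigensystems, this set is not shown to be
    measurable; it is only covered by the measurable \<open>A3\<close>.\<close>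
  define B where "B = {x. \<bar>lam n x\<bar> \<le> L * ?r \<and> (\<exists>u \<mu>. eigsys n x (Suc K) u \<mu> \<and> (\<forall>a<Suc K. \<mu> a \<le> lam n x + \<tau> / ?r))}"
  have Bgain: "(\<Sum>i\<in>?V. resample_mean n i x - lam n x) \<le> - (L * ?r)" if x: "x \<in> space (mu n)" "x \<in> B" for x
  proof -
    obtain u \<mu> where u: "eigsys n x (Suc K) u \<mu>" "\<forall>a<Suc K. \<mu> a \<le> lam n x + \<tau> / ?r" and lx: "\<bar>lam n x\<bar> \<le> L * ?r"
      using x(2) unfolding B_def by blast
    have b: "1 / ?r > 0" "(1 / ?r)\<^sup>2 \<le> 3 / 4" "(1 / ?r)\<^sup>2 * (L * ?r) = L / ?r"
      using n r by (simp_all add: power_divide field_simps power2_eq_square)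
    have "(\<Sum>i\<in>?V. resample_mean n i x - lam n x) \<le> (\<Sum>i\<in>?V. - L / ?r)"
    proof (intro sum_mono)
      fix i assume i: "i \<in> ?V"
      have "resample_mean n i x \<le> lam n x + (1 / ?r)\<^sup>2 * (L * ?r) + \<tau> / ?r - 1 / ?r * (\<sigma> * sqrt (real K / fourth))"
        using u(2) \<tau> r by (intro resample_mean_gain[OF n1 x(1) i K(1) u(1) _ _ b(1,2) lx]) auto
      also have "\<dots> = lam n x + (L + \<tau> - \<sigma> * sqrt (real K / fourth)) / ?r"
        unfolding b(3) by (simp add: add_divide_distrib diff_divide_distrib)
      \<comment> \<open>The choice of \<open>K\<close> makes the gain at least
        \<open>2 * L + \<tau>\<close>, so each of the \<open>n\<close> rows lowers the mean by at
        least \<open>L / sqrt n\<close>.\<close>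
      also have "(L + \<tau> - \<sigma> * sqrt (real K / fourth)) / ?r \<le> - L / ?r"
        using K(2) r by (intro divide_right_mono) (auto simp: L_def \<tau>_def)
      finally show "resample_mean n i x - lam n x \<le> - L / ?r" by simp
    qed
    also have "\<dots> = - (L * (real n / ?r))" by simp
    also have "real n / ?r = ?r" by (simp add: real_div_sqrt)
    finally show ?thesis .
  qed
  obtain A3 where A3: "A3 \<in> sets (mu n)" "B \<inter> space (mu n) \<subseteq> A3" "measure (mu n) A3 \<le> C * ?r / (L * ?r)"
    using prob_many_eigenvalues[OF n1 C(3,2) _ Bgain] L r by (metis mult_pos_pos)
  have A3': "measure (mu n) A3 \<le> \<delta> / 4" using A3(3) r C(1) \<delta> by (simp add: L_def)
  define G2 where "G2 = RX -` (?A2 \<union> A3) \<inter> space \<Omega>"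
  have G2: "G2 \<in> sets \<Omega>" "measure \<Omega> G2 \<le> \<delta> / 2"
  proof -
    show "G2 \<in> sets \<Omega>" unfolding G2_def using A2(1) A3(1) by (intro measurable_sets[OF RX]) auto
    have "measure \<Omega> G2 = measure (distr \<Omega> (mu n) RX) (?A2 \<union> A3)"
      unfolding G2_def using A2(1) A3(1) by (subst measure_distr) auto
    also have "\<dots> \<le> measure (mu n) ?A2 + measure (mu n) A3"
      unfolding X_law using A2(1) A3(1) by (intro measure_Un_le) auto
    finally show "measure \<Omega> G2 \<le> \<delta> / 2" using A2(2) A3' by simp
  qed
  obtain N where N: "{\<omega> \<in> space \<Omega>. \<not> (\<forall>i\<in>?V. E i \<omega> = qf n (RX \<omega>) (v i \<omega>) - lam n (RX \<omega>))} \<subseteq> N"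
    "emeasure \<Omega> N = 0" "N \<in> sets \<Omega>"
    using E_eq by (rule AE_E)
  have good: "(INF A \<in> {A. A \<subseteq> ?V \<and> real (card A) > (1 - \<epsilon>) * real (card ?V)}.
        packing_number ((\<lambda>i. v i \<omega>) ` A) (euclid_dist n) \<epsilon>) \<le> enat ((2 * nat \<lceil>1 / (\<epsilon> / (2 * sqrt (real K)))\<rceil> + 1) ^ K)"
    if w: "\<omega> \<in> space \<Omega>" "\<omega> \<notin> ?G1" "\<omega> \<notin> G2" "\<omega> \<notin> N" for \<omega>
  proof -
    define x where "x = RX \<omega>"
    have xs: "x \<in> space (mu n)" unfolding x_def using measurable_space[OF RX w(1)] .
    have Eq: "E i \<omega> = qf n x (v i \<omega>) - lam n x" if "i \<in> ?V" for i
      using w(1,4) N(1) that unfolding x_def by blast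
    have E0: "0 \<le> E i \<omega>" if "i \<in> ?V" for i
      using lam_le_unit[OF n1 v_unit, of x] unfolding Eq[OF that] by simp
    have sumE: "(\<Sum>i\<in>?V. E i \<omega>) \<le> \<eta> * (\<epsilon> / 2 * real n)"
    proof -
      have "\<eta> * (\<epsilon> / 2 * real n) = L * (real n / ?r)" using \<epsilon> by (simp add: \<eta>_def)
      also have "real n / ?r = ?r" by (simp add: real_div_sqrt)
      finally show ?thesis using w(1,2) by simp
    qed
    define A where "A = {i \<in> ?V. E i \<omega> \<le> \<eta>}"
    have "real (card A) \<ge> real (card ?V) - \<epsilon> / 2 * real n"
      unfolding A_def by (rule card_large_values[OF E0 _ sumE \<eta>]) auto
    moreover have "\<epsilon> / 2 * real n < \<epsilon> * real n" using \<epsilon> n by simp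
    ultimately have cardA: "real (card A) > (1 - \<epsilon>) * real (card ?V)" by (simp add: algebra_simps)
    have xB: "\<bar>lam n x\<bar> < L * ?r" "x \<notin> B"
      using w(1,3) xs A3(2) unfolding G2_def x_def[symmetric] by (auto simp: x_def[symmetric])
    have "packing_number ((\<lambda>i. v i \<omega>) ` A) (euclid_dist n) \<epsilon> \<le> enat ((2 * nat \<lceil>1 / (\<epsilon> / (2 * sqrt (real K)))\<rceil> + 1) ^ K)"
    proof (rule packing_number_le)
      fix T assume T: "T \<subseteq> (\<lambda>i. v i \<omega>) ` A" "finite T" "pairwise (\<lambda>x y. euclid_dist n x y > \<epsilon>) T"
      show "card T \<le> (2 * nat \<lceil>1 / (\<epsilon> / (2 * sqrt (real K)))\<rceil> + 1) ^ K"
      proof (rule eig_dichotomy[OF n1, where x = x and k = "Suc K" and \<theta> = "lam n x + \<tau> / ?r"])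
        fix u \<mu> assume "eigsys n x (Suc K) u \<mu>" "\<And>a. a < Suc K \<Longrightarrow> \<mu> a \<le> lam n x + \<tau> / ?r"
        then have "x \<in> B" using xB(1) unfolding B_def by (auto intro!: exI[of _ u] exI[of _ \<mu>])
        then show ?thesis using xB(2) by simp
      next
        fix d u \<mu> assume d: "d < Suc K" "eigsys n x d u \<mu>"
          "\<And>r. (\<And>a. a < d \<Longrightarrow> ip n (u a) r = 0) \<Longrightarrow> (lam n x + \<tau> / ?r) * ip n r r \<le> qf n x r"
        show ?thesis
        proof (rule separated_near_minimizers_card[OF n1 d(2) _ d(3)])
          show "d \<le> K" using d(1) by simp
          show "lam n x < lam n x + \<tau> / ?r" using \<tau> r by simp
          show "\<eta> \<le> (lam n x + \<tau> / ?r - lam n x) * (\<epsilon>\<^sup>2 / 16)" unfolding \<eta>\<tau> by simp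
          show "0 < \<epsilon> / (2 * sqrt (real K))" using \<epsilon> K(1) by simp
          show "real K * (\<epsilon> / (2 * sqrt (real K)))\<^sup>2 \<le> \<epsilon>\<^sup>2 / 4"
            using K(1) by (simp add: power_divide power_mult_distrib)
          show "ip n t t = 1 \<and> qf n x t \<le> lam n x + \<eta>" if t: "t \<in> T" for t
          proof -
            obtain i where i: "i \<in> A" "t = v i \<omega>" using t T(1) by auto
            then have "E i \<omega> \<le> \<eta>" "i \<in> ?V" by (auto simp: A_def)
            then show ?thesis using Eq[of i] v_unit[of i \<omega>] i by simp
          qed
        qed (use \<epsilon> T(3) in auto)
      qed
    qed
    then show ?thesis using cardA by (intro INF_lower2[of A]) (auto simp: A_def)
  qed
  have sub: "?Bad \<subseteq> ?G1 \<union> G2 \<union> N"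
  proof
    fix \<omega> assume w: "\<omega> \<in> ?Bad"
    show "\<omega> \<in> ?G1 \<union> G2 \<union> N"
    proof (rule ccontr)
      assume nin: "\<omega> \<notin> ?G1 \<union> G2 \<union> N"
      let ?M = "(2 * nat \<lceil>1 / (\<epsilon> / (2 * sqrt (real K)))\<rceil> + 1) ^ K"
      have "enat (?M + 1) \<le> (INF A \<in> {A. A \<subseteq> ?V \<and> real (card A) > (1 - \<epsilon>) * real (card ?V)}.
        packing_number ((\<lambda>i. v i \<omega>) ` A) (euclid_dist n) \<epsilon>)"
        using w unfolding v_def by simp
      also have "\<dots> \<le> enat ?M" using w nin by (intro good) auto
      finally show False by simp
    qed
  qed
  have "outer_measure_of \<Omega> ?Bad \<le> emeasure \<Omega> (?G1 \<union> G2 \<union> N)"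
    using outer_measure_of_mono[OF sub, of \<Omega>] G1(1) G2(1) N(3) by simp
  also have "\<dots> \<le> emeasure \<Omega> ?G1 + emeasure \<Omega> G2 + emeasure \<Omega> N"
    using G1(1) G2(1) N(3) by (intro order_trans[OF emeasure_subadditive] add_mono emeasure_subadditive) auto
  also have "\<dots> = ennreal (measure \<Omega> ?G1 + measure \<Omega> G2)"
    unfolding N(2) by (simp add: \<Omega>.emeasure_eq_measure ennreal_plus)
  also have "\<dots> \<le> ennreal \<delta>" using G1(2) G2(2) \<delta> by (intro ennreal_leI) linarith
  finally show ?thesis .
qed

lemma packing_threshold:
  "\<exists>K::nat. K \<ge> 1 \<and> R \<le> \<sigma> * sqrt (real K / fourth)"
proof -
  define s where "s = max R 0 / \<sigma>"
  obtain k :: nat where k: "fourth * s\<^sup>2 \<le> real k" using real_arch_simple by blast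
  have "s\<^sup>2 \<le> real (Suc k) / fourth" using k fourth_pos by (simp add: le_divide_eq mult.commute)
  then have "s \<le> sqrt (real (Suc k) / fourth)" by (rule real_le_rsqrt)
  then have "\<sigma> * s \<le> \<sigma> * sqrt (real (Suc k) / fourth)" using sigma_pos by (intro mult_left_mono) auto
  moreover have "\<sigma> * s = max R 0" using sigma_pos by (simp add: s_def)
  ultimately show ?thesis by (intro exI[of _ "Suc k"]) auto
qed

end

text \<open>The moment bound for \<open>k = 1\<close> forces \<open>\<sigma> \<ge> 0\<close>, and
  \<open>\<sigma> = 0\<close> would concentrate the law at 0, against the absence of atoms that the
  density provides.\<close>

lemma wigner_inputI:
  fixes P :: "real measure" and f :: "real \<Rightarrow> real" and \<sigma> \<beta> :: real
  assumes prob_P: "prob_space P"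
    and density: "f \<in> borel_measurable borel" "P = density lborel (\<lambda>x. ennreal (f x))"
    and mean: "prob_space.expectation P (\<lambda>x. x) = 0"
    and var: "prob_space.variance P (\<lambda>x. x) = \<sigma>\<^sup>2"
    and moments: "\<And>k::nat. k \<ge> 1 \<Longrightarrow> integrable P (\<lambda>x. \<bar>x\<bar> ^ k) \<and>
      prob_space.expectation P (\<lambda>x. \<bar>x\<bar> ^ k) \<le> \<sigma> ^ k * real k powr (\<beta> * real k)"
  shows "wigner_input P \<sigma>"
proof -
  interpret prob_space P by fact
  have sets [measurable_cong]: "sets P = sets borel" unfolding density(2) by simp
  have atomless: "emeasure P {t} = 0" for t
  proof -
    have "{t} \<in> null_sets lborel" by (simp add: null_sets_def)
    then have "AE x in lborel. x \<notin> {t}" by (rule AE_not_in)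
    then have ae: "AE x in lborel. x \<in> {t} \<longrightarrow> ennreal (f x) = 0" by eventually_elim simp
    have fm: "(\<lambda>x. ennreal (f x)) \<in> borel_measurable lborel" using density(1) by simp
    have "{t} \<in> null_sets P"
      unfolding density(2) null_sets_density_iff[OF fm] by (intro conjI ae) simp
    then show ?thesis by (rule null_setsD1)
  qed
  have ipow: "integrable P (\<lambda>x. x ^ k)" for k
  proof (cases "k = 0")
    case False
    then have "integrable P (\<lambda>x. \<bar>x\<bar> ^ k)" using moments[of k] by simp
    then show ?thesis
      by (rule Bochner_Integration.integrable_bound) (auto simp: power_abs sets)
  qed simp
  have m2: "(\<integral>x. x\<^sup>2 \<partial>P) = \<sigma>\<^sup>2" using var mean by simp
  have "0 \<le> (\<integral>x. \<bar>x\<bar> ^ 1 \<partial>P)" by simp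
  also have "\<dots> \<le> \<sigma>" using moments[of 1] by simp
  finally have s0: "\<sigma> \<ge> 0" .
  have "\<sigma> \<noteq> 0"
  proof
    assume "\<sigma> = 0"
    then have "(\<integral>x. x\<^sup>2 \<partial>P) = 0" using m2 by simp
    then have "AE x in P. x\<^sup>2 = 0" using ipow[of 2] by (subst (asm) integral_nonneg_eq_0_iff_AE) auto
    then have "AE x in P. x \<in> {0}" by simp
    then have "emeasure P {0} = 1"
      using emeasure_eq_1_AE[of "{0}"] by (simp add: sets)
    then show False using atomless[of 0] by simp
  qed
  show ?thesis
    by unfold_locales (use sets ipow mean m2 s0 \<open>\<sigma> \<noteq> 0\<close> atomless in auto)
qed

theorem theorem3p6p7:
  fixes M :: "nat \<Rightarrow> 'w measure"
    and P :: "real measure" and f :: "real \<Rightarrow> real" and \<sigma> \<beta> :: real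
    and X :: "nat \<Rightarrow> nat \<times> nat \<Rightarrow> 'w \<Rightarrow> real"
    and Y :: "nat \<Rightarrow> nat \<Rightarrow> nat \<times> nat \<Rightarrow> 'w \<Rightarrow> real"
  assumes prob_M: "\<And>n. prob_space (M n)"
    and prob_P: "prob_space P"
    and density: "f \<in> borel_measurable borel" "\<And>x. f x \<ge> 0"
      "P = density lborel (\<lambda>x. ennreal (f x))"
    and mean: "prob_space.expectation P (\<lambda>x. x) = 0"
    and var: "prob_space.variance P (\<lambda>x. x) = \<sigma>\<^sup>2"
    and beta: "\<beta> > 0"
    and moments: "\<And>k::nat. k \<ge> 1 \<Longrightarrow> integrable P (\<lambda>x. \<bar>x\<bar> ^ k) \<and>
      prob_space.expectation P (\<lambda>x. \<bar>x\<bar> ^ k) \<le> \<sigma> ^ k * real k powr (\<beta> * real k)"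
    and indep: "\<And>n. prob_space.indep_vars (M n) (\<lambda>_. borel) (X n) (upper_indices n)"
    and ident: "\<And>n p. p \<in> upper_indices n \<Longrightarrow> distr (M n) borel (X n p) = P"
    and copies: "\<And>n i. i \<in> {1..n} \<Longrightarrow>
      independent_copy (M n) (upper_indices n) (X n) (Y n i)"
  shows "stable_under_small_perturbations M upper_indices (\<lambda>n. {1..n}) row_block
           euclid_dist min_eigenvector X Y"
proof -
  interpret wigner_input P \<sigma>
    using prob_P density(1,3) mean var moments by (rule wigner_inputI)
  have blocks: "perturbation_blocks (upper_indices n) {1..n} (row_block n)" for n
    unfolding perturbation_blocks_def
  proof (intro conjI equalityI subsetI)
    fix e assume "e \<in> upper_indices n"
    then have "fst e \<in> {1..n} \<and> e \<in> row_block n (fst e)"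
      by (auto simp: upper_indices_def row_block_def)
    then show "e \<in> (\<Union>i\<in>{1..n}. row_block n i)" by blast
  next
    fix e assume "e \<in> (\<Union>i\<in>{1..n}. row_block n i)"
    then show "e \<in> upper_indices n" using row_block_subset by (elim UN_E) (rule subsetD)
  qed simp
  obtain C where C: "C > 0" "\<And>n. n \<ge> 1 \<Longrightarrow> integrable (mu n) (defect_bound n)"
    "\<And>n. n \<ge> 1 \<Longrightarrow> (\<integral>x. defect_bound n x \<partial>mu n) \<le> C * sqrt (real n)"
    using expected_defect_bound by blast
  have "\<exists>K'::nat. limsup (\<lambda>n. outer_measure_of (M n) {\<omega> \<in> space (M n).
      min_packing_of_optima (upper_indices n) {1..n} (row_block n) (euclid_dist n) (min_eigenvector n) (X n) (Y n) \<epsilon> \<omega> \<ge> enat K'})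
        \<le> ennreal \<delta>" if \<epsilon>: "\<epsilon> > 0" and \<delta>: "\<delta> > 0" for \<epsilon> \<delta> :: real
  proof -
    obtain K where K: "K \<ge> 1" "8 * C / \<delta> + 128 * C / (\<delta> * \<epsilon> ^ 3) \<le> \<sigma> * sqrt (real K / fourth)"
      using packing_threshold by blast
    \<comment> \<open>One more than the packing bound, because the event in the definition of
      stability is non-strict.\<close>
    define K' where "K' = (2 * nat \<lceil>1 / (\<epsilon> / (2 * sqrt (real K)))\<rceil> + 1) ^ K + 1"
    have "outer_measure_of (M n) {\<omega> \<in> space (M n).
      min_packing_of_optima (upper_indices n) {1..n} (row_block n) (euclid_dist n) (min_eigenvector n) (X n) (Y n) \<epsilon> \<omega> \<ge> enat K'}
        \<le> ennreal \<delta>" if n: "n \<ge> 2" for n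
    proof -
      interpret Mn: prob_space "M n" by (rule prob_M)
      let ?I = "upper_indices n"
      let ?B = "PiM ?I (\<lambda>_. borel :: real measure)"
      let ?RX = "random_vector ?I (X n)" and ?RY = "\<lambda>i. random_vector ?I (Y n i)"
      \<comment> \<open>\<open>mu\<close> is a product of copies of \<open>P\<close>, whereas the
        random vectors take values in a product of Borel spaces; the sigma-algebras agree.\<close>
      have sets_mu: "sets (mu n) = sets ?B" unfolding mu_def by (rule sets_PiM_cong) auto
      have sets_mu2: "sets (mu2 n) = sets (?B \<Otimes>\<^sub>M ?B)" by (intro sets_pair_measure_cong sets_mu)
      have ne: "?I \<noteq> {}" using n by (auto simp: upper_indices_def intro!: exI[of _ 1])
      have rv: "X n p \<in> borel_measurable (M n)" if "p \<in> ?I" for p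
        using indep[of n] that unfolding Mn.indep_vars_def by blast
      have "distr (M n) ?B (\<lambda>\<omega>. \<lambda>p\<in>?I. X n p \<omega>) = PiM ?I (\<lambda>p. distr (M n) borel (X n p))"
        using indep[of n] Mn.indep_vars_iff_distr_eq_PiM'[where X = "X n" and M' = "\<lambda>_. borel" and I = ?I, OF ne rv]
        by blast
      also have "\<dots> = mu n" unfolding mu_def using ident by (intro PiM_cong) auto
      finally have RX_law: "distr (M n) ?B ?RX = mu n" by (simp add: random_vector_def[abs_def])
      have ind: "Mn.indep_var ?B ?RX ?B (?RY i)" and RY_law: "distr (M n) ?B (?RY i) = mu n" if "i \<in> {1..n}" for i
        using copies[OF that] RX_law unfolding independent_copy_def by auto
      have RXm: "?RX \<in> M n \<rightarrow>\<^sub>M mu n"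
        using Mn.indep_var_rv1[OF ind, of 1] n by (simp add: measurable_cong_sets[OF refl sets_mu])
      have RYm: "?RY i \<in> M n \<rightarrow>\<^sub>M mu n" if "i \<in> {1..n}" for i
        using Mn.indep_var_rv2[OF ind[OF that]] by (simp add: measurable_cong_sets[OF refl sets_mu])
      have law: "distr (M n) (mu2 n) (\<lambda>\<omega>. (?RX \<omega>, ?RY i \<omega>)) = mu2 n" if i: "i \<in> {1..n}" for i
      proof -
        have "distr (M n) (mu2 n) (\<lambda>\<omega>. (?RX \<omega>, ?RY i \<omega>)) = distr (M n) (?B \<Otimes>\<^sub>M ?B) (\<lambda>\<omega>. (?RX \<omega>, ?RY i \<omega>))"
          by (intro distr_cong sets_mu2 refl)
        also have "\<dots> = distr (M n) ?B ?RX \<Otimes>\<^sub>M distr (M n) ?B (?RY i)"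
          using ind[OF i] unfolding Mn.indep_var_distribution_eq by simp
        finally show ?thesis unfolding RX_law RY_law[OF i] .
      qed
      have n1: "n \<ge> 1" using n by simp
      show ?thesis
        unfolding min_packing_of_optima_def random_vector_resample K'_def
        by (rule stability_event[OF n prob_M RXm RYm law C(1) C(2)[OF n1] C(3)[OF n1] \<epsilon> \<delta> K])
    qed
    \<comment> \<open>The limit superior ignores the indices below 2.\<close>
    then show ?thesis
      by (intro exI[of _ K'] Limsup_bounded) (auto simp: eventually_sequentially)
  qed
  with blocks show ?thesis unfolding stable_under_small_perturbations_def by blast
qed

end
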